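(* Let $n\ge 2$ and let $\mathbb{K}$ be a perfect field of characteristic $p>n$. (1) Let $\mathcal{S}\subset\mathbb{P}^n$ be an absolutely irreducible nondegenerate hypersurface defined over $\mathbb{K}$, and let $\mathcal{X}\subset\mathcal{S}$ be a curve defined over $\mathbb{K}$ such that (i) $\mathcal{X}$ is not contained in the singular locus $\operatorname{Sing}(\mathcal{S})$ of $\mathcal{S}$, and (ii) the restriction to $\mathcal{X}$ of the Gauss map of $\mathcal{S}$ is inseparable. Then $\mathcal{X}$ is nonclassical. (2) Conversely, if $\mathbb{K}$ is algebraically closed (of characteristic $p>n$), then every nonclassical curve $\mathcal{X}\subset\mathbb{P}^n$ defined over $\mathbb{K}$ is contained in a (not necessarily unique) hypersurface $\mathcal{S}\subset\mathbb{P}^n$ whose Gauss map admits $p$-powers as coordinate functions, and such that $\mathcal{X}\not\subset\operatorname{Sing}(\mathcal{S})$.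
   Context: Varieties are projective and geometrically irreducible. A curve in $\mathbb{P}^n$ is such a variety of dimension $1$ which is nondegenerate, i.e. not contained in any hyperplane; it may be singular. A hypersurface is such a variety of dimension $n-1$. Order sequence: let $\mathcal{X}\subset\mathbb{P}^n$ be a curve with coordinate functions $y_0,\dots,y_n\in\mathbb{K}(\mathcal{X})$ (residues of the $X_i/X_j$ for a fixed $X_j$ not vanishing identically on $\mathcal{X}$), let $\zeta$ be a separating element of the function field and $D_\zeta^{(k)}$ the $k$-th Hasse derivative with respect to $\zeta$. The order sequence of $\mathcal{X}$ is the lexicographically minimal sequence $0\le\varepsilon_0<\dots<\varepsilon_n$ with $\det\bigl(D_\zeta^{(\varepsilon_i)}y_j\bigr)_{0\le i,j\le n}\neq 0$. The curve is classical if $(\varepsilon_0,\dots,\varepsilon_n)=(0,1,\dots,n)$, and nonclassical otherwise. Gauss map: if $\mathcal{S}$ is defined by the homogeneous polynomial $F$, its Gauss map is the rational map $\Gamma$ from $\mathcal{S}$ to the dual projective space $(\mathbb{P}^n)'$ sending a nonsingular point $P$ to the dual of the tangent hyperplane $T_P(\mathcal{S})$, i.e. $\Gamma=(F_0:\dots:F_n)$, where $F_i$ is the function induced on $\mathcal{S}$ by $\partial F/\partial X_i$. "$\Gamma$ admits $p$-powers as coordinate functions" means $\Gamma=(U_0^{p}:\dots:U_n^{p})$ for some $U_i\in\mathbb{K}(\mathcal{S})$. A rational map is inseparable if the extension of function fields of the source over that of the closure of the image is not separable. *)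

theory Defs
  imports
    "HOL-Library.Poly_Mapping"
    "HOL-Combinatorics.Permutations"
    "HOL-Computational_Algebra.Fraction_Field"
    "HOL-Algebra.Generated_Fields"
    "HOL-Algebra.QuotRing"
    "HOL-Algebra.Algebraic_Closure_Type"
begin

definition perfect_field :: "'k::field itself \<Rightarrow> bool" where
  "perfect_field _ \<longleftrightarrow> CHAR('k) = 0 \<or> surj (\<lambda>x::'k. x ^ CHAR('k))"

definition alg_closed_type :: "'k::field itself \<Rightarrow> bool" where
  "alg_closed_type _ \<longleftrightarrow>
     (\<forall>f::'k poly. 0 < Polynomial.degree f \<longrightarrow> (\<exists>x. poly f x = 0))"


section \<open>Polynomials and forms in the variables with index at most n\<close>

type_synonym 'a mpoly = "(nat \<Rightarrow>\<^sub>0 nat) \<Rightarrow>\<^sub>0 'a"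

definition polys :: "nat \<Rightarrow> 'a::zero mpoly set" where
  "polys n = {F. \<forall>m\<in>Poly_Mapping.keys F. Poly_Mapping.keys m \<subseteq> {..n}}"

definition forms :: "nat \<Rightarrow> nat \<Rightarrow> 'a::zero mpoly set" where
  "forms n d = {F \<in> polys n. \<forall>m\<in>Poly_Mapping.keys F.
     (\<Sum>i\<in>Poly_Mapping.keys m. Poly_Mapping.lookup m i) = d}"

definition mconst :: "'a::zero \<Rightarrow> 'a mpoly" where
  "mconst c = Poly_Mapping.single 0 c"

definition mvar :: "nat \<Rightarrow> 'a::zero_neq_one mpoly" where
  "mvar i = Poly_Mapping.single (Poly_Mapping.single i 1) 1"

definition meval :: "'a::comm_semiring_1 mpoly \<Rightarrow> (nat \<Rightarrow> 'a) \<Rightarrow> 'a" where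
  "meval F x = (\<Sum>m\<in>Poly_Mapping.keys F. Poly_Mapping.lookup F m *
     (\<Prod>i\<in>Poly_Mapping.keys m. x i ^ Poly_Mapping.lookup m i))"

definition mderiv :: "nat \<Rightarrow> 'a::comm_semiring_1 mpoly \<Rightarrow> 'a mpoly" where
  "mderiv i F = (\<Sum>m\<in>Poly_Mapping.keys F.
     Poly_Mapping.single (m - Poly_Mapping.single i 1)
       (of_nat (Poly_Mapping.lookup m i) * Poly_Mapping.lookup F m))"

definition base_change :: "'k::field mpoly \<Rightarrow> 'k alg_closure mpoly" where
  "base_change F = Poly_Mapping.map to_ac F"


section \<open>Projective varieties over a field\<close>

text \<open>
  Points are points over the algebraic closure of the ground field; a projective point is the class
  of its vectors of homogeneous coordinates, which are extended by zero beyond the index n.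
\<close>

definition proj_vecs :: "nat \<Rightarrow> (nat \<Rightarrow> 'a::field) set" where
  "proj_vecs n = {x. (\<forall>i>n. x i = 0) \<and> (\<exists>i\<le>n. x i \<noteq> 0)}"

definition proj_space :: "nat \<Rightarrow> (nat \<Rightarrow> 'a::field) set set" where
  "proj_space n = proj_vecs n //
     {(x, y). x \<in> proj_vecs n \<and> y \<in> proj_vecs n \<and> (\<exists>c. c \<noteq> 0 \<and> y = (\<lambda>i. c * x i))}"

definition vanishes_at :: "'a::field mpoly \<Rightarrow> (nat \<Rightarrow> 'a) set \<Rightarrow> bool" where
  "vanishes_at F P \<longleftrightarrow> (\<forall>x\<in>P. meval F x = 0)"

definition zero_locus :: "nat \<Rightarrow> 'a::field mpoly set \<Rightarrow> (nat \<Rightarrow> 'a) set set" where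
  "zero_locus n T = {P \<in> proj_space n. \<forall>F\<in>T. vanishes_at F P}"

definition zariski_closed :: "nat \<Rightarrow> (nat \<Rightarrow> 'a::field) set set \<Rightarrow> bool" where
  "zariski_closed n A \<longleftrightarrow> (\<exists>T \<subseteq> (\<Union>d. forms n d). A = zero_locus n T)"

definition zariski_irreducible :: "nat \<Rightarrow> (nat \<Rightarrow> 'a::field) set set \<Rightarrow> bool" where
  "zariski_irreducible n Z \<longleftrightarrow> Z \<noteq> {} \<and>
     (\<forall>A B. zariski_closed n A \<and> zariski_closed n B \<and> Z \<subseteq> A \<union> B \<longrightarrow> Z \<subseteq> A \<or> Z \<subseteq> B)"

text \<open>
  Projective, geometrically irreducible and defined over the field \<open>'k\<close>.
\<close>

definition variety :: "nat \<Rightarrow> (nat \<Rightarrow> 'k::field alg_closure) set set \<Rightarrow> bool" where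
  "variety n Z \<longleftrightarrow>
     (\<exists>T \<subseteq> (\<Union>d. forms n d :: 'k mpoly set). Z = zero_locus n (base_change ` T)) \<and>
     zariski_irreducible n Z"

definition nondegenerate :: "nat \<Rightarrow> (nat \<Rightarrow> 'a::field) set set \<Rightarrow> bool" where
  "nondegenerate n Z \<longleftrightarrow> \<not> (\<exists>L \<in> forms n 1. L \<noteq> 0 \<and> Z \<subseteq> zero_locus n {L})"

definition vanishes_on ::
    "'k::field mpoly \<Rightarrow> (nat \<Rightarrow> 'k alg_closure) set set \<Rightarrow> bool" where
  "vanishes_on F Z \<longleftrightarrow> (\<forall>P\<in>Z. vanishes_at (base_change F) P)"


section \<open>Function fields\<close>

text \<open>
  The function field over \<open>'k\<close> is the residue field of the local ring of \<open>Z\<close>, which consists of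
  the quotients of forms of equal degree over \<open>'k\<close> whose denominator does not vanish identically
  on \<open>Z\<close>.
\<close>

definition local_ring ::
    "nat \<Rightarrow> (nat \<Rightarrow> 'k::field alg_closure) set set \<Rightarrow> 'k mpoly fract ring" where
  "local_ring n Z =
     \<lparr> carrier = {Fract G H | G H d. G \<in> forms n d \<and> H \<in> forms n d \<and> \<not> vanishes_on H Z},
       monoid.mult = (*), one = 1, ring.zero = 0, add = (+) \<rparr>"

definition local_ideal ::
    "nat \<Rightarrow> (nat \<Rightarrow> 'k::field alg_closure) set set \<Rightarrow> 'k mpoly fract set" where
  "local_ideal n Z =
     {Fract G H | G H d. G \<in> forms n d \<and> H \<in> forms n d \<and> vanishes_on G Z \<and> \<not> vanishes_on H Z}"

definition function_field ::
    "nat \<Rightarrow> (nat \<Rightarrow> 'k::field alg_closure) set set \<Rightarrow> 'k mpoly fract set ring" where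
  "function_field n Z = local_ring n Z Quot local_ideal n Z"

definition ratio :: "nat \<Rightarrow> (nat \<Rightarrow> 'k::field alg_closure) set set \<Rightarrow>
    'k mpoly \<Rightarrow> 'k mpoly \<Rightarrow> 'k mpoly fract set" where
  "ratio n Z G H = local_ideal n Z +>\<^bsub>local_ring n Z\<^esub> Fract G H"

definition constants ::
    "nat \<Rightarrow> (nat \<Rightarrow> 'k::field alg_closure) set set \<Rightarrow> 'k mpoly fract set set" where
  "constants n Z = range (\<lambda>c. ratio n Z (mconst c) 1)"


section \<open>Field extensions\<close>

text \<open>
  Here \<open>R\<close> is a field and \<open>L\<close> a subfield of it.
\<close>

definition alg_independent :: "('a, 'b) ring_scheme \<Rightarrow> 'a set \<Rightarrow> 'a set \<Rightarrow> bool" where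
  "alg_independent R L B \<longleftrightarrow>
     (\<forall>(M :: ('a \<Rightarrow>\<^sub>0 nat) set) c. finite M \<and> (\<forall>m\<in>M. Poly_Mapping.keys m \<subseteq> B \<and> c m \<in> L) \<and>
        (\<Oplus>\<^bsub>R\<^esub>m\<in>M. c m \<otimes>\<^bsub>R\<^esub>
           (\<Otimes>\<^bsub>R\<^esub>b\<in>Poly_Mapping.keys m. b [^]\<^bsub>R\<^esub> Poly_Mapping.lookup m b)) = \<zero>\<^bsub>R\<^esub>
        \<longrightarrow> (\<forall>m\<in>M. c m = \<zero>\<^bsub>R\<^esub>))"

definition has_transcendence_degree ::
    "('a, 'b) ring_scheme \<Rightarrow> 'a set \<Rightarrow> nat \<Rightarrow> bool" where
  "has_transcendence_degree R L d \<longleftrightarrow>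
     (\<exists>B \<subseteq> carrier R. finite B \<and> card B = d \<and> alg_independent R L B \<and>
        (\<forall>x\<in>carrier R. ring.algebraic R (generate_field R (L \<union> B)) x))"

text \<open>
  Polynomials over \<open>R\<close> are lists of coefficients with the leading coefficient first.
\<close>

definition formal_deriv :: "('a, 'b) ring_scheme \<Rightarrow> 'a list \<Rightarrow> 'a list" where
  "formal_deriv R f = ring.normalize R
     (map (\<lambda>i. add_pow R (length f - 1 - i) (f ! i)) [0..<length f - 1])"

definition separable_element :: "('a, 'b) ring_scheme \<Rightarrow> 'a set \<Rightarrow> 'a \<Rightarrow> bool" where
  "separable_element R L x \<longleftrightarrow> ring.algebraic R L x \<and>
     (let f = ring.Irr R L x; P = univ_poly R L in
        \<exists>a \<in> carrier P. \<exists>b \<in> carrier P.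
          a \<otimes>\<^bsub>P\<^esub> f \<oplus>\<^bsub>P\<^esub> b \<otimes>\<^bsub>P\<^esub> formal_deriv R f = \<one>\<^bsub>P\<^esub>)"

text \<open>
  Separability of a finitely generated, not necessarily algebraic extension: existence of a
  separating transcendence basis (the empty one if the extension is algebraic).
\<close>

definition separable_extension :: "('a, 'b) ring_scheme \<Rightarrow> 'a set \<Rightarrow> bool" where
  "separable_extension R L \<longleftrightarrow>
     (\<exists>B \<subseteq> carrier R. alg_independent R L B \<and>
        (\<forall>x\<in>carrier R. separable_element R (generate_field R (L \<union> B)) x))"


section \<open>Curves, hypersurfaces and rational maps\<close>

definition has_dimension ::
    "nat \<Rightarrow> (nat \<Rightarrow> 'k::field alg_closure) set set \<Rightarrow> nat \<Rightarrow> bool" where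
  "has_dimension n Z d \<longleftrightarrow> has_transcendence_degree (function_field n Z) (constants n Z) d"

definition curve :: "nat \<Rightarrow> (nat \<Rightarrow> 'k::field alg_closure) set set \<Rightarrow> bool" where
  "curve n Z \<longleftrightarrow> variety n Z \<and> has_dimension n Z 1 \<and> nondegenerate n Z"

definition hypersurface :: "nat \<Rightarrow> (nat \<Rightarrow> 'k::field alg_closure) set set \<Rightarrow> bool" where
  "hypersurface n S \<longleftrightarrow> variety n S \<and> has_dimension n S (n - 1)"

text \<open>
  The equation \<open>F\<close> of a hypersurface is reduced: it generates the homogeneous ideal over \<open>'k\<close>.
\<close>

definition defined_by ::
    "nat \<Rightarrow> (nat \<Rightarrow> 'k::field alg_closure) set set \<Rightarrow> 'k mpoly \<Rightarrow> bool" where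
  "defined_by n S F \<longleftrightarrow> (\<exists>d. F \<in> forms n d) \<and>
     {G \<in> polys n. vanishes_on G S} = {F * G | G. G \<in> polys n}"

definition sing_locus ::
    "nat \<Rightarrow> (nat \<Rightarrow> 'k::field alg_closure) set set \<Rightarrow> 'k mpoly \<Rightarrow> (nat \<Rightarrow> 'k alg_closure) set set" where
  "sing_locus n S F = {P \<in> S. \<forall>i\<le>n. vanishes_at (base_change (mderiv i F)) P}"

text \<open>
  A rational map from \<open>Z\<close> to projective space is given by forms \<open>A 0, \<dots>, A n\<close> of equal degree, not
  all vanishing identically on \<open>Z\<close>; the Gauss map of the hypersurface defined by \<open>F\<close>, and its
  restrictions to subvarieties, are given by the partial derivatives of \<open>F\<close>.
\<close>

definition gauss_map :: "'k::field mpoly \<Rightarrow> nat \<Rightarrow> 'k mpoly" where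
  "gauss_map F = (\<lambda>i. mderiv i F)"

text \<open>
  The function field of the closure of the image, as a subfield of the function field of \<open>Z\<close>.
\<close>

definition image_field :: "nat \<Rightarrow> (nat \<Rightarrow> 'k::field alg_closure) set set \<Rightarrow>
    (nat \<Rightarrow> 'k mpoly) \<Rightarrow> 'k mpoly fract set set" where
  "image_field n Z A = generate_field (function_field n Z)
     (constants n Z \<union> {ratio n Z (A i) (A j) | i j. i \<le> n \<and> j \<le> n \<and> \<not> vanishes_on (A j) Z})"

definition inseparable_map :: "nat \<Rightarrow> (nat \<Rightarrow> 'k::field alg_closure) set set \<Rightarrow>
    (nat \<Rightarrow> 'k mpoly) \<Rightarrow> bool" where
  "inseparable_map n Z A \<longleftrightarrow> \<not> separable_extension (function_field n Z) (image_field n Z A)"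

text \<open>
  \<open>(A 0 : \<dots> : A n) = (V 0 : \<dots> : V n)\<close> as rational maps on \<open>Z\<close>, where the \<open>A i\<close> are forms and the
  \<open>V i\<close> are elements of the function field.
\<close>

definition has_coordinate_functions :: "nat \<Rightarrow> (nat \<Rightarrow> 'k::field alg_closure) set set \<Rightarrow>
    (nat \<Rightarrow> 'k mpoly) \<Rightarrow> (nat \<Rightarrow> 'k mpoly fract set) \<Rightarrow> bool" where
  "has_coordinate_functions n Z A V \<longleftrightarrow>
     (\<forall>i\<le>n. V i \<in> carrier (function_field n Z)) \<and>
     (\<exists>i\<le>n. V i \<noteq> \<zero>\<^bsub>function_field n Z\<^esub>) \<and>
     (\<exists>j\<le>n. \<not> vanishes_on (A j) Z) \<and>
     (\<forall>i\<le>n. \<forall>j\<le>n. \<not> vanishes_on (A j) Z \<longrightarrow>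
        V i = ratio n Z (A i) (A j) \<otimes>\<^bsub>function_field n Z\<^esub> V j)"

definition gauss_map_admits_powers :: "nat \<Rightarrow> nat \<Rightarrow>
    (nat \<Rightarrow> 'k::field alg_closure) set set \<Rightarrow> 'k mpoly \<Rightarrow> bool" where
  "gauss_map_admits_powers p n S F \<longleftrightarrow>
     (\<exists>U. (\<forall>i\<le>n. U i \<in> carrier (function_field n S)) \<and>
        has_coordinate_functions n S (gauss_map F) (\<lambda>i. U i [^]\<^bsub>function_field n S\<^esub> p))"


section \<open>Hasse derivatives and order sequences\<close>

definition separating_element :: "nat \<Rightarrow> (nat \<Rightarrow> 'k::field alg_closure) set set \<Rightarrow>
    'k mpoly fract set \<Rightarrow> bool" where
  "separating_element n Z \<zeta> \<longleftrightarrow> \<zeta> \<in> carrier (function_field n Z) \<and>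
     (\<forall>x\<in>carrier (function_field n Z).
        separable_element (function_field n Z)
          (generate_field (function_field n Z) (insert \<zeta> (constants n Z))) x)"

text \<open>
  The clauses say that \<open>f \<mapsto> (\<Sum>k. D k f * t ^ k)\<close> is a \<open>'k\<close>-algebra homomorphism into the power
  series over the function field which lifts the identity and sends \<open>\<zeta>\<close> to \<open>\<zeta> + t\<close>. For a
  separating \<open>\<zeta>\<close> there is exactly one such family on the function field.
\<close>

definition hasse_derivatives :: "nat \<Rightarrow> (nat \<Rightarrow> 'k::field alg_closure) set set \<Rightarrow>
    'k mpoly fract set \<Rightarrow> (nat \<Rightarrow> 'k mpoly fract set \<Rightarrow> 'k mpoly fract set) \<Rightarrow> bool" where
  "hasse_derivatives n Z \<zeta> D \<longleftrightarrow>
     (let R = function_field n Z in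
        (\<forall>k. \<forall>f\<in>carrier R. D k f \<in> carrier R) \<and>
        (\<forall>f\<in>carrier R. D 0 f = f) \<and>
        (\<forall>k. \<forall>f\<in>carrier R. \<forall>g\<in>carrier R. D k (f \<oplus>\<^bsub>R\<^esub> g) = D k f \<oplus>\<^bsub>R\<^esub> D k g) \<and>
        (\<forall>k. \<forall>f\<in>carrier R. \<forall>g\<in>carrier R.
           D k (f \<otimes>\<^bsub>R\<^esub> g) = (\<Oplus>\<^bsub>R\<^esub>i\<in>{..k}. D i f \<otimes>\<^bsub>R\<^esub> D (k - i) g)) \<and>
        (\<forall>k\<ge>1. \<forall>c\<in>constants n Z. D k c = \<zero>\<^bsub>R\<^esub>) \<and>
        D 1 \<zeta> = \<one>\<^bsub>R\<^esub> \<and> (\<forall>k\<ge>2. D k \<zeta> = \<zero>\<^bsub>R\<^esub>))"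

definition ring_det :: "('a, 'b) ring_scheme \<Rightarrow> nat \<Rightarrow> (nat \<Rightarrow> nat \<Rightarrow> 'a) \<Rightarrow> 'a" where
  "ring_det R n A =
     (\<Oplus>\<^bsub>R\<^esub>\<pi>\<in>{\<pi>. \<pi> permutes {..n}}. add_pow R (sign \<pi> :: int) (\<Otimes>\<^bsub>R\<^esub>i\<in>{..n}. A i (\<pi> i)))"

text \<open>
  Everything the order sequence of \<open>Z\<close> is computed from: coordinate functions
  \<open>mvar i / mvar j\<close>, a separating element and its Hasse derivatives.
\<close>

definition order_data :: "nat \<Rightarrow> (nat \<Rightarrow> 'k::field alg_closure) set set \<Rightarrow> nat \<Rightarrow>
    'k mpoly fract set \<Rightarrow> (nat \<Rightarrow> 'k mpoly fract set \<Rightarrow> 'k mpoly fract set) \<Rightarrow> bool" where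
  "order_data n Z j \<zeta> D \<longleftrightarrow> j \<le> n \<and> \<not> vanishes_on (mvar j :: 'k mpoly) Z \<and>
     separating_element n Z \<zeta> \<and> hasse_derivatives n Z \<zeta> D"

definition independent_orders :: "nat \<Rightarrow> (nat \<Rightarrow> 'k::field alg_closure) set set \<Rightarrow> nat \<Rightarrow>
    (nat \<Rightarrow> 'k mpoly fract set \<Rightarrow> 'k mpoly fract set) \<Rightarrow> nat list \<Rightarrow> bool" where
  "independent_orders n Z j D \<epsilon> \<longleftrightarrow> length \<epsilon> = Suc n \<and> sorted_wrt (<) \<epsilon> \<and>
     ring_det (function_field n Z) n (\<lambda>i l. D (\<epsilon> ! i) (ratio n Z (mvar l) (mvar j)))
       \<noteq> \<zero>\<^bsub>function_field n Z\<^esub>"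

definition is_order_sequence :: "nat \<Rightarrow> (nat \<Rightarrow> 'k::field alg_closure) set set \<Rightarrow> nat \<Rightarrow>
    (nat \<Rightarrow> 'k mpoly fract set \<Rightarrow> 'k mpoly fract set) \<Rightarrow> nat list \<Rightarrow> bool" where
  "is_order_sequence n Z j D \<epsilon> \<longleftrightarrow> independent_orders n Z j D \<epsilon> \<and>
     (\<forall>\<delta>. independent_orders n Z j D \<delta> \<longrightarrow> \<delta> = \<epsilon> \<or> (\<epsilon>, \<delta>) \<in> lexord {(a, b). a < b})"

definition classical :: "nat \<Rightarrow> (nat \<Rightarrow> 'k::field alg_closure) set set \<Rightarrow> nat \<Rightarrow>
    (nat \<Rightarrow> 'k mpoly fract set \<Rightarrow> 'k mpoly fract set) \<Rightarrow> bool" where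
  "classical n Z j D \<longleftrightarrow> is_order_sequence n Z j D [0..<Suc n]"

abbreviation nonclassical :: "nat \<Rightarrow> (nat \<Rightarrow> 'k::field alg_closure) set set \<Rightarrow> nat \<Rightarrow>
    (nat \<Rightarrow> 'k mpoly fract set \<Rightarrow> 'k mpoly fract set) \<Rightarrow> bool" where
  "nonclassical n Z j D \<equiv> \<not> classical n Z j D"

end

theory Submission
  imports Defs "Jordan_Normal_Form.Determinant"
begin

text \<open>
  Write \<open>d\<close> for the derivation \<open>D 1\<close> of the function field \<open>R\<close> of the curve and \<open>y l\<close> for its
  coordinate functions. Since \<open>n < p\<close>, the Hasse derivatives of order at most \<open>n\<close> are the iterates of \<open>d\<close>
  up to the invertible factors \<open>i!\<close>, so that the curve is nonclassical if and only if the Wronskian of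
  \<open>y 0, \<dots>, y n\<close> vanishes, which means that the \<open>y l\<close> are linearly dependent over the field of
  constants of \<open>d\<close> (\<open>classical_iff\<close>, \<open>wronskian_dependence\<close>).

  For the first part, let \<open>w l\<close> be the quotients of the partial derivatives \<open>F l\<close> of the equation of
  the hypersurface, restricted to the curve. Euler's identity gives \<open>\<Sum> w l * y l = 0\<close>. If the Gauss
  map is inseparable on the curve, then \<open>d (w l) = 0\<close>: an element with nonzero derivative
  generates a subfield over which all of \<open>R\<close> is separable (\<open>separable_over_nonconstant\<close>). So the
  \<open>y l\<close> are dependent over the constants.

  For the second part, the constants of \<open>d\<close> are the \<open>p\<close>-th powers (\<open>pth_power_if_constant\<close>), so a
  dependence gives forms \<open>A l\<close> of equal degree such that \<open>\<Sum> (A l)\<^sup>p * X l\<close> vanishes on the curve. Its partial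
  derivatives are the \<open>(A l)\<^sup>p\<close>. An irreducible factor \<open>F\<close> that vanishes on the curve defines the
  hypersurface: if \<open>F * G\<close> is the whole form, then \<open>(A l)\<^sup>p = F l * G\<close> where \<open>F = 0\<close>, so the Gauss map is
  given by the \<open>(A l)\<^sup>p\<close> (\<open>gauss_map_of_divisor\<close>), and not all \<open>F l\<close> vanish on the curve.

  That an irreducible form defines a hypersurface rests on one elimination lemma (\<open>eliminate_variable\<close>),
  a version of Gauss's lemma. It shows that irreducible polynomials are prime, and it gives
  the Nullstellensatz for a single equation (\<open>dvd_if_vanishes_on_hypersurface\<close>), from which irreducibility,
  homogeneous ideal and dimension (\<open>hypersurface_dimension\<close>) follow.
\<close>

section \<open>Evaluation of polynomials\<close>

abbreviation keys :: "('a \<Rightarrow>\<^sub>0 'b::zero) \<Rightarrow> 'a set" where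
  "keys \<equiv> Poly_Mapping.keys"

abbreviation lookup :: "('a \<Rightarrow>\<^sub>0 'b::zero) \<Rightarrow> 'a \<Rightarrow> 'b" where
  "lookup \<equiv> Poly_Mapping.lookup"

abbreviation single :: "'a \<Rightarrow> 'b \<Rightarrow> 'a \<Rightarrow>\<^sub>0 'b::zero" where
  "single \<equiv> Poly_Mapping.single"

lemma poly_mapping_sum_single:
  "(\<Sum>m\<in>keys F. single m (lookup F m)) = F"
proof (rule poly_mapping_eqI)
  fix k
  show "lookup (\<Sum>m\<in>keys F. single m (lookup F m)) k
      = lookup F k"
    by (simp add: lookup_sum lookup_single when_def in_keys_iff)
qed

definition polys_in :: "nat set \<Rightarrow> 'a::zero mpoly set" where
  "polys_in V = {F. \<forall>m\<in>keys F. keys m \<subseteq> V}"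

lemma polys_eq: "polys n = polys_in {..n}"
  by (simp add: polys_def polys_in_def)

lemma keys_add_nat: "keys (m + m') = keys m \<union> keys (m' :: 'b \<Rightarrow>\<^sub>0 nat)"
  by (auto simp: in_keys_iff lookup_add)

lemma polys_in_add: "F \<in> polys_in V \<Longrightarrow> G \<in> polys_in V \<Longrightarrow> F + G \<in> polys_in V"
  unfolding polys_in_def using keys_add[of F G] by blast

lemma polys_in_uminus: "F \<in> polys_in V \<Longrightarrow> - F \<in> polys_in V" for F :: "'a::ab_group_add mpoly"
  unfolding polys_in_def by (auto simp: in_keys_iff)

lemma polys_in_diff: "F \<in> polys_in V \<Longrightarrow> G \<in> polys_in V \<Longrightarrow> F - G \<in> polys_in V"
  for F :: "'a::ab_group_add mpoly"
  using polys_in_add[OF _ polys_in_uminus, of F V G] by simp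

lemma polys_in_mult: "F \<in> polys_in V \<Longrightarrow> G \<in> polys_in V \<Longrightarrow> F * G \<in> polys_in V"
  for F :: "'a::comm_semiring_1 mpoly"
proof -
  assume F: "F \<in> polys_in V" and G: "G \<in> polys_in V"
  have "keys m \<subseteq> V" if m: "m \<in> keys (F * G)" for m
  proof -
    obtain a b where "m = a + b" "a \<in> keys F" "b \<in> keys G"
      using m keys_mult[of F G] by blast
    thus ?thesis using F G by (simp add: polys_in_def keys_add_nat)
  qed
  thus ?thesis by (simp add: polys_in_def)
qed

lemma polys_in_zero [simp]: "0 \<in> polys_in V"
  by (simp add: polys_in_def)

lemma polys_in_single: "keys m \<subseteq> V \<Longrightarrow> single m c \<in> polys_in V"
  by (simp add: polys_in_def)

lemma polys_in_const [simp]: "mconst c \<in> polys_in V"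
  by (simp add: polys_in_def mconst_def)

lemma mconst_1: "mconst 1 = 1"
  by (simp add: mconst_def)

lemma mconst_0 [simp]: "mconst 0 = 0"
  by (simp add: mconst_def)

lemma mconst_add: "mconst (a + b) = mconst a + mconst b"
  by (simp add: mconst_def single_add)

lemma mconst_mult: "mconst (a * b) = mconst a * mconst b"
  by (simp add: mconst_def mult_single)

lemma mconst_eq_iff [simp]: "mconst a = mconst b \<longleftrightarrow> a = b"
  unfolding mconst_def by (metis lookup_single_eq)

lemma mconst_eq_0_iff [simp]: "mconst a = 0 \<longleftrightarrow> a = 0"
  using mconst_eq_iff[of a 0] by (simp del: mconst_eq_iff)

lemma polys_in_one [simp]: "(1 :: 'a::comm_semiring_1 mpoly) \<in> polys_in V"
  unfolding mconst_1[symmetric] by (rule polys_in_const)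

lemma polys_in_var [simp]: "i \<in> V \<Longrightarrow> (mvar i :: 'a::zero_neq_one mpoly) \<in> polys_in V"
  by (simp add: polys_in_def mvar_def)

lemma polys_in_power: "F \<in> polys_in V \<Longrightarrow> F ^ k \<in> polys_in V" for F :: "'a::comm_semiring_1 mpoly"
  by (induction k) (auto intro: polys_in_mult)

lemma polys_in_sum: "(\<And>i. i \<in> I \<Longrightarrow> F i \<in> polys_in V) \<Longrightarrow> sum F I \<in> polys_in V"
  by (induction I rule: infinite_finite_induct) (auto intro: polys_in_add)

lemma polys_in_mono: "V \<subseteq> W \<Longrightarrow> polys_in V \<subseteq> polys_in W"
  by (auto simp: polys_in_def)

lemma polys_in_finite: obtains V where "finite V" "F \<in> polys_in V"
proof
  show "finite (\<Union>m\<in>keys F. keys m)" by simp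
  show "F \<in> polys_in (\<Union>m\<in>keys F. keys m)"
    by (auto simp: polys_in_def)
qed

lemma polys_in_empty: "F \<in> polys_in {} \<longleftrightarrow> (\<exists>c. F = mconst c)"
proof
  assume "F \<in> polys_in {}"
  hence "m \<in> keys F \<Longrightarrow> m = 0" for m by (auto simp: polys_in_def)
  hence "keys F \<subseteq> {0}" by auto
  hence "F = mconst (lookup F 0)"
    by (intro poly_mapping_eqI) (auto simp: mconst_def lookup_single when_def in_keys_iff)
  thus "\<exists>c. F = mconst c" ..
qed auto

lemma mvar_power: "mvar i ^ k = (single (single i k) 1 :: 'a::comm_semiring_1 mpoly)"
  unfolding mvar_def
proof (induction k)
  case (Suc k)
  thus ?case by (simp add: mult_single flip: single_add)
qed simp

lemma single_eq_monomial:
  "single m c = mconst c * (\<Prod>i\<in>keys m. mvar i ^ lookup m i)"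
  for c :: "'a::comm_semiring_1"
proof -
  have *: "(\<Prod>i\<in>I. single (f i) 1) = (single (sum f I) 1 :: 'a mpoly)"
    if "finite I" for f :: "nat \<Rightarrow> (nat \<Rightarrow>\<^sub>0 nat)" and I
    using that by induction (auto simp: mult_single)
  show ?thesis
    unfolding mvar_power by (subst *) (simp_all add: poly_mapping_sum_single mconst_def mult_single)
qed

text \<open>
  Compatibility of evaluation with differentiation and with regrouping of variables reduces to
  constants and variables.
\<close>

lemma polys_in_induct [consumes 1, case_names const var add mult]:
  fixes F :: "'a::comm_semiring_1 mpoly"
  assumes F: "F \<in> polys_in V"
    and const: "\<And>c. P (mconst c)" and var: "\<And>i. i \<in> V \<Longrightarrow> P (mvar i)"
    and add: "\<And>F G. F \<in> polys_in V \<Longrightarrow> G \<in> polys_in V \<Longrightarrow> P F \<Longrightarrow> P G \<Longrightarrow> P (F + G)"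
    and mult: "\<And>F G. F \<in> polys_in V \<Longrightarrow> G \<in> polys_in V \<Longrightarrow> P F \<Longrightarrow> P G \<Longrightarrow> P (F * G)"
  shows "P F"
proof -
  let ?Q = "\<lambda>F. F \<in> polys_in V \<and> P F"
  have one: "?Q 1" using const[of 1] by (simp add: mconst_1)
  have zero: "?Q 0" using const[of 0] by simp
  have pow: "?Q (mvar i ^ k)" if "i \<in> V" for i k
    by (induction k) (use one that mult var in \<open>auto intro: polys_in_mult\<close>)
  have prod: "?Q (prod f I)" if "\<And>i. i \<in> I \<Longrightarrow> ?Q (f i)" for f and I :: "nat set"
    using that by (induction I rule: infinite_finite_induct) (use one mult in \<open>auto intro: polys_in_mult\<close>)
  have sum: "?Q (sum f I)" if "\<And>i. i \<in> I \<Longrightarrow> ?Q (f i)" for f and I :: "(nat \<Rightarrow>\<^sub>0 nat) set"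
    using that by (induction I rule: infinite_finite_induct) (use zero add in \<open>auto intro: polys_in_add\<close>)
  have "?Q (\<Sum>m\<in>keys F. single m (lookup F m))"
  proof (rule sum)
    fix m assume "m \<in> keys F"
    hence "keys m \<subseteq> V" using F by (auto simp: polys_in_def)
    hence 1: "?Q (\<Prod>i\<in>keys m. mvar i ^ lookup m i)"
      by (intro prod pow) auto
    show "?Q (single m (lookup F m))"
      unfolding single_eq_monomial using 1 mult const by (auto intro: polys_in_mult)
  qed
  thus ?thesis by (simp add: poly_mapping_sum_single)
qed

definition mono_eval :: "(nat \<Rightarrow> 'b::comm_semiring_1) \<Rightarrow> (nat \<Rightarrow>\<^sub>0 nat) \<Rightarrow> 'b" where
  "mono_eval x m = (\<Prod>i\<in>keys m. x i ^ lookup m i)"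

lemma mono_eval_superset:
  "finite V \<Longrightarrow> keys m \<subseteq> V \<Longrightarrow> mono_eval x m = (\<Prod>i\<in>V. x i ^ lookup m i)"
  unfolding mono_eval_def by (rule prod.mono_neutral_left) (auto simp: in_keys_iff)

lemma mono_eval_0 [simp]: "mono_eval x 0 = 1"
  by (simp add: mono_eval_def)

lemma mono_eval_add: "mono_eval x (m + m') = mono_eval x m * mono_eval x m'"
proof -
  let ?V = "keys m \<union> keys m'"
  have "mono_eval x (m + m') = (\<Prod>i\<in>?V. x i ^ lookup (m + m') i)"
    by (rule mono_eval_superset) (auto simp: keys_add_nat)
  thus ?thesis
    by (simp add: mono_eval_superset[of ?V] lookup_add power_add prod.distrib)
qed

lemma mono_eval_single [simp]: "mono_eval x (single i k) = x i ^ k"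
  by (simp add: mono_eval_def)

lemma mono_eval_mvar: "mono_eval mvar m = (single m 1 :: 'a::comm_semiring_1 mpoly)"
  using single_eq_monomial[of m "1::'a"] by (simp add: mono_eval_def mconst_1)

text \<open>
  Evaluation along a map of coefficient rings. Points over the algebraic closure, elements of a function
  field and regroupings of a polynomial by one variable or by degree are all values of this map.
\<close>

definition peval :: "('a::comm_ring_1 \<Rightarrow> 'b::comm_ring_1) \<Rightarrow> (nat \<Rightarrow> 'b) \<Rightarrow> 'a mpoly \<Rightarrow> 'b" where
  "peval f x F = (\<Sum>m\<in>keys F. f (lookup F m) * mono_eval x m)"

lemma meval_eq: "meval F x = peval (\<lambda>c. c) x F"
  by (simp add: meval_def peval_def mono_eval_def)

context
  fixes f :: "'a::comm_ring_1 \<Rightarrow> 'b::comm_ring_1"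
  assumes hom: "comm_ring_hom f"
begin

interpretation comm_ring_hom f by (rule hom)

lemma peval_single [simp]: "peval f x (single m c) = f c * mono_eval x m"
  by (simp add: peval_def)

lemma peval_add [simp]: "peval f x (F + G) = peval f x F + peval f x G"
  unfolding peval_def
  by (rule setsum_keys_plus_distrib) (auto simp: algebra_simps hom_distribs)

lemma peval_0 [simp]: "peval f x 0 = 0"
  by (simp add: peval_def)

lemma peval_sum [simp]: "peval f x (sum F I) = (\<Sum>i\<in>I. peval f x (F i))"
  by (induction I rule: infinite_finite_induct) auto

lemma peval_mult [simp]: "peval f x (F * G) = peval f x F * peval f x G"
proof -
  let ?s = "\<lambda>F m. single m (lookup F m)"
  have "peval f x (F * G) = peval f x ((\<Sum>m\<in>keys F. ?s F m) * (\<Sum>m\<in>keys G. ?s G m))"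
    by (simp only: poly_mapping_sum_single)
  also have "\<dots> = (\<Sum>m\<in>keys F. \<Sum>m'\<in>keys G. peval f x (?s F m) * peval f x (?s G m'))"
    unfolding sum_product by (simp add: mult_single mono_eval_add hom_distribs mult_ac)
  also have "\<dots> = peval f x F * peval f x G"
    by (simp only: peval_single peval_def[of f x F] peval_def[of f x G] flip: sum_product)
  finally show ?thesis .
qed

lemma peval_const [simp]: "peval f x (mconst c) = f c"
  by (simp add: mconst_def)

lemma peval_var [simp]: "peval f x (mvar i) = x i"
  by (simp add: mvar_def)

lemma peval_hom: "comm_ring_hom (peval f x)"
  using peval_const[of x 1] by unfold_locales (auto simp: mconst_1)

end

lemma comm_ring_hom_id: "comm_ring_hom (\<lambda>c. c :: 'a::comm_ring_1)"
  by unfold_locales auto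

lemma mconst_hom: "comm_ring_hom (mconst :: 'a::comm_ring_1 \<Rightarrow> 'a mpoly)"
  by unfold_locales (auto simp: mconst_add mconst_mult mconst_1)

lemma peval_mvar [simp]: "peval mconst mvar F = F"
  unfolding peval_def mono_eval_mvar by (simp add: mconst_def mult_single poly_mapping_sum_single)

lemma peval_cong:
  "F \<in> polys_in V \<Longrightarrow> (\<And>i. i \<in> V \<Longrightarrow> x i = y i) \<Longrightarrow> peval f x F = peval f y F"
  unfolding peval_def mono_eval_def polys_in_def
  by (intro sum.cong prod.cong arg_cong2[of _ _ _ _ "(*)"] refl arg_cong2[of _ _ _ _ "(^)"]) auto

lemma hom_peval:
  assumes "comm_ring_hom g" shows "g (peval f x F) = peval (\<lambda>c. g (f c)) (\<lambda>i. g (x i)) F"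
proof -
  interpret comm_ring_hom g by fact
  show ?thesis unfolding peval_def mono_eval_def
    by (simp add: hom_distribs)
qed

lemma comm_ring_hom_comp:
  "comm_ring_hom f \<Longrightarrow> comm_ring_hom g \<Longrightarrow> comm_ring_hom (\<lambda>x. g (f x))"
proof -
  assume "comm_ring_hom f" "comm_ring_hom g"
  then interpret f: comm_ring_hom f + g: comm_ring_hom g .
  show ?thesis by unfold_locales (simp_all add: f.hom_add g.hom_add f.hom_mult g.hom_mult)
qed

lemma to_ac_hom: "comm_ring_hom to_ac"
  by unfold_locales auto

lemma keys_base_change: "keys (base_change F) = keys F"
  and lookup_base_change: "lookup (base_change F) m = to_ac (lookup F m)"
  by (auto simp: base_change_def in_keys_iff Poly_Mapping.map.rep_eq when_def)

lemma meval_base_change: "meval (base_change F) x = peval to_ac x F"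
  by (simp only: meval_eq peval_def keys_base_change lookup_base_change)

section \<open>Derivatives, degrees and forms\<close>
lemma mderiv_single:
  "mderiv i (single m c)
   = single (m - single i 1) (of_nat (lookup m i) * c)"
  by (simp add: mderiv_def)

lemma mderiv_add: "mderiv i (F + G) = mderiv i F + mderiv i G"
  unfolding mderiv_def
  by (rule setsum_keys_plus_distrib) (auto simp: algebra_simps single_add)

lemma mderiv_0 [simp]: "mderiv i 0 = 0"
  by (simp add: mderiv_def)

lemma mderiv_sum: "mderiv i (sum F I) = (\<Sum>k\<in>I. mderiv i (F k))"
  by (induction I rule: infinite_finite_induct) (auto simp: mderiv_add)

lemma mderiv_const [simp]: "mderiv i (mconst c) = 0"
  by (simp add: mconst_def mderiv_single)

lemma mderiv_one [simp]: "mderiv i (1 :: 'a::comm_semiring_1 mpoly) = 0"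
  by (subst mconst_1[symmetric]) (rule mderiv_const)

lemma mderiv_var: "mderiv i (mvar j) = (if i = j then 1 else 0 :: 'a::comm_semiring_1 mpoly)"
  by (simp add: mvar_def mderiv_single lookup_single when_def)

lemma mderiv_mult:
  fixes F G :: "'a::comm_semiring_1 mpoly"
  shows "mderiv i (F * G) = F * mderiv i G + mderiv i F * G"
proof -
  \<comment> \<open>If the exponent is zero, the truncated subtraction is off, but the coefficient vanishes.\<close>
  have shift: "single (m + m' - single i 1) (of_nat (lookup m i) * c)
      = single ((m - single i 1) + m') (of_nat (lookup m i) * c)"
    for m m' :: "nat \<Rightarrow>\<^sub>0 nat" and c :: 'a
  proof (cases "lookup m i = 0")
    case False
    hence "m + m' - single i 1 = (m - single i 1) + m'"
      by (intro poly_mapping_eqI) (auto simp: lookup_add lookup_minus lookup_single when_def)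
    thus ?thesis by simp
  qed simp
  have single: "mderiv i (single m c * single m' c')
      = single m c * mderiv i (single m' c')
        + mderiv i (single m c) * single m' c'" for m m' and c c' :: 'a
    using shift[of m m' "c * c'"] shift[of m' m "c * c'"]
    by (simp add: mult_single mderiv_single lookup_add distrib_right distrib_left single_add add.commute mult_ac)
  let ?s = "\<lambda>F m. single m (lookup F m)"
  let ?K = keys
  have "mderiv i ((\<Sum>m\<in>?K F. ?s F m) * (\<Sum>m\<in>?K G. ?s G m))
      = (\<Sum>m\<in>?K F. ?s F m) * mderiv i (\<Sum>m\<in>?K G. ?s G m) + mderiv i (\<Sum>m\<in>?K F. ?s F m) * (\<Sum>m\<in>?K G. ?s G m)"
    unfolding sum_product mderiv_sum single sum.distrib ..
  thus ?thesis by (simp only: poly_mapping_sum_single)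
qed

lemma mderiv_power:
  fixes F :: "'a::comm_semiring_1 mpoly"
  shows "mderiv i (F ^ k) = of_nat k * F ^ (k - 1) * mderiv i F"
proof (induction k)
  case (Suc k)
  thus ?case by (cases k) (simp_all add: mderiv_mult algebra_simps)
qed simp

lemma mderiv_in_polys_in: "F \<in> polys_in V \<Longrightarrow> mderiv i F \<in> polys_in V" for F :: "'a::comm_semiring_1 mpoly"
  by (induction rule: polys_in_induct)
     (auto simp: mderiv_var mderiv_add mderiv_mult intro: polys_in_add polys_in_mult)

locale derivation =
  fixes d :: "'b::comm_ring_1 \<Rightarrow> 'b"
  assumes add: "d (a + b) = d a + d b"
    and mult: "d (a * b) = a * d b + d a * b"
begin

lemma zero [simp]: "d 0 = 0"
  using add[of 0 0] by simp

lemma one [simp]: "d 1 = 0"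
  using mult[of 1 1] by simp

lemma uminus: "d (- a) = - d a"
  using add[of a "- a"] by (simp add: eq_neg_iff_add_eq_0 add.commute)

lemma sum: "d (sum f I) = (\<Sum>i\<in>I. d (f i))"
  by (induction I rule: infinite_finite_induct) (auto simp: add)

lemma of_nat [simp]: "d (of_nat k) = 0"
  by (induction k) (auto simp: add)

lemma chain_rule:
  assumes "finite V" and F: "F \<in> polys_in V" and f: "comm_ring_hom f" and const: "\<And>c. d (f c) = 0"
  shows "d (peval f x F) = (\<Sum>i\<in>V. peval f x (mderiv i F) * d (x i))"
  using F
proof (induction rule: polys_in_induct)
  case (const c)
  show ?case by (simp add: f assms(4))
next
  case (var i)
  interpret comm_ring_hom "peval f x" by (rule peval_hom[OF f])
  have "(\<Sum>j\<in>V. peval f x (mderiv j (mvar i)) * d (x j)) = (\<Sum>j\<in>V. if j = i then d (x j) else 0)"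
    by (intro sum.cong refl) (auto simp: mderiv_var hom_distribs)
  thus ?case using var \<open>finite V\<close> by (simp add: f)
next
  case (add F G)
  thus ?case by (simp add: mderiv_add f distrib_right sum.distrib derivation.add[OF derivation_axioms])
next
  case (mult F G)
  have "d (peval f x (F * G)) = peval f x F * d (peval f x G) + d (peval f x F) * peval f x G"
    by (simp add: f derivation.mult[OF derivation_axioms])
  also have "\<dots> = (\<Sum>i\<in>V. peval f x F * (peval f x (mderiv i G) * d (x i)) + peval f x (mderiv i F) * d (x i) * peval f x G)"
    by (simp add: mult.IH sum_distrib_left sum_distrib_right sum.distrib)
  also have "\<dots> = (\<Sum>i\<in>V. peval f x (mderiv i (F * G)) * d (x i))"
    by (intro sum.cong refl) (simp add: mderiv_mult f algebra_simps)
  finally show ?case .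
qed

end

definition tdeg :: "(nat \<Rightarrow>\<^sub>0 nat) \<Rightarrow> nat" where
  "tdeg m = (\<Sum>i\<in>keys m. lookup m i)"

lemma forms_eq: "forms n d = {F \<in> polys_in {..n}. \<forall>m\<in>keys F. tdeg m = d}"
  by (simp add: forms_def polys_eq tdeg_def)

lemma formsD: "F \<in> forms n d \<Longrightarrow> F \<in> polys_in {..n}"
  by (simp add: forms_eq)

lemma tdeg_superset: "finite V \<Longrightarrow> keys m \<subseteq> V \<Longrightarrow> tdeg m = (\<Sum>i\<in>V. lookup m i)"
  unfolding tdeg_def by (rule sum.mono_neutral_left) (auto simp: in_keys_iff)

lemma tdeg_add: "tdeg (m + m') = tdeg m + tdeg m'"
proof -
  let ?V = "keys m \<union> keys m'"
  have "tdeg (m + m') = (\<Sum>i\<in>?V. lookup (m + m') i)"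
    by (rule tdeg_superset) (auto simp: keys_add_nat)
  thus ?thesis by (simp add: tdeg_superset[of ?V] lookup_add sum.distrib)
qed

lemma tdeg_single [simp]: "tdeg (single i k) = k"
  by (simp add: tdeg_def)

lemma tdeg_0 [simp]: "tdeg 0 = 0"
  by (simp add: tdeg_def)

text \<open>
  The coefficient at \<open>d\<close> is the homogeneous part of degree \<open>d\<close>. A polynomial is homogeneous if and only if
  its image is a monomial, which turns factors of forms into factors of monomials.
\<close>

definition grade :: "'a::comm_ring_1 mpoly \<Rightarrow> 'a mpoly poly" where
  "grade = peval (\<lambda>c. [:mconst c:]) (\<lambda>i. Polynomial.monom (mvar i) 1)"

lemma const_poly_hom: "comm_ring_hom (\<lambda>c. [:c:])"
  by unfold_locales auto

lemma grade_hom: "comm_ring_hom grade"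
  unfolding grade_def by (intro peval_hom comm_ring_hom_comp[OF mconst_hom const_poly_hom])

lemma mono_eval_monom:
  "mono_eval (\<lambda>i. Polynomial.monom (y i) 1) m = Polynomial.monom (mono_eval y m) (tdeg m)"
proof -
  have "(\<Prod>i\<in>I. Polynomial.monom (y i) 1 ^ e i) = Polynomial.monom (\<Prod>i\<in>I. y i ^ e i) (sum e I)"
    if "finite I" for I e
    using that by induction (auto simp: mult_monom monom_power simp flip: one_pCons)
  thus ?thesis by (simp add: mono_eval_def tdeg_def)
qed

lemma grade_eq: "grade F = (\<Sum>m\<in>keys F.
    Polynomial.monom (single m (lookup F m)) (tdeg m))"
  unfolding grade_def peval_def mono_eval_monom mono_eval_mvar
  by (simp add: smult_monom mconst_def mult_single)

lemma lookup_coeff_grade: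
  "lookup (Polynomial.coeff (grade F) d) m = (if tdeg m = d then lookup F m else 0)"
proof -
  have "lookup (Polynomial.coeff (grade F) d) m
      = (\<Sum>k\<in>keys F. if k = m then (if tdeg k = d then lookup F k else 0) else 0)"
    unfolding grade_eq coeff_sum lookup_sum
    by (intro sum.cong refl) (auto simp: lookup_single when_def)
  thus ?thesis by (simp add: in_keys_iff)
qed

lemma forms_grade: "F \<in> forms n d \<longleftrightarrow> F \<in> polys_in {..n} \<and> grade F = Polynomial.monom F d"
proof (intro iffI conjI; (elim conjE)?)
  assume F: "F \<in> forms n d"
  show "F \<in> polys_in {..n}" using F by (rule formsD)
  show "grade F = Polynomial.monom F d"
    by (rule poly_eqI, rule poly_mapping_eqI)
       (use F in \<open>auto simp: lookup_coeff_grade forms_eq in_keys_iff\<close>)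
next
  assume F: "F \<in> polys_in {..n}" and *: "grade F = Polynomial.monom F d"
  have "tdeg m = d" if "m \<in> keys F" for m
  proof (rule ccontr)
    assume "tdeg m \<noteq> d"
    hence "lookup (Polynomial.coeff (grade F) (tdeg m)) m = 0" by (simp add: *)
    thus False using that by (simp add: lookup_coeff_grade in_keys_iff)
  qed
  thus "F \<in> forms n d" using F by (simp add: forms_eq)
qed

lemma forms_0 [simp]: "0 \<in> forms n d"
  by (simp add: forms_eq)

lemma forms_add: "F \<in> forms n d \<Longrightarrow> G \<in> forms n d \<Longrightarrow> F + G \<in> forms n d" for F :: "'a::comm_ring_1 mpoly"
  using keys_add[of F G] by (auto simp: forms_eq intro: polys_in_add)

lemma forms_uminus: "F \<in> forms n d \<Longrightarrow> - F \<in> forms n d" for F :: "'a::comm_ring_1 mpoly"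
  by (auto simp: forms_eq in_keys_iff intro: polys_in_uminus)

lemma forms_mult: "F \<in> forms n d \<Longrightarrow> G \<in> forms n e \<Longrightarrow> F * G \<in> forms n (d + e)" for F :: "'a::comm_ring_1 mpoly"
proof -
  interpret comm_ring_hom "grade :: 'a mpoly \<Rightarrow> _" by (rule grade_hom)
  assume "F \<in> forms n d" "G \<in> forms n e"
  thus ?thesis by (auto simp: forms_grade hom_mult mult_monom intro: polys_in_mult)
qed

lemma forms_const: "mconst c \<in> forms n 0"
  by (simp add: forms_eq mconst_def polys_in_single)

lemma forms_one: "(1 :: 'a::comm_ring_1 mpoly) \<in> forms n 0"
  using forms_const[of "1::'a"] by (simp add: mconst_1)

lemma forms_var: "i \<le> n \<Longrightarrow> (mvar i :: 'a::comm_ring_1 mpoly) \<in> forms n 1"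
  by (simp add: forms_eq mvar_def polys_in_single)

lemma forms_power: "F \<in> forms n d \<Longrightarrow> F ^ k \<in> forms n (k * d)" for F :: "'a::comm_ring_1 mpoly"
  by (induction k) (auto simp: forms_one intro: forms_mult)

lemma forms_sum: "(\<And>i. i \<in> I \<Longrightarrow> F i \<in> forms n d) \<Longrightarrow> sum F I \<in> forms n d" for F :: "'i \<Rightarrow> 'a::comm_ring_1 mpoly"
  by (induction I rule: infinite_finite_induct) (auto intro: forms_add)

lemma forms_prod: "(\<And>i. i \<in> I \<Longrightarrow> F i \<in> forms n (d i)) \<Longrightarrow> prod F I \<in> forms n (sum d I)"
  for F :: "'i \<Rightarrow> 'a::comm_ring_1 mpoly"
  by (induction I rule: infinite_finite_induct) (auto simp: forms_one intro: forms_mult)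

lemma keys_mderiv: "keys (mderiv i F) \<subseteq>
    (\<lambda>m. m - single i 1) ` {m \<in> keys F. lookup m i > 0}"
proof -
  have "keys (mderiv i F) \<subseteq> (\<Union>m\<in>keys F.
      keys (single (m - single i 1)
         (of_nat (lookup m i) * lookup F m)))"
    unfolding mderiv_def by (rule keys_sum)
  also have "\<dots> \<subseteq> (\<lambda>m. m - single i 1) ` {m \<in> keys F. lookup m i > 0}"
    by (rule UN_least) (auto split: if_splits intro!: imageI Nat.gr0I)
  finally show ?thesis .
qed

lemma tdeg_diff_single:
  assumes "lookup m i > 0" shows "tdeg m = Suc (tdeg (m - single i 1))"
proof -
  have "m = (m - single i 1) + single i 1"
    using assms by (intro poly_mapping_eqI) (auto simp: lookup_add lookup_minus lookup_single when_def)
  thus ?thesis by (metis tdeg_add tdeg_single Suc_eq_plus1)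
qed

lemma forms_mderiv: "F \<in> forms n d \<Longrightarrow> mderiv i F \<in> forms n (d - 1)" for F :: "'a::comm_ring_1 mpoly"
  using keys_mderiv[of i F] tdeg_diff_single[of _ i]
  by (fastforce simp: forms_eq intro: mderiv_in_polys_in)

lemma peval_scale:
  assumes f: "comm_ring_hom f" and F: "F \<in> forms n d"
  shows "peval f (\<lambda>i. c * x i) F = c ^ d * peval f x F"
proof -
  have "mono_eval (\<lambda>i. c * x i) m = c ^ tdeg m * mono_eval x m" for m
    by (simp add: mono_eval_def tdeg_def power_mult_distrib prod.distrib power_sum)
  hence "peval f (\<lambda>i. c * x i) F = (\<Sum>m\<in>keys F. c ^ d * (f (lookup F m) * mono_eval x m))"
    unfolding peval_def using F by (intro sum.cong refl) (simp add: forms_eq mult_ac)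
  thus ?thesis by (simp add: peval_def sum_distrib_left)
qed

lemma euler_identity:
  assumes F: "F \<in> forms n d"
  shows "(\<Sum>i\<le>n. mvar i * mderiv i F) = of_nat d * (F :: 'a::comm_ring_1 mpoly)"
proof -
  have *: "(mvar i * mderiv i (single m c) :: 'a mpoly)
      = of_nat (lookup m i) * single m c" for i m c
  proof (cases "lookup m i = 0")
    case False
    hence "single i 1 + (m - single i 1) = m"
      by (intro poly_mapping_eqI) (auto simp: lookup_add lookup_minus lookup_single when_def)
    thus ?thesis
      by (simp add: mvar_def mderiv_single mult_single flip: single_of_nat)
  qed (simp add: mderiv_single)
  let ?s = "\<lambda>m. single m (lookup F m)"
  have "(\<Sum>i\<le>n. mvar i * mderiv i F) = (\<Sum>i\<le>n. mvar i * mderiv i (\<Sum>m\<in>keys F. ?s m))"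
    by (simp only: poly_mapping_sum_single)
  also have "\<dots> = (\<Sum>m\<in>keys F. \<Sum>i\<le>n. of_nat (lookup m i) * ?s m)"
    by (simp only: mderiv_sum sum_distrib_left *) (rule sum.swap)
  also have "\<dots> = (\<Sum>m\<in>keys F. of_nat d * ?s m)"
  proof (rule sum.cong[OF refl])
    fix m assume "m \<in> keys F"
    hence "(\<Sum>i\<le>n. lookup m i) = d"
      using F tdeg_superset[of "{..n}" m] by (auto simp: forms_eq polys_in_def)
    thus "(\<Sum>i\<le>n. of_nat (lookup m i) * ?s m) = of_nat d * ?s m"
      by (metis sum_distrib_right of_nat_sum)
  qed
  also have "\<dots> = of_nat d * F" by (simp only: poly_mapping_sum_single flip: sum_distrib_left)
  finally show ?thesis .
qed

text \<open>
  The order at \<open>0\<close> and the degree are additive, the order is at most the degree, and for a monomial they agree. Hence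
  they agree for each factor.
\<close>

lemma factor_of_monom:
  fixes p q :: "'a::idom poly"
  assumes "p * q = Polynomial.monom c d" and "c \<noteq> 0"
  shows "\<exists>a e. p = Polynomial.monom a e"
proof -
  have nz: "p \<noteq> 0" "q \<noteq> 0" using assms by auto
  have order_monom: "order 0 (Polynomial.monom c d) = d" using assms(2)
    by (rule order_0_monom)
  have "order 0 p + order 0 q = d" using order_mult[of p q 0] assms order_monom nz by simp
  moreover have "Polynomial.degree p + Polynomial.degree q = d"
    using degree_mult_eq[of p q] nz assms by (simp add: degree_monom_eq)
  ultimately have deg: "Polynomial.degree p = order 0 p"
    using order_degree[OF nz(1), of 0] order_degree[OF nz(2), of 0] by linarith
  obtain r where r: "p = [:0, 1:] ^ order 0 p * r"
    using order_1[of 0 p] by (auto elim: dvdE)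
  have "r \<noteq> 0" using r nz by auto
  hence "Polynomial.degree r = 0" using deg r nz
    by (metis add_left_cancel add_0_right degree_linear_power degree_mult_eq mult_eq_0_iff)
  then obtain a where "r = [:a:]" by (auto elim: degree_eq_zeroE)
  hence "p = Polynomial.monom a (order 0 p)" using r by (simp add: monom_altdef)
  thus ?thesis by blast
qed

section \<open>Unique factorisation\<close>
text \<open>
  A polynomial as univariate polynomial in \<open>X v\<close>. The coefficients stay in the same ring but no longer
  involve \<open>X v\<close>, which avoids a tower of polynomial rings.
\<close>

definition collect :: "nat \<Rightarrow> 'a::comm_ring_1 mpoly \<Rightarrow> 'a mpoly poly" where
  "collect v = peval (\<lambda>c. [:mconst c:]) (\<lambda>i. if i = v then [:0, 1:] else [:mvar i:])"

lemma collect_hom: "comm_ring_hom (collect v)"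
  unfolding collect_def by (intro peval_hom comm_ring_hom_comp[OF mconst_hom const_poly_hom])

lemma collect_add: "collect v (F + G) = collect v F + collect v G"
  and collect_mult: "collect v (F * G) = collect v F * collect v G"
  and collect_0 [simp]: "collect v 0 = 0"
proof -
  interpret comm_ring_hom "collect v" by (rule collect_hom)
  show "collect v (F + G) = collect v F + collect v G" by (rule hom_add)
  show "collect v (F * G) = collect v F * collect v G" by (rule hom_mult)
  show "collect v 0 = 0" by (rule hom_zero)
qed

lemma poly_at_hom: "comm_ring_hom (\<lambda>q. poly q (a :: 'a::comm_ring_1))"
  by unfold_locales auto

lemma poly_collect [simp]: "poly (collect v F) (mvar v) = F"
proof -
  have "poly (collect v F) (mvar v)
      = peval (\<lambda>c. poly [:mconst c:] (mvar v)) (\<lambda>i. poly (if i = v then [:0, 1:] else [:mvar i:]) (mvar v)) F"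
    unfolding collect_def by (rule hom_peval[OF poly_at_hom])
  also have "\<dots> = peval mconst mvar F"
    by (intro arg_cong2[of _ _ _ _ "\<lambda>f x. peval f x F"]) auto
  finally show ?thesis by simp
qed

lemma collect_eq_0_iff [simp]: "collect v F = 0 \<longleftrightarrow> F = 0"
  by (metis poly_collect poly_0 collect_0)

lemma coeff_collect_in:
  fixes F :: "'a::comm_ring_1 mpoly"
  assumes "F \<in> polys_in V" shows "Polynomial.coeff (collect v F) k \<in> polys_in (V - {v})"
  using assms
proof (induction arbitrary: k rule: polys_in_induct)
  case (const c)
  have "collect v (mconst c) = [:mconst c:]"
    unfolding collect_def by (rule peval_const) (rule comm_ring_hom_comp[OF mconst_hom const_poly_hom])
  thus ?case by (simp add: coeff_pCons split: nat.split)
next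
  case (var i)
  have "collect v (mvar i :: 'a mpoly) = (if i = v then [:0, 1:] else [:mvar i:])"
    unfolding collect_def by (rule peval_var) (rule comm_ring_hom_comp[OF mconst_hom const_poly_hom])
  thus ?case using var by (auto simp add: coeff_pCons split: nat.split)
next
  case (add F G)
  thus ?case by (simp add: collect_add polys_in_add)
next
  case (mult F G)
  thus ?case by (auto simp add: collect_mult coeff_mult intro!: polys_in_sum polys_in_mult)
qed

lemma collect_free:
  assumes "F \<in> polys_in V" "v \<notin> V" shows "collect v F = [:F:]"
proof -
  have "collect v F = peval (\<lambda>c. [:mconst c:]) (\<lambda>i. [:mvar i:]) F"
    unfolding collect_def by (rule peval_cong[OF assms(1)]) (use assms(2) in auto)
  also have "\<dots> = [:peval mconst mvar F:]" by (rule hom_peval[OF const_poly_hom, symmetric])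
  finally show ?thesis by simp
qed

lemma polys_in_iff_free: "F \<in> polys_in V \<longleftrightarrow> (\<forall>v. v \<notin> V \<longrightarrow> F \<in> polys_in (- {v}))"
  by (auto simp: polys_in_def)

abbreviation vdeg :: "nat \<Rightarrow> 'a::comm_ring_1 mpoly \<Rightarrow> nat" where
  "vdeg v F \<equiv> Polynomial.degree (collect v F)"

lemma vdeg_eq_0_iff: "vdeg v F = 0 \<longleftrightarrow> F \<in> polys_in (- {v})"
proof
  assume "vdeg v F = 0"
  then obtain c where c: "collect v F = [:c:]" by (auto elim: degree_eq_zeroE)
  have "c \<in> polys_in (UNIV - {v})"
    using coeff_collect_in[of F UNIV v 0] by (simp add: c polys_in_def)
  moreover have "F = c" using poly_collect[of v F] by (simp add: c)
  ultimately show "F \<in> polys_in (- {v})" by (simp add: Compl_eq_Diff_UNIV)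
qed (simp add: collect_free[of _ "- {v}"])

lemma vdeg_mult: "F \<noteq> 0 \<Longrightarrow> G \<noteq> 0 \<Longrightarrow> vdeg v (F * G) = vdeg v F + vdeg v G" for F :: "'a::idom mpoly"
  by (simp add: collect_mult degree_mult_eq)

lemma polys_in_factor:
  fixes F G :: "'a::idom mpoly"
  assumes "F * G \<in> polys_in V" "F * G \<noteq> 0" shows "F \<in> polys_in V"
proof (subst polys_in_iff_free, intro allI impI)
  fix v assume "v \<notin> V"
  hence "F * G \<in> polys_in (- {v})" using assms(1) polys_in_mono[of V "- {v}"] by auto
  hence "vdeg v (F * G) = 0" by (simp only: vdeg_eq_0_iff)
  hence "vdeg v F = 0" using assms(2) by (simp add: vdeg_mult)
  thus "F \<in> polys_in (- {v})" by (simp only: vdeg_eq_0_iff)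
qed

lemma polys_in_dvd: "G dvd F \<Longrightarrow> F \<in> polys_in V \<Longrightarrow> F \<noteq> 0 \<Longrightarrow> G \<in> polys_in V" for F :: "'a::idom mpoly"
  by (metis dvdE polys_in_factor)

lemma polys_in_insertE:
  assumes "F \<in> polys_in (insert v W)" "v \<notin> W" shows "Polynomial.coeff (collect v F) k \<in> polys_in W"
  using coeff_collect_in[OF assms(1), of v k] assms(2) by simp

lemma polys_in_insert_free:
  assumes "F \<in> polys_in (insert v W)" "v \<notin> W" "vdeg v F = 0" shows "F \<in> polys_in W"
proof -
  obtain a where a: "collect v F = [:a:]" using assms(3) by (auto elim: degree_eq_zeroE)
  have "F = a" using poly_collect[of v F] by (simp add: a)
  moreover have "a \<in> polys_in W" using polys_in_insertE[OF assms(1,2), of 0] by (simp only: a coeff_pCons_0)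
  ultimately show ?thesis by simp
qed

lemma poly_grade [simp]: "poly (grade F) 1 = F"
proof -
  have "poly (grade F) 1 = peval (\<lambda>c. poly [:mconst c:] 1) (\<lambda>i. poly (Polynomial.monom (mvar i) 1) 1) F"
    unfolding grade_def by (rule hom_peval[OF poly_at_hom])
  thus ?thesis by (simp add: poly_monom)
qed

abbreviation gdeg :: "'a::comm_ring_1 mpoly \<Rightarrow> nat" where
  "gdeg F \<equiv> Polynomial.degree (grade F)"

lemma grade_mult: "grade (F * G) = grade F * grade G"
  and grade_0 [simp]: "grade 0 = 0"
proof -
  interpret comm_ring_hom grade by (rule grade_hom)
  show "grade (F * G) = grade F * grade G" by (rule hom_mult)
  show "grade 0 = 0" by (rule hom_zero)
qed

lemma grade_eq_0_iff [simp]: "grade F = 0 \<longleftrightarrow> F = 0"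
  by (metis poly_grade poly_0 grade_0)

lemma gdeg_mult: "F \<noteq> 0 \<Longrightarrow> G \<noteq> 0 \<Longrightarrow> gdeg (F * G) = gdeg F + gdeg G" for F :: "'a::idom mpoly"
  by (simp add: grade_mult degree_mult_eq)

lemma gdeg_eq_0: assumes "gdeg F = 0" obtains c where "F = mconst c"
proof -
  obtain G where G: "grade F = [:G:]" using assms by (auto elim: degree_eq_zeroE)
  have "m = 0" if "m \<in> keys F" for m
  proof -
    have "lookup (Polynomial.coeff (grade F) (tdeg m)) m \<noteq> 0"
      using that by (simp add: lookup_coeff_grade in_keys_iff)
    hence "tdeg m = 0" by (auto simp: G coeff_pCons split: nat.splits)
    thus "m = 0" by (auto simp: tdeg_def in_keys_iff intro: poly_mapping_eqI)
  qed
  hence "F \<in> polys_in {}" by (auto simp: polys_in_def)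
  thus ?thesis using that by (auto simp: polys_in_empty)
qed

lemma forms_factor:
  fixes F G :: "'a::idom mpoly"
  assumes "F * G \<in> forms n d" "F * G \<noteq> 0" shows "\<exists>e. F \<in> forms n e"
proof -
  have "grade F * grade G = Polynomial.monom (F * G) d"
    using assms(1) by (simp add: forms_grade grade_mult)
  then obtain a e where "grade F = Polynomial.monom a e" using factor_of_monom assms(2) by blast
  moreover from this have "a = F" using poly_grade[of F] by (simp add: poly_monom)
  ultimately have "F \<in> forms n e" using polys_in_factor[OF formsD[OF assms(1)] assms(2)]
    by (simp add: forms_grade)
  thus ?thesis ..
qed

lemma unit_mpoly_iff: "F dvd 1 \<longleftrightarrow> (\<exists>c. c \<noteq> 0 \<and> F = mconst c)" for F :: "'a::field mpoly"
proof
  assume "F dvd 1"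
  then have "F \<in> polys_in {}" using polys_in_dvd[of F 1 "{}"] by simp
  then obtain c where "F = mconst c" by (auto simp: polys_in_empty)
  moreover have "c \<noteq> 0" using \<open>F dvd 1\<close> calculation by auto
  ultimately show "\<exists>c. c \<noteq> 0 \<and> F = mconst c" by blast
next
  assume "\<exists>c. c \<noteq> 0 \<and> F = mconst c"
  then obtain c where "c \<noteq> 0" "F = mconst c" by blast
  hence "F * mconst (inverse c) = 1" by (simp add: mconst_1 flip: mconst_mult)
  thus "F dvd 1" by (metis dvdI)
qed

lemma gdeg_pos: "F \<noteq> 0 \<Longrightarrow> \<not> F dvd 1 \<Longrightarrow> gdeg F > 0" for F :: "'a::field mpoly"
  by (rule Nat.gr0I) (auto elim!: gdeg_eq_0 simp: unit_mpoly_iff)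

lemma exists_irreducible_factor:
  fixes F :: "'a::field mpoly"
  assumes "F \<noteq> 0" "\<not> F dvd 1" shows "\<exists>p. irreducible p \<and> p dvd F"
  using assms
proof (induction "gdeg F" arbitrary: F rule: less_induct)
  case less
  show ?case
  proof (cases "irreducible F")
    case False
    then obtain a b where F: "F = a * b" and ab: "\<not> a dvd 1" "\<not> b dvd 1"
      using less.prems by (auto simp: irreducible_def)
    have "gdeg a < gdeg F" using F less.prems(1) ab(2) gdeg_pos[of b] by (auto simp: gdeg_mult)
    then obtain p where "irreducible p" "p dvd a" using less.hyps[of a] ab(1) F less.prems(1) by auto
    thus ?thesis using F by (meson dvd_mult2)
  qed auto
qed

text \<open>
  Primality is relative to a set of variables because Gauss's lemma is an induction over that set.
\<close>

definition prime_in :: "nat set \<Rightarrow> 'a::comm_ring_1 mpoly \<Rightarrow> bool" where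
  "prime_in V F \<longleftrightarrow> (\<forall>G\<in>polys_in V. \<forall>H\<in>polys_in V. F dvd G * H \<longrightarrow> F dvd G \<or> F dvd H)"

text \<open>
  The product of the first coefficients of \<open>G\<close> and \<open>H\<close> that are not divisible by \<open>P\<close> is, modulo \<open>P\<close>, a
  coefficient of \<open>G * H\<close>.
\<close>

lemma prime_in_insert:
  fixes P :: "'a::field mpoly"
  assumes P: "P \<in> polys_in W" "prime_in W P" and v: "v \<notin> W"
  shows "prime_in (insert v W) P"
  unfolding prime_in_def
proof (intro ballI impI, rule ccontr)
  fix G H assume GH: "G \<in> polys_in (insert v W)" "H \<in> polys_in (insert v W)" and dvd: "P dvd G * H"
    and no: "\<not> (P dvd G \<or> P dvd H)"
  let ?g = "Polynomial.coeff (collect v G)" and ?h = "Polynomial.coeff (collect v H)"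
  have ex: "\<exists>i. \<not> P dvd Polynomial.coeff (collect v F) i" if "\<not> P dvd F" for F
  proof (rule ccontr)
    assume "\<not> ?thesis"
    hence "[:P:] dvd collect v F" by (simp add: const_poly_dvd_iff)
    hence "poly [:P:] (mvar v) dvd poly (collect v F) (mvar v)"
      by (auto elim!: dvdE simp del: poly_collect)
    thus False using that by simp
  qed
  define i where "i = (LEAST i. \<not> P dvd ?g i)"
  define j where "j = (LEAST j. \<not> P dvd ?h j)"
  have i: "\<not> P dvd ?g i" unfolding i_def by (rule LeastI_ex[OF ex]) (use no in blast)
  have i': "P dvd ?g k" if "k < i" for k using not_less_Least[OF that[unfolded i_def]] by blast
  have j: "\<not> P dvd ?h j" unfolding j_def by (rule LeastI_ex[OF ex]) (use no in blast)
  have j': "P dvd ?h k" if "k < j" for k using not_less_Least[OF that[unfolded j_def]] by blast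
  have "collect v P dvd collect v (G * H)" using dvd unfolding dvd_def by (metis collect_mult)
  hence "[:P:] dvd collect v G * collect v H" by (simp add: collect_free[OF P(1) v] collect_mult)
  hence "P dvd Polynomial.coeff (collect v G * collect v H) (i + j)" by (simp add: const_poly_dvd_iff)
  also have "Polynomial.coeff (collect v G * collect v H) (i + j)
      = ?g i * ?h j + (\<Sum>k\<in>{..i + j} - {i}. ?g k * ?h (i + j - k))"
    by (simp add: coeff_mult sum.remove[of "{..i + j}" i])
  finally have sum: "P dvd ?g i * ?h j + (\<Sum>k\<in>{..i + j} - {i}. ?g k * ?h (i + j - k))" .
  have rest: "P dvd (\<Sum>k\<in>{..i + j} - {i}. ?g k * ?h (i + j - k))"
  proof (rule dvd_sum)
    fix k assume k: "k \<in> {..i + j} - {i}"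
    show "P dvd ?g k * ?h (i + j - k)"
    proof (cases "k < i")
      case True thus ?thesis by (intro dvd_mult2 i')
    next
      case False
      hence "i + j - k < j" using k by auto
      thus ?thesis by (intro dvd_mult j')
    qed
  qed
  have "P dvd ?g i * ?h j" using sum rest by (simp add: dvd_add_left_iff)
  thus False using P(2) i j polys_in_insertE[OF GH(1) v] polys_in_insertE[OF GH(2) v]
    unfolding prime_in_def by blast
qed

definition factorial_in :: "'a::field itself \<Rightarrow> nat set \<Rightarrow> bool" where
  "factorial_in _ V \<longleftrightarrow> (\<forall>P::'a mpoly. P \<in> polys_in V \<longrightarrow> irreducible P \<longrightarrow> prime_in V P)"

text \<open>
  Irreducible factors of \<open>c\<close> are prime and do not divide \<open>F\<close>, so they divide the cofactor of \<open>F\<close> and can be cancelled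
  one at a time.
\<close>

lemma cancel_content:
  fixes c F H :: "'a::field mpoly"
  assumes W: "factorial_in TYPE('a) W" and v: "v \<notin> W"
    and F: "F \<in> polys_in (insert v W)" "F \<noteq> 0" and prim: "\<And>p. p \<in> polys_in W \<Longrightarrow> irreducible p \<Longrightarrow> \<not> p dvd F"
    and c: "c \<in> polys_in W" "c \<noteq> 0" and H: "H \<in> polys_in (insert v W)" and "F dvd c * H"
  shows "F dvd H"
  using c assms(9)
proof (induction "gdeg c" arbitrary: c rule: less_induct)
  case less
  show ?case
  proof (cases "c dvd 1 \<or> H = 0")
    case True
    thus ?thesis
    proof
      assume "c dvd 1"
      then obtain c' where "1 = c * c'" by (auto elim: dvdE)
      hence "H = c' * (c * H)" by (metis mult.assoc mult.commute mult_1)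
      thus ?thesis using less.prems(3) by (metis dvd_mult)
    qed simp
  next
    case False
    then obtain p where p: "irreducible p" "p dvd c"
      using exists_irreducible_factor less.prems(2) by blast
    then obtain c' where c': "c = p * c'" by (auto elim: dvdE)
    have pW: "p \<in> polys_in W" and c'W: "c' \<in> polys_in W"
      using polys_in_dvd[OF _ less.prems(1,2)] c' by auto
    have nz: "p \<noteq> 0" "c' \<noteq> 0" using c' less.prems(2) by auto
    obtain Q where Q: "c * H = F * Q" using less.prems(3) by (auto elim: dvdE)
    have "c * H \<in> polys_in (insert v W)" "c * H \<noteq> 0"
      using less.prems(1,2) H False polys_in_mono[of W "insert v W"] by (auto intro!: polys_in_mult)
    hence QW: "Q \<in> polys_in (insert v W)" using polys_in_dvd[of Q "c * H"] Q by auto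
    have "prime_in W p" using W p(1) pW by (auto simp: factorial_in_def)
    hence "prime_in (insert v W) p" using prime_in_insert pW v by blast
    moreover have "p dvd F * Q" using Q c' by (metis dvd_triv_left mult.assoc)
    ultimately have "p dvd Q" using F(1) QW prim[OF pW p(1)] by (auto simp: prime_in_def)
    then obtain Q' where "Q = p * Q'" by (auto elim: dvdE)
    hence "p * (c' * H) = p * (F * Q')" using Q c' by (simp add: mult_ac)
    hence "c' * H = F * Q'" using nz by simp
    hence dvd: "F dvd c' * H" by simp
    have "gdeg c' < gdeg c"
      using c' nz gdeg_mult[of p c'] gdeg_pos[of p] p(1) by (auto simp: irreducible_def)
    thus ?thesis using less.hyps[of c'] c'W nz dvd by blast
  qed
qed

text \<open>
  Each irreducible factor of \<open>c\<close> is prime, so it divides \<open>Q\<close> or \<open>M\<close> and can be cancelled there; the factors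
  cancelled from \<open>M\<close> are collected in \<open>e\<close>.
\<close>

lemma split_content:
  fixes c F Q M :: "'a::field mpoly"
  assumes W: "factorial_in TYPE('a) W" and v: "v \<notin> W"
    and c: "c \<in> polys_in W" "c \<noteq> 0" and F: "F \<in> polys_in (insert v W)" "F \<noteq> 0"
    and "c * F = Q * M"
  shows "\<exists>e Q' M'. e \<in> polys_in W \<and> e \<noteq> 0 \<and> M = e * M' \<and> F = Q' * M'"
  using c assms(7)
proof (induction "gdeg c" arbitrary: c Q M rule: less_induct)
  case less
  show ?case
  proof (cases "c dvd 1")
    case True
    then obtain c' where "1 = c * c'" by (auto elim: dvdE)
    hence "F = (c' * Q) * M" using less.prems(3) by (metis mult.assoc mult.commute mult_1)
    thus ?thesis by (intro exI[of _ 1] exI[of _ "c' * Q"] exI[of _ M]) simp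
  next
    case False
    then obtain p where p: "irreducible p" "p dvd c"
      using exists_irreducible_factor less.prems(2) by blast
    then obtain c' where c': "c = p * c'" by (auto elim: dvdE)
    have pW: "p \<in> polys_in W" and c'W: "c' \<in> polys_in W"
      using polys_in_dvd[OF _ less.prems(1,2)] c' by auto
    have nz: "p \<noteq> 0" "c' \<noteq> 0" using c' less.prems(2) by auto
    have "c * F \<in> polys_in (insert v W)" "c * F \<noteq> 0"
      using less.prems(1,2) F polys_in_mono[of W "insert v W"] by (auto intro!: polys_in_mult)
    hence QM: "Q \<in> polys_in (insert v W)" "M \<in> polys_in (insert v W)"
      using polys_in_dvd[of Q "c * F"] polys_in_dvd[of M "c * F"] less.prems(3) by auto
    have "prime_in W p" using W p(1) pW by (auto simp: factorial_in_def)
    hence "prime_in (insert v W) p" using prime_in_insert pW v by blast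
    moreover have "p dvd Q * M" using less.prems(3) c' by (metis dvd_triv_left mult.assoc)
    ultimately have dvd: "p dvd Q \<or> p dvd M" using QM by (auto simp: prime_in_def)
    have small: "gdeg c' < gdeg c"
      using c' nz gdeg_mult[of p c'] gdeg_pos[of p] p(1) by (auto simp: irreducible_def)
    from dvd show ?thesis
    proof
      assume "p dvd Q"
      then obtain Q' where "Q = p * Q'" by (auto elim: dvdE)
      hence "p * (c' * F) = p * (Q' * M)" using less.prems(3) c' by (simp add: mult_ac)
      hence "c' * F = Q' * M" using nz by simp
      thus ?thesis using less.hyps[OF small c'W nz(2)] by blast
    next
      assume "p dvd M"
      then obtain M0 where M0: "M = p * M0" by (auto elim: dvdE)
      hence "p * (c' * F) = p * (Q * M0)" using less.prems(3) c' by (simp add: mult_ac)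
      hence "c' * F = Q * M0" using nz by simp
      then obtain e Q' M' where "e \<in> polys_in W" "e \<noteq> 0" "M0 = e * M'" "F = Q' * M'"
        using less.hyps[OF small c'W nz(2)] by blast
      thus ?thesis using M0 pW nz
        by (intro exI[of _ "p * e"] exI[of _ Q'] exI[of _ M']) (auto simp: mult_ac intro: polys_in_mult)
    qed
  qed
qed

lemma pseudo_division:
  fixes M N :: "'a::field mpoly"
  assumes v: "v \<notin> W" and M: "M \<in> polys_in (insert v W)" "M \<noteq> 0" and N: "N \<in> polys_in (insert v W)"
  shows "\<exists>c Q. c \<in> polys_in W \<and> c \<noteq> 0 \<and> Q \<in> polys_in (insert v W) \<and>
           (c * N - Q * M = 0 \<or> vdeg v (c * N - Q * M) < vdeg v M)"
  using N
proof (induction "vdeg v N" arbitrary: N rule: less_induct)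
  case less
  show ?case
  proof (cases "N = 0 \<or> vdeg v N < vdeg v M")
    case True
    thus ?thesis by (intro exI[of _ 1] exI[of _ 0]) auto
  next
    case False
    define l where "l = Polynomial.lead_coeff (collect v M)"
    define a where "a = Polynomial.lead_coeff (collect v N)"
    define k where "k = vdeg v N - vdeg v M"
    define N' where "N' = l * N - a * mvar v ^ k * M"
    have l: "l \<in> polys_in W" "l \<noteq> 0" and a: "a \<in> polys_in W"
      using polys_in_insertE[OF M(1) v] polys_in_insertE[OF less.prems v] M(2) by (auto simp: l_def a_def)
    have sub: "polys_in W \<subseteq> (polys_in (insert v W) :: 'a mpoly set)" by (rule polys_in_mono) auto
    have aX: "a * mvar v ^ k \<in> polys_in (insert v W)"
      using a sub by (auto intro!: polys_in_mult polys_in_power)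
    have N'V: "N' \<in> polys_in (insert v W)"
      unfolding N'_def using l sub
      by (intro polys_in_diff polys_in_mult[OF _ less.prems] polys_in_mult[OF aX M(1)]) auto
    have cv: "collect v (mvar v :: 'a mpoly) = [:0, 1:]"
      unfolding collect_def by (subst peval_var) (auto intro: comm_ring_hom_comp[OF mconst_hom const_poly_hom])
    interpret comm_ring_hom "collect v :: 'a mpoly \<Rightarrow> _" by (rule collect_hom)
    have cN': "collect v N' = Polynomial.smult l (collect v N) - Polynomial.monom a k * collect v M"
      unfolding N'_def
      by (simp add: hom_distribs cv collect_free[OF l(1) v] collect_free[OF a v] monom_altdef mult_ac)
    have kdeg: "k + vdeg v M = vdeg v N" using False by (simp add: k_def)
    have deg: "Polynomial.degree (Polynomial.monom a k * collect v M) \<le> vdeg v N"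
      using degree_mult_le[of "Polynomial.monom a k" "collect v M"] degree_monom_le[of a k] kdeg
      by linarith
    have "Polynomial.coeff (collect v N') (vdeg v N) = 0"
      using False by (simp add: cN' coeff_monom_mult k_def l_def a_def)
    moreover have "vdeg v N' \<le> vdeg v N"
      unfolding cN' using deg by (intro degree_diff_le) (auto intro: order.trans[OF degree_smult_le])
    ultimately have "N' = 0 \<or> vdeg v N' < vdeg v N"
      by (metis collect_eq_0_iff le_neq_implies_less leading_coeff_0_iff)
    then obtain c Q where cQ: "c \<in> polys_in W" "c \<noteq> 0" "Q \<in> polys_in (insert v W)"
      "c * N' - Q * M = 0 \<or> vdeg v (c * N' - Q * M) < vdeg v M"
    proof
      assume "N' = 0"
      thus ?thesis using that[of 1 0] by simp
    next
      assume "vdeg v N' < vdeg v N"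
      thus ?thesis using less.hyps[OF _ N'V] that by blast
    qed
    have eq: "(c * l) * N - (c * (a * mvar v ^ k) + Q) * M = c * N' - Q * M"
      by (simp add: N'_def algebra_simps)
    show ?thesis
      by (intro exI[of _ "c * l"] exI[of _ "c * (a * mvar v ^ k) + Q"], unfold eq)
         (use cQ l sub aX in \<open>auto intro!: polys_in_mult polys_in_add\<close>)
  qed
qed

lemma irreducible_no_content:
  fixes F :: "'a::field mpoly"
  assumes v: "v \<notin> W" and F: "irreducible F" "vdeg v F > 0" and p: "p \<in> polys_in W" "irreducible p"
  shows "\<not> p dvd F"
proof
  assume "p dvd F"
  then obtain u where u: "F = p * u" by (auto elim: dvdE)
  hence "u dvd 1" using F(1) p(2) by (auto simp: irreducible_def)
  then obtain k where "u = mconst k" by (auto simp: unit_mpoly_iff)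
  hence "F \<in> polys_in W" using u p by (auto intro: polys_in_mult)
  hence "vdeg v F = 0" using v by (simp add: collect_free)
  thus False using F(2) by simp
qed

text \<open>
  An element \<open>M\<close> of least degree in \<open>X v\<close> of the ideal generated by \<open>F\<close> and \<open>G\<close> divides both of them up to factors
  without \<open>X v\<close>, by pseudo-division. Stripping the content from \<open>M\<close> leaves a divisor of the irreducible \<open>F\<close>. If
  that divisor is a unit, then \<open>M\<close> is free of \<open>X v\<close>; if it is associated to \<open>F\<close>, then \<open>F\<close> divides \<open>G\<close>.
\<close>

lemma eliminate_variable:
  fixes F G :: "'a::field mpoly"
  assumes W: "factorial_in TYPE('a) W" and v: "v \<notin> W"
    and F: "F \<in> polys_in (insert v W)" "irreducible F" "vdeg v F > 0"
    and G: "G \<in> polys_in (insert v W)" "\<not> F dvd G"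
  shows "\<exists>r a b. r \<in> polys_in W \<and> r \<noteq> 0 \<and> r = a * F + b * G"
proof -
  let ?B = "polys_in (insert v W) :: 'a mpoly set"
  define I where "I = {M \<in> ?B. \<exists>a\<in>?B. \<exists>b\<in>?B. M = a * F + b * G}"
  have I_I: "a * F + b * G \<in> I" if "a \<in> ?B" "b \<in> ?B" for a b
    unfolding I_def using that F(1) G(1) by (auto intro: polys_in_add polys_in_mult)
  have FI: "F \<in> I" using I_I[of 1 0] by simp
  have GI: "G \<in> I" using I_I[of 0 1] by simp
  have F0: "F \<noteq> 0" using F by auto
  define M where "M = arg_min (vdeg v) (\<lambda>M. M \<in> I \<and> M \<noteq> 0)"
  have M: "M \<in> I" "M \<noteq> 0" and least: "\<And>N. N \<in> I \<Longrightarrow> N \<noteq> 0 \<Longrightarrow> vdeg v M \<le> vdeg v N"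
    using arg_min_nat_lemma[of "\<lambda>M. M \<in> I \<and> M \<noteq> 0" F "vdeg v"] FI F0 unfolding M_def by auto
  have MB: "M \<in> ?B" using M by (simp add: I_def)
  obtain a b where ab: "M = a * F + b * G" using M(1) by (auto simp: I_def)
  have sub: "polys_in W \<subseteq> ?B" by (rule polys_in_mono) auto
  have closed: "c * N - Q * M \<in> I" if "N \<in> I" "c \<in> ?B" "Q \<in> ?B" for c N Q
  proof -
    from that(1) obtain a1 b1 where 1: "N = a1 * F + b1 * G" "a1 \<in> ?B" "b1 \<in> ?B" "N \<in> ?B" by (auto simp: I_def)
    from M(1) obtain a2 b2 where 2: "M = a2 * F + b2 * G" "a2 \<in> ?B" "b2 \<in> ?B" by (auto simp: I_def)
    have "c * N - Q * M = (c * a1 - Q * a2) * F + (c * b1 - Q * b2) * G"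
      unfolding 1(1) 2(1) by (simp add: algebra_simps)
    moreover have "c * a1 - Q * a2 \<in> ?B" "c * b1 - Q * b2 \<in> ?B" "c * N - Q * M \<in> ?B"
      using 1 2 that MB by (auto intro!: polys_in_diff polys_in_mult)
    ultimately show ?thesis unfolding I_def by blast
  qed
  have division: "\<exists>c Q. c \<in> polys_in W \<and> c \<noteq> 0 \<and> c * N = Q * M" if "N \<in> I" for N
  proof -
    have "N \<in> ?B" using that by (simp add: I_def)
    then obtain c Q where cQ: "c \<in> polys_in W" "c \<noteq> 0" "Q \<in> ?B"
      "c * N - Q * M = 0 \<or> vdeg v (c * N - Q * M) < vdeg v M"
      using pseudo_division[OF v MB M(2)] by blast
    have "c * N - Q * M = 0"
      using least[OF closed[OF that _ cQ(3)], of c] cQ sub by force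
    thus ?thesis using cQ by (intro exI[of _ c] exI[of _ Q]) simp
  qed
  obtain c Q where c: "c \<in> polys_in W" "c \<noteq> 0" "c * F = Q * M" using division[OF FI] by blast
  obtain e Q' M' where e: "e \<in> polys_in W" "e \<noteq> 0" "M = e * M'" "F = Q' * M'"
    using split_content[OF W v c(1,2) F(1) F0 c(3)] by blast
  have "Q' dvd 1 \<or> M' dvd 1" using F(2) e(4) by (auto simp: irreducible_def)
  thus ?thesis
  proof
    assume "M' dvd 1"
    then obtain k where "M' = mconst k" by (auto simp: unit_mpoly_iff)
    hence "M \<in> polys_in W" using e by (auto intro: polys_in_mult)
    thus ?thesis using M(2) ab by blast
  next
    assume "Q' dvd 1"
    then obtain u where "1 = Q' * u" by (auto elim: dvdE)
    hence "M' = u * F" using e(4) by (metis mult.assoc mult.commute mult_1)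
    moreover obtain c2 Q2 where c2: "c2 \<in> polys_in W" "c2 \<noteq> 0" "c2 * G = Q2 * M"
      using division[OF GI] by blast
    ultimately have dvd: "F dvd c2 * G" using e(3) by (metis dvd_triv_right mult.assoc)
    have "F dvd G" using cancel_content[OF W v F(1) F0 _ c2(1,2) G(1) dvd]
        irreducible_no_content[OF v F(2,3)] by blast
    thus ?thesis using G(2) by blast
  qed
qed

text \<open>
  If \<open>F\<close> divides \<open>G * H\<close> but not \<open>G\<close>, elimination yields an \<open>r\<close> without \<open>X v\<close> in the ideal of \<open>F\<close> and \<open>G\<close>. Then \<open>F\<close>
  divides \<open>r * H\<close>, and \<open>r\<close> can be cancelled.
\<close>

theorem factorial_polys_in: "finite V \<Longrightarrow> factorial_in TYPE('a::field) V"
proof (induction V rule: finite_induct)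
  case empty
  show ?case by (auto simp: factorial_in_def polys_in_empty irreducible_def unit_mpoly_iff)
next
  case (insert v W)
  note W = insert.IH and v = insert.hyps(2)
  have "prime_in (insert v W) F" if F: "F \<in> polys_in (insert v W)" "irreducible F" for F :: "'a mpoly"
  proof (cases "vdeg v F = 0")
    case True
    hence "F \<in> polys_in W" using polys_in_insert_free[OF F(1) v] by blast
    thus ?thesis using prime_in_insert[OF _ _ v] W F(2) by (auto simp: factorial_in_def)
  next
    case False
    hence pos: "vdeg v F > 0" by simp
    have F0: "F \<noteq> 0" using F by auto
    show ?thesis unfolding prime_in_def
    proof (intro ballI impI)
      fix G H assume GH: "G \<in> polys_in (insert v W)" "H \<in> polys_in (insert v W)" "F dvd G * H"
      show "F dvd G \<or> F dvd H"
      proof (cases "F dvd G")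
        case False
        then obtain r a b where r: "r \<in> polys_in W" "r \<noteq> 0" "r = a * F + b * G"
          using eliminate_variable[OF W v F pos GH(1)] by blast
        have "r * H = F * (a * H) + b * (G * H)" unfolding r(3) by (simp add: algebra_simps)
        hence "F dvd r * H" using GH(3) by simp
        hence "F dvd H" using cancel_content[OF W v F(1) F0 _ r(1,2) GH(2)]
            irreducible_no_content[OF v F(2) pos] by blast
        thus ?thesis ..
      qed simp
    qed
  qed
  thus ?case by (auto simp: factorial_in_def)
qed

section \<open>Projective hypersurfaces\<close>
lemma mvar_neq_0 [simp]: "mvar i \<noteq> (0 :: 'a::zero_neq_one mpoly)"
  unfolding mvar_def by (metis keys_single keys_zero insert_not_empty zero_neq_one)

lemma infinite_UNIV_alg_closed: "infinite (UNIV :: 'a::alg_closed_field set)"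
proof
  assume fin: "finite (UNIV :: 'a set)"
  \<comment> \<open>Adding \<open>1\<close> to the product of all linear factors leaves no possible root.\<close>
  define p where "p = (\<Prod>a\<in>(UNIV :: 'a set). [:- a, 1:])"
  have deg: "Polynomial.degree p = card (UNIV :: 'a set)"
    unfolding p_def by (subst degree_prod_eq_sum_degree) auto
  hence "Polynomial.degree p > 0" using fin by (simp add: card_gt_0_iff)
  hence "Polynomial.degree (p + 1) > 0" by (subst degree_add_eq_left) auto
  then obtain x where "poly (p + 1) x = 0" using alg_closed_imp_poly_has_root by blast
  moreover have "poly p x = 0" unfolding p_def poly_prod using fin by (auto intro!: prod_zero)
  ultimately show False by simp
qed

lemma hom_poly:
  assumes "comm_ring_hom h" shows "h (poly q a) = poly (map_poly h q) (h a)"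
proof -
  interpret comm_ring_hom h by fact
  show ?thesis by (induction q) (auto simp: map_poly_pCons hom_distribs)
qed

lemma peval_collect:
  assumes f: "comm_ring_hom f"
  shows "peval f y G = poly (map_poly (peval f y) (collect v G)) (y v)"
  using hom_poly[OF peval_hom[OF f, of y], of "collect v G" "mvar v"] by (simp add: f)

lemma peval_free: "G \<in> polys_in V \<Longrightarrow> v \<notin> V \<Longrightarrow> peval f (x(v := t)) G = peval f x G"
  by (rule peval_cong) auto

lemma peval_update:
  assumes f: "comm_ring_hom f"
  shows "peval f (x(v := t)) G = poly (map_poly (peval f x) (collect v G)) t"
proof -
  have "map_poly (peval f (x(v := t))) (collect v G) = map_poly (peval f x) (collect v G)"
    using coeff_collect_in[of G UNIV v]
    by (intro poly_eqI) (simp add: coeff_map_poly f polys_in_def peval_free[of _ "UNIV - {v}" v])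
  thus ?thesis using peval_collect[OF f, of "x(v := t)" G v] by simp
qed

lemma exists_nonvanishing_point:
  fixes f :: "'a::field \<Rightarrow> 'b::alg_closed_field"
  assumes f: "comm_ring_hom f" and inj: "\<And>c. f c = 0 \<Longrightarrow> c = 0"
    and "finite V" and "G \<in> polys_in V" "G \<noteq> 0"
  shows "\<exists>x. peval f x G \<noteq> 0"
  using assms(3-5)
proof (induction V arbitrary: G rule: finite_induct)
  case empty
  then obtain c where "G = mconst c" by (auto simp: polys_in_empty)
  thus ?case using empty inj by (auto simp: f)
next
  case (insert v W)
  have "Polynomial.lead_coeff (collect v G) \<noteq> 0" using insert.prems by simp
  then obtain x where x: "peval f x (Polynomial.lead_coeff (collect v G)) \<noteq> 0"
    using insert.IH[OF polys_in_insertE[OF insert.prems(1) insert.hyps(2)]] by blast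
  have "Polynomial.coeff (map_poly (peval f x) (collect v G)) (vdeg v G) \<noteq> 0"
    using x by (simp add: coeff_map_poly f)
  hence "map_poly (peval f x) (collect v G) \<noteq> 0" by (metis coeff_0)
  hence "finite {t. poly (map_poly (peval f x) (collect v G)) t = 0}" by (rule poly_roots_finite)
  hence "{t. poly (map_poly (peval f x) (collect v G)) t = 0} \<noteq> UNIV"
    using infinite_UNIV_alg_closed[where 'a = 'b] by metis
  then obtain t where "poly (map_poly (peval f x) (collect v G)) t \<noteq> 0" by blast
  thus ?case using peval_update[OF f, of x v t G] by metis
qed

lemma irreducible_involves_variable:
  fixes F :: "'a::field mpoly"
  assumes "F \<in> polys_in V" "irreducible F" obtains v where "v \<in> V" "vdeg v F > 0"
proof (rule ccontr)
  assume "\<not> thesis"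
  hence "v \<in> V \<Longrightarrow> F \<in> polys_in (- {v})" for v using that vdeg_eq_0_iff[of v F] by auto
  hence "i \<notin> keys m" if "m \<in> keys F" for m i
    using that assms(1) unfolding polys_in_def by blast
  hence "F \<in> polys_in {}" unfolding polys_in_def by blast
  thus False using assms(2) by (auto simp: polys_in_empty irreducible_def unit_mpoly_iff)
qed

text \<open>
  If \<open>F\<close> does not divide \<open>G\<close>, elimination yields an \<open>r\<close> without \<open>X v\<close> that vanishes at the common zeros. Choose the
  other coordinates such that neither \<open>r\<close> nor the leading coefficient of \<open>F\<close> in \<open>X v\<close> vanishes, and solve \<open>F = 0\<close>
  for the remaining one. The condition at \<open>u\<close> lets this be applied to projective points.
\<close>

lemma dvd_if_vanishes_on_hypersurface:
  fixes f :: "'a::field \<Rightarrow> 'b::alg_closed_field"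
  assumes f: "comm_ring_hom f" and inj: "\<And>c. f c = 0 \<Longrightarrow> c = 0"
    and V: "finite V" and F: "F \<in> polys_in V" "irreducible F" and G: "G \<in> polys_in V"
    and v: "v \<in> V" "vdeg v F > 0" and u: "u \<in> V" "u \<noteq> v"
    and van: "\<And>y. y u \<noteq> 0 \<Longrightarrow> (\<And>i. i \<notin> V \<Longrightarrow> y i = 0) \<Longrightarrow> peval f y F = 0 \<Longrightarrow> peval f y G = 0"
  shows "F dvd G"
proof (rule ccontr)
  assume "\<not> F dvd G"
  define W where "W = V - {v}"
  have W: "insert v W = V" "v \<notin> W" "finite W" using v V by (auto simp: W_def)
  obtain r a b where r: "r \<in> polys_in W" "r \<noteq> 0" "r = a * F + b * G"
    using eliminate_variable[OF factorial_polys_in[OF W(3)] W(2), of F G] W(1) F G v(2) \<open>\<not> F dvd G\<close> by blast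
  define l where "l = Polynomial.lead_coeff (collect v F)"
  have l: "l \<in> polys_in W" "l \<noteq> 0"
    using polys_in_insertE[of F v W] W F by (auto simp: l_def irreducible_def)
  have uW: "u \<in> W" using u by (simp add: W_def)
  have "r * l * mvar u \<in> polys_in W" using r l uW by (auto intro!: polys_in_mult)
  moreover have "r * l * mvar u \<noteq> 0" using r(2) l(2) mvar_neq_0[of u] by simp
  ultimately obtain x0 where x0: "peval f x0 (r * l * mvar u) \<noteq> 0"
    using exists_nonvanishing_point[OF f inj W(3)] by blast
  define x where "x = (\<lambda>i. if i \<in> W then x0 i else 0)"
  have xx0: "peval f x H = peval f x0 H" if "H \<in> polys_in W" for H
    using that by (rule peval_cong) (simp add: x_def)
  have x: "peval f x r \<noteq> 0" "peval f x l \<noteq> 0" "x u \<noteq> 0"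
    unfolding xx0[OF r(1)] xx0[OF l(1)] using x0 uW by (auto simp: f x_def)
  define q where "q = map_poly (peval f x) (collect v F)"
  have "Polynomial.coeff q (vdeg v F) \<noteq> 0" using x(2) by (simp add: q_def coeff_map_poly f l_def)
  hence "Polynomial.degree q > 0" using le_degree[of q "vdeg v F"] v(2) by linarith
  then obtain t where t: "poly q t = 0" using alg_closed_imp_poly_has_root by blast
  let ?y = "x(v := t)"
  have "peval f ?y F = 0" using t by (simp add: peval_update[OF f] q_def)
  moreover have "peval f ?y G = 0"
    by (rule van) (use x u W v calculation in \<open>auto simp: x_def W_def\<close>)
  ultimately have "peval f ?y r = 0" by (simp add: r(3) f)
  thus False using x(1) peval_free[OF r(1) W(2), of f x t] by simp
qed

text \<open>
  The projective point with homogeneous coordinates \<open>x\<close>.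
\<close>

definition ray :: "(nat \<Rightarrow> 'a::field) \<Rightarrow> (nat \<Rightarrow> 'a) set" where
  "ray x = {\<lambda>i. c * x i | c. c \<noteq> 0}"

lemma proj_space_eq: "proj_space n = ray ` proj_vecs n"
proof -
  have "{(x, y). x \<in> proj_vecs n \<and> y \<in> proj_vecs n \<and> (\<exists>c. c \<noteq> 0 \<and> y = (\<lambda>i. c * x i))} `` {x} = ray x"
    if "x \<in> proj_vecs n" for x :: "nat \<Rightarrow> 'a"
    using that by (auto simp: ray_def proj_vecs_def)
  thus ?thesis by (auto simp: proj_space_def quotient_def)
qed

lemma self_in_ray: "x \<in> ray x"
  unfolding ray_def by (rule CollectI, rule exI[of _ 1]) simp

lemma ray_subset: "x \<in> proj_vecs n \<Longrightarrow> ray x \<subseteq> proj_vecs n"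
  by (auto simp: ray_def proj_vecs_def)

lemma vanishes_at_ray:
  assumes "F \<in> forms n d" shows "vanishes_at F (ray x) \<longleftrightarrow> meval F x = 0"
proof
  assume "vanishes_at F (ray x)"
  thus "meval F x = 0" using self_in_ray[of x] by (auto simp: vanishes_at_def)
next
  assume "meval F x = 0"
  thus "vanishes_at F (ray x)"
    using peval_scale[OF comm_ring_hom_id assms] by (auto simp: vanishes_at_def ray_def meval_eq)
qed

lemma base_change_forms: "base_change F \<in> forms n d \<longleftrightarrow> F \<in> forms n d"
  by (simp add: forms_eq polys_in_def keys_base_change)

lemma Union_zero_locus:
  assumes "T \<subseteq> (\<Union>d. forms n d)"
  shows "\<Union> (zero_locus n T) = {x \<in> proj_vecs n. \<forall>F\<in>T. meval F x = 0}"
proof (intro equalityI subsetI)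
  fix x assume "x \<in> \<Union> (zero_locus n T)"
  then obtain y where y: "y \<in> proj_vecs n" "x \<in> ray y" "\<forall>F\<in>T. vanishes_at F (ray y)"
    by (auto simp: zero_locus_def proj_space_eq)
  thus "x \<in> {x \<in> proj_vecs n. \<forall>F\<in>T. meval F x = 0}"
    using ray_subset[OF y(1)] by (auto simp: vanishes_at_def)
next
  fix x assume x: "x \<in> {x \<in> proj_vecs n. \<forall>F\<in>T. meval F x = 0}"
  have "ray x \<in> zero_locus n T"
    using x assms by (auto simp: zero_locus_def proj_space_eq vanishes_at_ray)
  thus "x \<in> \<Union> (zero_locus n T)" using self_in_ray by blast
qed

lemma vanishes_on_iff: "vanishes_on F Z \<longleftrightarrow> (\<forall>x\<in>\<Union> Z. peval to_ac x F = 0)"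
  by (auto simp: vanishes_on_def vanishes_at_def meval_base_change)

lemma variety_proj_space: "variety n Z \<Longrightarrow> Z \<subseteq> proj_space n"
  by (auto simp: variety_def zero_locus_def)

lemma zariski_closed_form: "F \<in> forms n d \<Longrightarrow> zariski_closed n (zero_locus n {F})"
  unfolding zariski_closed_def by (rule exI[of _ "{F}"]) auto

lemma subset_zero_locus_form:
  assumes "Z \<subseteq> proj_space n" shows "Z \<subseteq> zero_locus n {base_change F} \<longleftrightarrow> vanishes_on F Z"
  using assms by (auto simp: zero_locus_def vanishes_on_def)

lemma vanishes_on_mult_iff:
  assumes Z: "variety n Z" and G: "G \<in> forms n d" and H: "H \<in> forms n e"
  shows "vanishes_on (G * H) Z \<longleftrightarrow> vanishes_on G Z \<or> vanishes_on H Z"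
proof
  assume GH: "vanishes_on (G * H) Z"
  have "Z \<subseteq> zero_locus n {base_change G} \<union> zero_locus n {base_change H}"
  proof
    fix P assume P: "P \<in> Z"
    then obtain x where x: "P = ray x" "x \<in> proj_vecs n"
      using variety_proj_space[OF Z] by (auto simp: proj_space_eq)
    have "peval to_ac x (G * H) = 0" using GH P x(1) self_in_ray[of x] by (auto simp: vanishes_on_iff)
    hence "peval to_ac x G = 0 \<or> peval to_ac x H = 0" by (simp add: to_ac_hom)
    thus "P \<in> zero_locus n {base_change G} \<union> zero_locus n {base_change H}"
      using x vanishes_at_ray[of "base_change G" n d] vanishes_at_ray[of "base_change H" n e] G H
      by (auto simp: zero_locus_def proj_space_eq base_change_forms meval_base_change)
  qed
  hence "Z \<subseteq> zero_locus n {base_change G} \<or> Z \<subseteq> zero_locus n {base_change H}"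
    using Z zariski_closed_form[of "base_change G" n d] zariski_closed_form[of "base_change H" n e] G H
    unfolding variety_def zariski_irreducible_def base_change_forms by blast
  thus "vanishes_on G Z \<or> vanishes_on H Z"
    using subset_zero_locus_form[OF variety_proj_space[OF Z]] by blast
qed (auto simp: vanishes_on_iff to_ac_hom)

lemma variety_nonempty: "variety n Z \<Longrightarrow> \<exists>x\<in>\<Union> Z. x \<in> proj_vecs n"
proof -
  assume Z: "variety n Z"
  hence "Z \<noteq> {}" unfolding variety_def zariski_irreducible_def by blast
  then obtain P where P: "P \<in> Z" by blast
  then obtain x where "P = ray x" "x \<in> proj_vecs n"
    using variety_proj_space[OF Z] by (auto simp: proj_space_eq)
  thus ?thesis using P self_in_ray[of x] by blast
qed

lemma vanishes_on_const: "variety n Z \<Longrightarrow> vanishes_on (mconst c) Z \<longleftrightarrow> c = 0"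
  using variety_nonempty[of n Z] by (auto simp: vanishes_on_iff to_ac_hom)

lemma vanishes_on_power_iff:
  assumes Z: "variety n Z" and G: "G \<in> forms n d"
  shows "vanishes_on (G ^ k) Z \<longleftrightarrow> k > 0 \<and> vanishes_on G Z"
proof (induction k)
  case 0
  show ?case using vanishes_on_const[OF Z, of 1] by (simp add: mconst_1)
next
  case (Suc k)
  thus ?case using vanishes_on_mult_iff[OF Z G forms_power[OF G, of k]] by auto
qed

lemma surj_to_ac:
  assumes "alg_closed_type TYPE('k::field)" shows "surj (to_ac :: 'k::field \<Rightarrow> 'k alg_closure)"
proof -
  have *: "x \<in> range to_ac" if "p \<noteq> 0" "poly (map_poly to_ac p) x = 0" for p :: "'k poly" and x
    using that
  proof (induction "Polynomial.degree p" arbitrary: p rule: less_induct)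
    case less
    show ?case
    proof (cases "Polynomial.degree p = 0")
      case True
      then obtain c where "p = [:c:]" by (auto elim: degree_eq_zeroE)
      thus ?thesis using less.prems by (simp add: map_poly_pCons)
    next
      case False
      then obtain a where "poly p a = 0" using assms by (auto simp: alg_closed_type_def)
      then obtain q where q: "p = [:- a, 1:] * q" by (auto simp: poly_eq_0_iff_dvd elim: dvdE)
      have q0: "q \<noteq> 0" using q less.prems(1) by auto
      hence deg: "Polynomial.degree q < Polynomial.degree p" 
        unfolding q using q0 by (subst degree_mult_eq) auto
      have mp: "map_poly to_ac p = map_poly to_ac [:- a, 1:] * map_poly to_ac q"
        unfolding q by (rule poly_eqI) (simp add: coeff_map_poly coeff_mult to_ac_sum del: mult_pCons_left)
      have "poly (map_poly to_ac p) x = (x - to_ac a) * poly (map_poly to_ac q) x"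
        by (simp add: mp map_poly_pCons algebra_simps)
      thus ?thesis using less.hyps[OF deg q0] less.prems(2) by auto
    qed
  qed
  show ?thesis
    using * alg_closure_algebraic by blast
qed

lemma surj_base_change:
  assumes "alg_closed_type TYPE('k::field)" obtains F :: "'k::field mpoly" where "G = base_change F"
proof -
  have inv: "to_ac (inv_into UNIV to_ac c) = c" for c :: "'k alg_closure"
    using surj_to_ac[OF assms] by (rule surj_f_inv_f)
  have "inv_into UNIV to_ac (0 :: 'k alg_closure) = 0" using inv[of 0] by simp
  hence "G = base_change (Poly_Mapping.map (inv_into UNIV to_ac) G)"
    by (intro poly_mapping_eqI) (simp add: lookup_base_change Poly_Mapping.map.rep_eq inv when_def)
  thus ?thesis by (rule that)
qed

lemma Union_hypersurface:
  "F \<in> forms n d \<Longrightarrow> \<Union> (zero_locus n {base_change F}) = {x \<in> proj_vecs n. peval to_ac x F = 0}"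
  using Union_zero_locus[of "{base_change F}" n] by (auto simp: base_change_forms meval_base_change)

lemma vanishes_on_hypersurface:
  assumes n: "n \<ge> 1" and F: "F \<in> forms n d" "irreducible F" and G: "G \<in> polys_in {..n}"
  shows "vanishes_on G (zero_locus n {base_change F}) \<longleftrightarrow> F dvd G"
proof
  assume van: "vanishes_on G (zero_locus n {base_change F})"
  obtain v where v: "v \<in> {..n}" "vdeg v F > 0"
    using irreducible_involves_variable[OF formsD[OF F(1)] F(2)] by blast
  define u where "u = (if v = 0 then 1 else 0 :: nat)"
  have u: "u \<in> {..n}" "u \<noteq> v" using n by (auto simp: u_def)
  show "F dvd G"
  proof (rule dvd_if_vanishes_on_hypersurface[OF to_ac_hom _ _ formsD[OF F(1)] F(2) G v u])
    fix y :: "nat \<Rightarrow> 'a alg_closure"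
    assume y: "y u \<noteq> 0" "\<And>i. i \<notin> {..n} \<Longrightarrow> y i = 0" "peval to_ac y F = 0"
    hence "y \<in> proj_vecs n" using u by (auto simp: proj_vecs_def)
    thus "peval to_ac y G = 0"
      using van y(3) Union_hypersurface[OF F(1)] by (auto simp: vanishes_on_iff)
  qed auto
next
  assume "F dvd G"
  then obtain H where "G = F * H" by (auto elim: dvdE)
  thus "vanishes_on G (zero_locus n {base_change F})"
    using Union_hypersurface[OF F(1)] by (auto simp: vanishes_on_iff to_ac_hom)
qed

lemma defined_by_hypersurface:
  assumes n: "n \<ge> 1" and F: "F \<in> forms n d" "irreducible F"
  shows "defined_by n (zero_locus n {base_change F}) F"
  unfolding defined_by_def polys_eq
proof (intro conjI equalityI subsetI)
  show "\<exists>d. F \<in> forms n d" using F by blast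
next
  fix G assume "G \<in> {G \<in> polys_in {..n}. vanishes_on G (zero_locus n {base_change F})}"
  hence G: "G \<in> polys_in {..n}" "F dvd G" using vanishes_on_hypersurface[OF assms] by auto
  then obtain H where H: "G = F * H" by (auto elim: dvdE)
  show "G \<in> {F * G | G. G \<in> polys_in {..n}}"
  proof (cases "G = 0")
    case True thus ?thesis by (intro CollectI exI[of _ 0]) simp
  next
    case False thus ?thesis using H G(1) polys_in_dvd[of H G] by auto
  qed
next
  fix G assume "G \<in> {F * G | G. G \<in> polys_in {..n}}"
  then obtain H where H: "G = F * H" "H \<in> polys_in {..n}" by blast
  hence "G \<in> polys_in {..n}" using formsD[OF F(1)] by (auto intro: polys_in_mult)
  thus "G \<in> {G \<in> polys_in {..n}. vanishes_on G (zero_locus n {base_change F})}"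
    using vanishes_on_hypersurface[OF assms] H by auto
qed

text \<open>
  Closed sets that do not contain the hypersurface lie in the zero sets of forms that \<open>F\<close> does not divide. Such forms
  may be taken over \<open>'k\<close>, and since \<open>F\<close> is prime it does not divide their product.
\<close>

lemma variety_hypersurface:
  fixes F :: "'k::field mpoly"
  assumes ac: "alg_closed_type TYPE('k)" and n: "n \<ge> 1" and F: "F \<in> forms n d" "irreducible F"
  shows "variety n (zero_locus n {base_change F})"
proof -
  let ?S = "zero_locus n {base_change F}"
  have ex: "\<exists>G e. G \<in> forms n e \<and> A \<subseteq> zero_locus n {base_change G} \<and> \<not> vanishes_on G ?S"
    if A: "zariski_closed n A" and no: "\<not> ?S \<subseteq> A" for A
  proof -
    obtain T where T: "T \<subseteq> (\<Union>d. forms n d)" "A = zero_locus n T" using A by (auto simp: zariski_closed_def)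
    obtain P where P: "P \<in> ?S" "P \<notin> A" using no by blast
    then obtain G' where G': "G' \<in> T" "\<not> vanishes_at G' P" using T by (auto simp: zero_locus_def)
    obtain G :: "'k mpoly" where G: "G' = base_change G" by (rule surj_base_change[OF ac])
    obtain e where "G \<in> forms n e" using G' T(1) G base_change_forms by blast
    moreover have "A \<subseteq> zero_locus n {base_change G}" using G' T(2) G by (auto simp: zero_locus_def)
    moreover have "\<not> vanishes_on G ?S" using G' P G by (auto simp: vanishes_on_def)
    ultimately show ?thesis by blast
  qed
  have "?S \<subseteq> A \<or> ?S \<subseteq> B" if AB: "zariski_closed n A" "zariski_closed n B" "?S \<subseteq> A \<union> B" for A B
  proof (rule ccontr)
    assume "\<not> ?thesis"
    then obtain G H d e where GH: "G \<in> forms n d" "A \<subseteq> zero_locus n {base_change G}" "\<not> vanishes_on G ?S"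
      "H \<in> forms n e" "B \<subseteq> zero_locus n {base_change H}" "\<not> vanishes_on H ?S"
      using ex[OF AB(1)] ex[OF AB(2)] by blast
    have "vanishes_on (G * H) ?S" unfolding vanishes_on_iff
    proof
      fix x assume "x \<in> \<Union> ?S"
      then obtain P where "x \<in> P" "P \<in> zero_locus n {base_change G} \<or> P \<in> zero_locus n {base_change H}"
        using AB(3) GH(2,5) by blast
      thus "peval to_ac x (G * H) = 0"
        by (auto simp: zero_locus_def vanishes_at_def meval_base_change to_ac_hom)
    qed
    moreover note pG = formsD[OF GH(1)] and pH = formsD[OF GH(4)]
    ultimately have "F dvd G * H"
      using vanishes_on_hypersurface[OF n F polys_in_mult[OF pG pH]] by blast
    moreover have "prime_in {..n} F"
      using factorial_polys_in[of "{..n}"] formsD[OF F(1)] F(2) unfolding factorial_in_def by blast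
    ultimately have "F dvd G \<or> F dvd H" using pG pH by (auto simp: prime_in_def)
    thus False using GH(3,6) vanishes_on_hypersurface[OF n F] pG pH by blast
  qed
  moreover have "?S \<noteq> {}"
  proof
    assume "?S = {}"
    hence "F dvd 1" using vanishes_on_hypersurface[OF n F, of 1] by (auto simp: vanishes_on_def)
    thus False using F(2) by (auto simp: irreducible_def)
  qed
  moreover have "\<exists>T \<subseteq> (\<Union>d. forms n d :: 'k mpoly set). ?S = zero_locus n (base_change ` T)"
    using F(1) by (intro exI[of _ "{F}"]) auto
  ultimately show ?thesis unfolding variety_def zariski_irreducible_def by blast
qed

section \<open>The function field of a variety\<close>
lemma local_ring_simps [simp]:
  "monoid.mult (local_ring n Z) = (*)" "one (local_ring n Z) = 1"
  "ring.zero (local_ring n Z) = 0" "add (local_ring n Z) = (+)"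
  by (simp_all add: local_ring_def)

lemma vanishes_on_0 [simp]: "vanishes_on 0 Z"
  by (simp add: vanishes_on_iff to_ac_hom)

lemma vanishes_on_add: "vanishes_on F Z \<Longrightarrow> vanishes_on G Z \<Longrightarrow> vanishes_on (F + G) Z"
  by (simp add: vanishes_on_iff to_ac_hom)

lemma vanishes_on_multI: "vanishes_on F Z \<Longrightarrow> vanishes_on (F * G) Z" "vanishes_on F Z \<Longrightarrow> vanishes_on (G * F) Z"
  by (simp_all add: vanishes_on_iff to_ac_hom)

lemma local_ringI: "G \<in> forms n d \<Longrightarrow> H \<in> forms n d \<Longrightarrow> \<not> vanishes_on H Z \<Longrightarrow> Fract G H \<in> carrier (local_ring n Z)"
  by (auto simp: local_ring_def)

lemma local_ringE:
  assumes "x \<in> carrier (local_ring n Z)"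
  obtains G H d where "x = Fract G H" "G \<in> forms n d" "H \<in> forms n d" "\<not> vanishes_on H Z" "H \<noteq> 0"
  using assms that by (fastforce simp: local_ring_def)

lemma local_idealI: "G \<in> forms n d \<Longrightarrow> H \<in> forms n d \<Longrightarrow> vanishes_on G Z \<Longrightarrow> \<not> vanishes_on H Z \<Longrightarrow> Fract G H \<in> local_ideal n Z"
  by (auto simp: local_ideal_def)

lemma local_idealE:
  assumes "x \<in> local_ideal n Z"
  obtains G H d where "x = Fract G H" "G \<in> forms n d" "H \<in> forms n d" "vanishes_on G Z" "\<not> vanishes_on H Z" "H \<noteq> 0"
  using assms that by (fastforce simp: local_ideal_def)

context
  fixes n :: nat and Z :: "(nat \<Rightarrow> 'k::field alg_closure) set set"
  assumes Z: "variety n Z"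
begin

abbreviation (input) "\<O> \<equiv> local_ring n Z"
abbreviation (input) "\<K> \<equiv> function_field n Z"

lemma local_ring_add:
  assumes "x \<in> carrier \<O>" "y \<in> carrier \<O>" shows "x + y \<in> carrier \<O>"
proof -
  obtain G H d where 1: "x = Fract G H" "G \<in> forms n d" "H \<in> forms n d" "\<not> vanishes_on H Z" "H \<noteq> 0"
    using assms(1) by (rule local_ringE)
  obtain G' H' e where 2: "y = Fract G' H'" "G' \<in> forms n e" "H' \<in> forms n e" "\<not> vanishes_on H' Z" "H' \<noteq> 0"
    using assms(2) by (rule local_ringE)
  have "x + y = Fract (G * H' + G' * H) (H * H')" using 1 2 by simp
  moreover have "G * H' + G' * H \<in> forms n (d + e)"
    using forms_mult[OF 1(2) 2(3)] forms_mult[OF 2(2) 1(3)] by (intro forms_add) (simp_all add: add.commute)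
  ultimately show ?thesis
    using 1 2 vanishes_on_mult_iff[OF Z 1(3) 2(3)] by (metis local_ringI forms_mult)
qed

lemma local_ring_mult:
  assumes "x \<in> carrier \<O>" "y \<in> carrier \<O>" shows "x * y \<in> carrier \<O>"
proof -
  obtain G H d where 1: "x = Fract G H" "G \<in> forms n d" "H \<in> forms n d" "\<not> vanishes_on H Z" "H \<noteq> 0"
    using assms(1) by (rule local_ringE)
  obtain G' H' e where 2: "y = Fract G' H'" "G' \<in> forms n e" "H' \<in> forms n e" "\<not> vanishes_on H' Z" "H' \<noteq> 0"
    using assms(2) by (rule local_ringE)
  have "x * y = Fract (G * G') (H * H')" using 1 2 by simp
  thus ?thesis
    using 1 2 vanishes_on_mult_iff[OF Z 1(3) 2(3)] by (metis local_ringI forms_mult)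
qed

lemma local_ring_uminus:
  assumes "x \<in> carrier \<O>" shows "- x \<in> carrier \<O>"
proof -
  obtain G H d where 1: "x = Fract G H" "G \<in> forms n d" "H \<in> forms n d" "\<not> vanishes_on H Z" "H \<noteq> 0"
    using assms by (rule local_ringE)
  thus ?thesis using local_ringI[OF forms_uminus[OF 1(2)] 1(3,4)] by simp
qed

lemma one_not_vanishing: "\<not> vanishes_on 1 Z"
  using vanishes_on_const[OF Z, of 1] by (simp add: mconst_1)

lemma local_ring_const: "Fract (mconst c) 1 \<in> carrier \<O>"
  by (rule local_ringI[OF forms_const forms_one one_not_vanishing])

lemma local_ring_cring: "cring \<O>"
proof (rule cringI)
  show "abelian_group \<O>"
  proof (rule abelian_groupI; (simp add: local_ring_add add_ac)?)
    show "0 \<in> carrier \<O>" using local_ring_const[of 0] by (simp add: fract_collapse)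
    show "\<exists>y\<in>carrier \<O>. x + y = 0" if "x \<in> carrier \<O>" for x
      using local_ring_uminus[OF that] by (intro bexI[of _ "- x"]) auto
  qed
  show "Group.comm_monoid \<O>"
  proof (rule comm_monoidI; (simp add: local_ring_mult mult_ac)?)
    show "1 \<in> carrier \<O>" using local_ring_const[of 1] by (simp add: mconst_1 fract_collapse)
  qed
qed (simp add: distrib_right)

lemma local_ring_a_inv: "x \<in> carrier \<O> \<Longrightarrow> a_inv \<O> x = - x"
proof -
  interpret cring \<O> by (rule local_ring_cring)
  assume "x \<in> carrier \<O>"
  thus ?thesis using minus_equality[of "- x" x] local_ring_uminus by simp
qed

lemma local_ideal_subset: "local_ideal n Z \<subseteq> carrier \<O>"
  by (auto elim!: local_idealE intro: local_ringI)

lemma Fract_in_local_ideal_iff: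
  assumes "G \<in> forms n d" "H \<in> forms n d" "\<not> vanishes_on H Z"
  shows "Fract G H \<in> local_ideal n Z \<longleftrightarrow> vanishes_on G Z"
proof
  assume "Fract G H \<in> local_ideal n Z"
  then obtain G' H' e where 1: "Fract G H = Fract G' H'" "G' \<in> forms n e" "H' \<in> forms n e"
    "vanishes_on G' Z" "\<not> vanishes_on H' Z" "H' \<noteq> 0" by (rule local_idealE)
  have "H \<noteq> 0" using assms(3) by auto
  hence "G * H' = G' * H" using 1(1,6) eq_fract(1)[of H H' G G'] by blast
  hence "vanishes_on (G * H') Z" using vanishes_on_multI(1)[OF 1(4)] by simp
  thus "vanishes_on G Z" using vanishes_on_mult_iff[OF Z assms(1) 1(3)] 1(5) by blast
qed (use local_idealI assms in blast)

lemma local_ideal_add: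
  assumes "x \<in> local_ideal n Z" "y \<in> local_ideal n Z" shows "x + y \<in> local_ideal n Z"
proof -
  obtain G H d where 1: "x = Fract G H" "G \<in> forms n d" "H \<in> forms n d" "vanishes_on G Z" "\<not> vanishes_on H Z" "H \<noteq> 0"
    using assms(1) by (rule local_idealE)
  obtain G' H' e where 2: "y = Fract G' H'" "G' \<in> forms n e" "H' \<in> forms n e" "vanishes_on G' Z" "\<not> vanishes_on H' Z" "H' \<noteq> 0"
    using assms(2) by (rule local_idealE)
  have "x + y = Fract (G * H' + G' * H) (H * H')" using 1 2 by simp
  moreover have "G * H' + G' * H \<in> forms n (d + e)"
    using forms_mult[OF 1(2) 2(3)] forms_mult[OF 2(2) 1(3)] by (intro forms_add) (simp_all add: add.commute)
  moreover have "vanishes_on (G * H' + G' * H) Z" using 1 2 by (auto intro: vanishes_on_add vanishes_on_multI)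
  ultimately show ?thesis
    using 1 2 vanishes_on_mult_iff[OF Z 1(3) 2(3)] by (metis local_idealI forms_mult)
qed

lemma local_ideal_mult:
  assumes "x \<in> local_ideal n Z" "y \<in> carrier \<O>" shows "x * y \<in> local_ideal n Z"
proof -
  obtain G H d where 1: "x = Fract G H" "G \<in> forms n d" "H \<in> forms n d" "vanishes_on G Z" "\<not> vanishes_on H Z" "H \<noteq> 0"
    using assms(1) by (rule local_idealE)
  obtain G' H' e where 2: "y = Fract G' H'" "G' \<in> forms n e" "H' \<in> forms n e" "\<not> vanishes_on H' Z" "H' \<noteq> 0"
    using assms(2) by (rule local_ringE)
  have "x * y = Fract (G * G') (H * H')" using 1 2 by simp
  moreover have "vanishes_on (G * G') Z" using 1 by (auto intro: vanishes_on_multI)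
  ultimately show ?thesis
    using 1 2 vanishes_on_mult_iff[OF Z 1(3) 2(3)] by (metis local_idealI forms_mult)
qed

lemma local_ideal_ideal: "ideal (local_ideal n Z) \<O>"
proof -
  interpret cring \<O> by (rule local_ring_cring)
  have zero: "0 \<in> local_ideal n Z"
    using Fract_in_local_ideal_iff[OF forms_0 forms_one one_not_vanishing] by (simp add: fract_collapse)
  show ?thesis
  proof (rule idealI[OF ring_axioms])
    show "subgroup (local_ideal n Z) (add_monoid \<O>)"
    proof (rule add.subgroupI)
      show "local_ideal n Z \<noteq> {}" using zero by auto
      show "a_inv \<O> x \<in> local_ideal n Z" if x: "x \<in> local_ideal n Z" for x
      proof -
        have "x * (- 1) \<in> local_ideal n Z"
          using local_ideal_mult[OF x local_ring_uminus[OF one_closed]] by simp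
        thus ?thesis using local_ideal_subset x by (auto simp: local_ring_a_inv)
      qed
    qed (use local_ideal_subset local_ideal_add in auto)
  qed (use local_ideal_mult in \<open>auto simp: mult.commute\<close>)
qed

text \<open>
  A quotient outside the ideal is inverted by exchanging numerator and denominator.
\<close>

lemma local_ideal_maximal: "maximalideal (local_ideal n Z) \<O>"
proof -
  interpret cring \<O> by (rule local_ring_cring)
  show ?thesis
  proof (rule maximalidealI[OF local_ideal_ideal])
    have "1 \<notin> local_ideal n Z"
      using Fract_in_local_ideal_iff[OF forms_one forms_one one_not_vanishing] one_not_vanishing
      by (simp add: fract_collapse)
    thus "carrier \<O> \<noteq> local_ideal n Z" using one_closed by auto
  next
    fix J assume J: "ideal J \<O>" "local_ideal n Z \<subseteq> J" "J \<subseteq> carrier \<O>"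
    interpret J: ideal J \<O> by (rule J(1))
    show "J = local_ideal n Z \<or> J = carrier \<O>"
    proof (rule disjCI)
      assume "J \<noteq> carrier \<O>"
      show "J = local_ideal n Z"
      proof (rule ccontr)
        assume "J \<noteq> local_ideal n Z"
        then obtain x where x: "x \<in> J" "x \<notin> local_ideal n Z" using J(2) by blast
        then obtain G H d where 1: "x = Fract G H" "G \<in> forms n d" "H \<in> forms n d" "\<not> vanishes_on H Z" "H \<noteq> 0"
          using J(3) by (blast elim: local_ringE)
        have G: "\<not> vanishes_on G Z" using x(2) 1 local_idealI by blast
        hence "G \<noteq> 0" by auto
        hence "x * Fract H G = 1" using 1 by (simp add: eq_fract One_fract_def)
        moreover have "Fract H G \<in> carrier \<O>" using local_ringI[OF 1(3,2) G] .
        ultimately have "1 \<in> J" using J.I_r_closed[OF x(1)] by force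
        hence "J = carrier \<O>" using J.one_imp_carrier by simp
        thus False using \<open>J \<noteq> carrier \<O>\<close> by simp
      qed
    qed
  qed
qed

lemma function_field_field: "field \<K>"
  unfolding function_field_def
  by (rule maximalideal.quotient_is_field[OF local_ideal_maximal local_ring_cring])

lemma function_field_coset_hom: "(+>\<^bsub>\<O>\<^esub>) (local_ideal n Z) \<in> Ring.ring_hom \<O> \<K>"
  unfolding function_field_def by (rule ideal.rcos_ring_hom[OF local_ideal_ideal])

lemma ratio_closed:
  "G \<in> forms n d \<Longrightarrow> H \<in> forms n d \<Longrightarrow> \<not> vanishes_on H Z \<Longrightarrow> ratio n Z G H \<in> carrier \<K>"
  unfolding ratio_def by (rule ring_hom_memE(1)[OF function_field_coset_hom local_ringI])

lemma function_fieldE: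
  assumes "x \<in> carrier \<K>"
  obtains G H d where "x = ratio n Z G H" "G \<in> forms n d" "H \<in> forms n d" "\<not> vanishes_on H Z"
proof -
  obtain a where "a \<in> carrier \<O>" "x = local_ideal n Z +>\<^bsub>\<O>\<^esub> a"
    using assms unfolding function_field_def FactRing_def A_RCOSETS_def' by auto
  thus ?thesis using that by (metis local_ringE ratio_def)
qed

lemma ratio_add:
  assumes "G \<in> forms n d" "H \<in> forms n d" "\<not> vanishes_on H Z" "G' \<in> forms n e" "H' \<in> forms n e" "\<not> vanishes_on H' Z"
  shows "ratio n Z G H \<oplus>\<^bsub>\<K>\<^esub> ratio n Z G' H' = ratio n Z (G * H' + G' * H) (H * H')"
proof -
  have "H \<noteq> 0" "H' \<noteq> 0" using assms by auto
  hence "Fract (G * H' + G' * H) (H * H') = Fract G H + Fract G' H'" by simp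
  thus ?thesis unfolding ratio_def
    using ring_hom_memE(3)[OF function_field_coset_hom local_ringI[OF assms(1-3)] local_ringI[OF assms(4-6)]] by simp
qed

lemma ratio_mult:
  assumes "G \<in> forms n d" "H \<in> forms n d" "\<not> vanishes_on H Z" "G' \<in> forms n e" "H' \<in> forms n e" "\<not> vanishes_on H' Z"
  shows "ratio n Z G H \<otimes>\<^bsub>\<K>\<^esub> ratio n Z G' H' = ratio n Z (G * G') (H * H')"
proof -
  have "H \<noteq> 0" "H' \<noteq> 0" using assms by auto
  hence "Fract (G * G') (H * H') = Fract G H * Fract G' H'" by simp
  thus ?thesis unfolding ratio_def
    using ring_hom_memE(2)[OF function_field_coset_hom local_ringI[OF assms(1-3)] local_ringI[OF assms(4-6)]] by simp
qed

lemma ratio_one: "ratio n Z 1 1 = \<one>\<^bsub>\<K>\<^esub>"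
  using ring_hom_memE(4)[OF function_field_coset_hom] by (simp add: ratio_def One_fract_def)

lemma ratio_eq_iff:
  assumes "G \<in> forms n d" "H \<in> forms n d" "\<not> vanishes_on H Z" "G' \<in> forms n e" "H' \<in> forms n e" "\<not> vanishes_on H' Z"
  shows "ratio n Z G H = ratio n Z G' H' \<longleftrightarrow> vanishes_on (G * H' - G' * H) Z"
proof -
  interpret cring \<O> by (rule local_ring_cring)
  note c = local_ringI[OF assms(1-3)] local_ringI[OF assms(4-6)]
  have nz: "H \<noteq> 0" "H' \<noteq> 0" using assms by auto
  have "ratio n Z G H = ratio n Z G' H' \<longleftrightarrow> Fract G H \<ominus>\<^bsub>\<O>\<^esub> Fract G' H' \<in> local_ideal n Z"
    unfolding ratio_def using quotient_eq_iff_same_a_r_cos[OF local_ideal_ideal c] by blast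
  also have "Fract G H \<ominus>\<^bsub>\<O>\<^esub> Fract G' H' = Fract (G * H' - G' * H) (H * H')"
    using nz by (simp add: a_minus_def local_ring_a_inv[OF c(2)])
  also have "\<dots> \<in> local_ideal n Z \<longleftrightarrow> vanishes_on (G * H' - G' * H) Z"
  proof (rule Fract_in_local_ideal_iff)
    show "G * H' - G' * H \<in> forms n (d + e)"
      using forms_add[OF forms_mult[OF assms(1,5)] forms_uminus[OF forms_mult[OF assms(2,4)]]]
      by (simp add: mult.commute)
    show "H * H' \<in> forms n (d + e)" using assms by (intro forms_mult)
    show "\<not> vanishes_on (H * H') Z" using vanishes_on_mult_iff[OF Z assms(2,5)] assms by blast
  qed
  finally show ?thesis .
qed

lemma ratio_eq_0_iff:
  assumes "G \<in> forms n d" "H \<in> forms n d" "\<not> vanishes_on H Z"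
  shows "ratio n Z G H = \<zero>\<^bsub>\<K>\<^esub> \<longleftrightarrow> vanishes_on G Z"
proof -
  interpret R: field \<K> by (rule function_field_field)
  interpret cring \<O> by (rule local_ring_cring)
  have "ratio n Z 0 1 = \<zero>\<^bsub>\<K>\<^esub>"
    using ring_hom_zero[OF function_field_coset_hom ring_axioms R.ring_axioms]
    by (simp add: ratio_def fract_collapse)
  thus ?thesis using ratio_eq_iff[OF assms forms_0 forms_one one_not_vanishing] by simp
qed

end

section \<open>Relations in characteristic p\<close>
text \<open>
  The classical argument on Wronskians, in terms of relations between columns: if the first \<open>N\<close> functions admit no
  such relation, the relation for \<open>N + 1\<close> functions can be normalised to have last coefficient \<open>1\<close>. Differentiating it
  gives a relation between the first \<open>N\<close> functions with coefficients \<open>d (w l)\<close>, which must vanish.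
\<close>

lemma wronskian_dependence:
  fixes d :: "'f::field \<Rightarrow> 'f" and y :: "nat \<Rightarrow> 'f"
  assumes d: "derivation d"
    and "\<exists>l<N. c l \<noteq> 0" and "\<And>i. i < N \<Longrightarrow> (\<Sum>l<N. c l * (d ^^ i) (y l)) = 0"
  shows "\<exists>w. (\<exists>l<N. w l \<noteq> 0) \<and> (\<forall>l<N. d (w l) = 0) \<and> (\<Sum>l<N. w l * y l) = 0"
  using assms(2,3)
proof (induction N arbitrary: c)
  case 0
  thus ?case by simp
next
  case (Suc N)
  interpret derivation d by (rule d)
  show ?case
  proof (cases "\<exists>c. (\<exists>l<N. c l \<noteq> 0) \<and> (\<forall>i<N. (\<Sum>l<N. c l * (d ^^ i) (y l)) = 0)")
    case True
    then obtain c' where c': "\<exists>l<N. c' l \<noteq> 0" "\<And>i. i < N \<Longrightarrow> (\<Sum>l<N. c' l * (d ^^ i) (y l)) = 0" by blast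
    obtain w where w: "\<exists>l<N. w l \<noteq> 0" "\<forall>l<N. d (w l) = 0" "(\<Sum>l<N. w l * y l) = 0"
      using Suc.IH[OF c'] by blast
    show ?thesis
      by (rule exI[of _ "w(N := 0)"]) (use w in \<open>auto simp: less_Suc_eq intro: exI\<close>)
  next
    case False
    have "c N \<noteq> 0"
    proof
      assume "c N = 0"
      hence "\<exists>l<N. c l \<noteq> 0" using Suc.prems(1) less_Suc_eq by auto
      moreover have "\<forall>i<N. (\<Sum>l<N. c l * (d ^^ i) (y l)) = 0"
        using Suc.prems(2) \<open>c N = 0\<close> by (metis (no_types, lifting) add_0_right less_SucI lessThan_Suc mult_zero_left sum.lessThan_Suc)
      ultimately show False using False by blast
    qed
    define w where "w l = c l / c N" for l
    have wN: "w N = 1" using \<open>c N \<noteq> 0\<close> by (simp add: w_def)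
    have rel: "(\<Sum>l<Suc N. w l * (d ^^ i) (y l)) = 0" if "i < Suc N" for i
    proof -
      have "(\<Sum>l<Suc N. w l * (d ^^ i) (y l)) = (\<Sum>l<Suc N. c l * (d ^^ i) (y l)) / c N"
        unfolding w_def sum_divide_distrib by (simp add: field_simps)
      thus ?thesis using Suc.prems(2)[OF that] by simp
    qed
    have "(\<Sum>l<N. d (w l) * (d ^^ i) (y l)) = 0" if i: "i < N" for i
    proof -
      have "0 = d (\<Sum>l<Suc N. w l * (d ^^ i) (y l))" using rel[of i] i by simp
      also have "\<dots> = (\<Sum>l<Suc N. w l * (d ^^ Suc i) (y l)) + (\<Sum>l<Suc N. d (w l) * (d ^^ i) (y l))"
        unfolding sum mult by (simp only: sum.distrib funpow.simps o_apply)
      also have "(\<Sum>l<Suc N. w l * (d ^^ Suc i) (y l)) = 0" using rel[of "Suc i"] i by (simp only: Suc_less_eq)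
      also have "(\<Sum>l<Suc N. d (w l) * (d ^^ i) (y l)) = (\<Sum>l<N. d (w l) * (d ^^ i) (y l))"
        by (simp add: wN)
      finally show ?thesis by simp
    qed
    moreover have "\<not> ((\<exists>l<N. c l \<noteq> 0) \<and> (\<forall>i<N. (\<Sum>l<N. c l * (d ^^ i) (y l)) = 0))" for c
      using False by blast
    from this[of "\<lambda>l. d (w l)"] have "(\<forall>i<N. (\<Sum>l<N. d (w l) * (d ^^ i) (y l)) = 0) \<Longrightarrow> \<forall>l<N. d (w l) = 0"
      by auto
    ultimately have "\<forall>l<N. d (w l) = 0" by auto
    moreover have "(\<Sum>l<Suc N. w l * y l) = 0" using rel[of 0] by simp
    ultimately show ?thesis using wN by (intro exI[of _ w]) (auto simp: less_Suc_eq)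
  qed
qed

definition deg_le :: "nat \<Rightarrow> 'a::zero mpoly \<Rightarrow> bool" where
  "deg_le N F \<longleftrightarrow> (\<forall>m\<in>keys F. tdeg m \<le> N)"

lemma deg_le_mderiv: "deg_le N F \<Longrightarrow> deg_le (N - 1) (mderiv i F)" for F :: "'a::comm_semiring_1 mpoly"
  using keys_mderiv[of i F] tdeg_diff_single[of _ i] by (fastforce simp: deg_le_def)

lemma deg_le_ex: "\<exists>N. deg_le N F"
  by (intro exI[of _ "Max (insert 0 (tdeg ` keys F))"]) (auto simp: deg_le_def)

lemma deg_le_0: "deg_le 0 F \<Longrightarrow> \<exists>c. F = mconst c"
proof -
  assume "deg_le 0 F"
  hence "tdeg m = 0" if "m \<in> keys F" for m using that by (auto simp: deg_le_def)
  hence "m = 0" if "m \<in> keys F" for m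
    using that by (auto simp: tdeg_def in_keys_iff intro!: poly_mapping_eqI)
  hence "F \<in> polys_in {}" by (auto simp: polys_in_def)
  thus ?thesis by (simp add: polys_in_empty)
qed

lemma lookup_mderiv:
  "lookup (mderiv i F) m
   = of_nat (Suc (lookup m i)) * lookup F (m + single i 1)"
proof -
  have eq: "k - single i 1 = m \<longleftrightarrow> k = m + single i 1" if "lookup k i > 0" for k
  proof
    assume "k - single i 1 = m"
    thus "k = m + single i 1"
      using that by (auto intro!: poly_mapping_eqI simp: lookup_add lookup_minus lookup_single when_def)
  qed simp
  have "lookup (mderiv i F) m = (\<Sum>k\<in>keys F. if k = m + single i 1
      then of_nat (lookup k i) * lookup F k else 0)"
    unfolding mderiv_def lookup_sum
  proof (rule sum.cong[OF refl])
    fix k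
    show "lookup (single (k - single i 1)
        (of_nat (lookup k i) * lookup F k)) m
      = (if k = m + single i 1 then of_nat (lookup k i) * lookup F k else 0)"
      using eq[of k] by (cases "lookup k i > 0") (auto simp: lookup_single when_def)
  qed
  thus ?thesis by (simp add: in_keys_iff lookup_add)
qed

lemma mderiv_eq_0_exponents:
  fixes F :: "'a::field mpoly"
  assumes "mderiv i F = 0" and m: "m \<in> keys F" shows "CHAR('a) dvd lookup m i"
proof (cases "lookup m i = 0")
  case False
  let ?m = "m - single i 1"
  have "?m + single i 1 = m"
    using False by (intro poly_mapping_eqI) (auto simp: lookup_add lookup_minus lookup_single when_def)
  moreover have "Suc (lookup ?m i) = lookup m i"
    using False by (simp add: lookup_minus)
  ultimately have "of_nat (lookup m i) * lookup F m = 0"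
    using lookup_mderiv[of i F ?m] assms(1) by simp
  hence "of_nat (lookup m i) = (0 :: 'a)" using m by (simp add: in_keys_iff)
  thus ?thesis by (simp add: of_nat_eq_0_iff_char_dvd)
qed simp

definition root_exponent :: "nat \<Rightarrow> (nat \<Rightarrow>\<^sub>0 nat) \<Rightarrow> (nat \<Rightarrow>\<^sub>0 nat)" where
  "root_exponent p m = Poly_Mapping.map (\<lambda>k. k div p) m"

lemma lookup_root_exponent: "lookup (root_exponent p m) i = lookup m i div p"
  by (simp add: root_exponent_def Poly_Mapping.map.rep_eq when_def)

text \<open>
  Vanishing of all derivatives makes every exponent a multiple of \<open>p\<close>, and the coefficients are \<open>p\<close>-th powers because the
  ground field is perfect.
\<close>

lemma exists_pth_root_poly:
  fixes P :: "'a::field mpoly" and f :: "'a \<Rightarrow> 'b::field"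
  assumes f: "comm_ring_hom f" and p: "p = CHAR('a)" "prime p" and perf: "surj (\<lambda>x::'a. x ^ p)"
    and P: "P \<in> polys_in V" "P \<noteq> 0" "deg_le N P" and der: "\<And>i. i \<in> V \<Longrightarrow> mderiv i P = 0"
  shows "\<exists>Q. Q \<in> polys_in V \<and> Q \<noteq> 0 \<and> deg_le (N div p) Q \<and> peval f x P = peval f x Q ^ p"
proof -
  interpret f: comm_ring_hom f by (rule f)
  define rt where "rt = inv_into UNIV (\<lambda>x::'a. x ^ p)"
  have rt: "rt c ^ p = c" for c unfolding rt_def using surj_f_inv_f[OF perf] by simp
  have p0: "p > 0" using p by (simp add: prime_gt_0_nat)
  have CHARb: "CHAR('b) = p"
  proof (rule CHAR_eqI)
    have "f (of_nat p) = 0" by (simp add: p)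
    thus "of_nat p = (0 :: 'b)" by (simp add: f.hom_of_nat)
    fix k assume "of_nat k = (0 :: 'b)"
    hence "f (of_nat k) = 0" by (simp add: f.hom_of_nat)
    hence "of_nat k = (0 :: 'a)"
      by (metis f.hom_mult f.hom_one mult_zero_left right_inverse zero_neq_one)
    thus "p dvd k" by (simp add: p of_nat_eq_0_iff_char_dvd)
  qed
  let ?K = "keys P" and ?r = "root_exponent p"
  have dvd: "p dvd lookup m i" if "m \<in> ?K" for m i
  proof (cases "i \<in> V")
    case True thus ?thesis using mderiv_eq_0_exponents[OF der that] p by simp
  next
    case False
    hence "i \<notin> keys m" using P(1) that by (auto simp: polys_in_def)
    thus ?thesis by (simp add: in_keys_iff)
  qed
  have mult: "p * lookup (?r m) i = lookup m i" if "m \<in> ?K" for m i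
    using dvd[OF that, of i] by (simp add: lookup_root_exponent)
  have inj: "inj_on ?r ?K"
    by (rule inj_onI, rule poly_mapping_eqI) (metis mult)
  have keys_r: "keys (?r m) = keys m" if "m \<in> ?K" for m
  proof -
    have "lookup m i = 0 \<longleftrightarrow> lookup (?r m) i = 0" for i
      using mult[OF that, of i] p0 by (metis mult_is_0 less_irrefl)
    thus ?thesis by (auto simp: in_keys_iff)
  qed
  define Q where "Q = (\<Sum>m\<in>?K. single (?r m) (rt (lookup P m)))"
  have lookup_Q: "lookup Q (?r m) = rt (lookup P m)" if m: "m \<in> ?K" for m
  proof -
    have "lookup Q (?r m) = (\<Sum>k\<in>?K. if k = m then rt (lookup P k) else 0)"
      unfolding Q_def lookup_sum
      by (intro sum.cong refl) (use inj_onD[OF inj _ _ m] in \<open>auto simp: lookup_single when_def\<close>)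
    thus ?thesis using m by simp
  qed
  have keysQ: "keys Q \<subseteq> ?r ` ?K"
    unfolding Q_def by (rule order.trans[OF keys_sum]) auto
  have "Q \<in> polys_in V" using keysQ keys_r P(1) by (fastforce simp: polys_in_def)
  moreover have "Q \<noteq> 0"
  proof
    assume "Q = 0"
    obtain m where m: "m \<in> ?K" using P(2) by (metis poly_mapping_eqI lookup_zero in_keys_iff)
    hence "rt (lookup P m) = 0" using lookup_Q[OF m] \<open>Q = 0\<close> by simp
    hence "lookup P m = 0" using rt[of "lookup P m"] p0 by (metis zero_power)
    thus False using m by (simp add: in_keys_iff)
  qed
  moreover have "deg_le (N div p) Q"
  proof -
    have "p * tdeg (?r m) = tdeg m" if "m \<in> ?K" for m
      unfolding tdeg_def keys_r[OF that] sum_distrib_left mult[OF that] ..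
    hence "tdeg (?r m) \<le> N div p" if "m \<in> ?K" for m
      using that P(3) p0 by (metis deg_le_def div_le_mono nonzero_mult_div_cancel_left not_gr_zero)
    thus ?thesis using keysQ by (auto simp: deg_le_def)
  qed
  moreover have "peval f x P = peval f x Q ^ p"
  proof -
    have "peval f x Q ^ p = (\<Sum>m\<in>?K. (f (rt (lookup P m)) * mono_eval x (?r m)) ^ p)"
      unfolding Q_def peval_sum[OF f] peval_single[OF f]
      by (rule freshmans_dream_sum) (use p CHARb in auto)
    also have "\<dots> = (\<Sum>m\<in>?K. f (lookup P m) * mono_eval x m)"
    proof (rule sum.cong[OF refl])
      fix m assume m: "m \<in> ?K"
      have "f (rt (lookup P m)) ^ p = f (lookup P m)"
        by (simp add: rt flip: f.hom_power)
      moreover have "mono_eval x (?r m) ^ p = mono_eval x m"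
        unfolding mono_eval_def keys_r[OF m] prod_power_distrib
      proof (rule prod.cong[OF refl])
        fix i
        have "lookup m i = lookup (?r m) i * p" using mult[OF m, of i] by (simp add: mult.commute)
        thus "(x i ^ lookup (?r m) i) ^ p = x i ^ lookup m i"
          by (simp only: power_mult)
      qed
      ultimately show "(f (rt (lookup P m)) * mono_eval x (?r m)) ^ p
          = f (lookup P m) * mono_eval x m" by (simp add: power_mult_distrib)
    qed
    finally show ?thesis by (simp add: peval_def)
  qed
  ultimately show ?thesis by blast
qed

text \<open>
  Take a relation of least total degree. Its partial derivatives have smaller degree, so they are zero as polynomials
  if they vanish at \<open>x\<close>. If all of them did, the relation would be a \<open>p\<close>-th power, and the root would be a relation of
  smaller degree.
\<close>

lemma exists_separable_relation:
  fixes P :: "'a::field mpoly" and f :: "'a \<Rightarrow> 'b::field"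
  assumes f: "comm_ring_hom f" and p: "p = CHAR('a)" "prime p" and perf: "surj (\<lambda>x::'a. x ^ p)"
    and P: "P \<in> polys_in V" "P \<noteq> 0" "peval f x P = 0"
  shows "\<exists>P\<in>polys_in V. peval f x P = 0 \<and> (\<exists>i\<in>V. peval f x (mderiv i P) \<noteq> 0) \<and>
           (\<forall>i\<in>V. peval f x (mderiv i P) = 0 \<longrightarrow> mderiv i P = 0)"
proof -
  interpret f: comm_ring_hom f by (rule f)
  let ?A = "\<lambda>N. \<exists>P. P \<in> polys_in V \<and> P \<noteq> 0 \<and> peval f x P = 0 \<and> deg_le N P"
  define N where "N = (LEAST N. ?A N)"
  have "\<exists>N. ?A N" using P deg_le_ex[of P] by blast
  hence "?A N" unfolding N_def by (rule LeastI_ex)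
  then obtain P where P: "P \<in> polys_in V" "P \<noteq> 0" "peval f x P = 0" "deg_le N P" by blast
  have least: "\<not> ?A k" if "k < N" for k using not_less_Least[OF that[unfolded N_def]] .
  have N0: "N > 0"
  proof (rule Nat.gr0I)
    assume "N = 0"
    then obtain c where c: "P = mconst c" using deg_le_0 P(4) by blast
    hence "f c = 0" "c \<noteq> 0" using P by (auto simp: f)
    thus False by (metis f.hom_mult f.hom_one mult_zero_left right_inverse zero_neq_one)
  qed
  have small: "mderiv i P = 0" if "peval f x (mderiv i P) = 0" for i
    using least[of "N - 1"] N0 that deg_le_mderiv[OF P(4)] mderiv_in_polys_in[OF P(1), of i] by auto
  have "\<exists>i\<in>V. peval f x (mderiv i P) \<noteq> 0"
  proof (rule ccontr)
    assume "\<not> ?thesis"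
    hence "\<And>i. i \<in> V \<Longrightarrow> mderiv i P = 0" using small by blast
    then obtain Q where Q: "Q \<in> polys_in V" "Q \<noteq> 0" "deg_le (N div p) Q" "peval f x P = peval f x Q ^ p"
      using exists_pth_root_poly[OF f p perf P(1,2,4)] by blast
    have "peval f x Q = 0" using Q(4) P(3) by simp
    moreover have "N div p < N" using N0 p(2) prime_gt_1_nat by simp
    ultimately show False using least Q by blast
  qed
  thus ?thesis using P small by blast
qed

lemma exists_separable_relation_second:
  fixes f :: "'a::field \<Rightarrow> 'b::field"
  assumes f: "comm_ring_hom f" and p: "p = CHAR('a)" "prime p" and perf: "surj (\<lambda>x::'a. x ^ p)"
    and d: "derivation d" "\<And>c. d (f c) = 0" "d (x 0) \<noteq> 0"
    and P: "P \<in> polys_in {0, 1}" "P \<noteq> 0" "peval f x P = 0"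
  shows "\<exists>P\<in>polys_in {0, 1}. peval f x P = 0 \<and> peval f x (mderiv 1 P) \<noteq> 0"
proof -
  interpret derivation d by (rule d)
  obtain P where P: "P \<in> polys_in {0, 1}" "peval f x P = 0"
    "peval f x (mderiv 0 P) \<noteq> 0 \<or> peval f x (mderiv 1 P) \<noteq> 0"
    using exists_separable_relation[OF f p perf P] by auto
  have "0 = peval f x (mderiv 0 P) * d (x 0) + peval f x (mderiv 1 P) * d (x 1)"
    using chain_rule[OF _ P(1) f d(2), of x] P(2) by simp
  thus ?thesis using P d(3) by (intro bexI[of _ P]) auto
qed

definition subfield_set :: "'b::field set \<Rightarrow> bool" where
  "subfield_set A \<longleftrightarrow> 1 \<in> A \<and> (\<forall>a\<in>A. \<forall>b\<in>A. a + b \<in> A \<and> a * b \<in> A) \<and> (\<forall>a\<in>A. - a \<in> A \<and> inverse a \<in> A)"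

text \<open>
  Division with remainder inside the polynomials with coefficients in the subfield \<open>A\<close>.
\<close>

lemma minimal_dvd:
  fixes g :: "'b::field poly"
  assumes A: "subfield_set A" and g: "\<And>i. Polynomial.coeff g i \<in> A" "g \<noteq> 0" "poly g w = 0"
    and least: "\<And>h. (\<And>i. Polynomial.coeff h i \<in> A) \<Longrightarrow> poly h w = 0 \<Longrightarrow> h \<noteq> 0 \<Longrightarrow> Polynomial.degree g \<le> Polynomial.degree h"
    and h: "\<And>i. Polynomial.coeff h i \<in> A" "poly h w = 0"
  shows "g dvd h"
proof -
  have A': "a + b \<in> A" "a * b \<in> A" "- a \<in> A" "inverse a \<in> A" if "a \<in> A" "b \<in> A" for a b
    using A that unfolding subfield_set_def by auto
  have A'': "a - b \<in> A" if "a \<in> A" "b \<in> A" for a b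
    using A'(1)[OF that(1) A'(3)[OF that(2,2)]] by simp
  have A0: "0 \<in> A" using A''[OF g(1) g(1), of 0 0] by simp
  show ?thesis
    using h
  proof (induction "Polynomial.degree h" arbitrary: h rule: less_induct)
    case less
    show ?case
    proof (cases "h = 0")
      case False
      define k where "k = Polynomial.degree h - Polynomial.degree g"
      define a where "a = Polynomial.lead_coeff h / Polynomial.lead_coeff g"
      have deg: "Polynomial.degree h = k + Polynomial.degree g"
        using least[OF less.prems False] by (simp add: k_def)
      have a: "a \<in> A" "a \<noteq> 0" using less.prems g False by (auto simp: a_def divide_inverse intro: A')
      define h' where "h' = h - Polynomial.monom a k * g"
      have h': "Polynomial.coeff h' i \<in> A" "poly h' w = 0" for i
        using less.prems g a(1) A0 by (auto simp: h'_def coeff_monom_mult intro: A' A'')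
      have "Polynomial.coeff h' (Polynomial.degree h) = 0"
        using g(2) by (simp add: h'_def coeff_monom_mult deg a_def)
      moreover have "Polynomial.degree h' \<le> Polynomial.degree h"
        unfolding h'_def using a g by (intro degree_diff_le) (auto simp: degree_mult_eq degree_monom_eq deg)
      ultimately have "h' = 0 \<or> Polynomial.degree h' < Polynomial.degree h"
        by (metis leading_coeff_0_iff le_neq_implies_less)
      hence "g dvd h'" using less.hyps h' by auto
      hence "g dvd h' + Polynomial.monom a k * g" by (intro dvd_add) auto
      thus ?thesis by (simp add: h'_def)
    qed simp
  qed
qed

text \<open>
  The minimal polynomial of \<open>w\<close> over \<open>A\<close> divides \<open>T\<^sup>p - w\<^sup>p = (T - w)\<^sup>p\<close>, so it is a power of \<open>T - w\<close>; it divides \<open>q\<close>, of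
  which \<open>w\<close> is a simple root, so it is \<open>T - w\<close> itself.
\<close>

lemma in_subfield_if_separable_and_power:
  fixes w :: "'b::field"
  assumes A: "subfield_set A" and q: "\<And>i. Polynomial.coeff q i \<in> A" "poly q w = 0" "poly (pderiv q) w \<noteq> 0"
    and p: "CHAR('b) = p" "prime p" "w ^ p \<in> A"
  shows "w \<in> A"
proof -
  have A0: "0 \<in> A" using A by (metis subfield_set_def add.right_inverse)
  have A': "a + b \<in> A" "a * b \<in> A" "- a \<in> A" "inverse a \<in> A" if "a \<in> A" "b \<in> A" for a b
    using A that unfolding subfield_set_def by auto
  have A'': "a - b \<in> A" if "a \<in> A" "b \<in> A" for a b
    using A'(1)[OF that(1) A'(3)[OF that(2,2)]] by simp
  let ?I = "\<lambda>g. (\<forall>i. Polynomial.coeff g i \<in> A) \<and> poly g w = 0"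
  have "q \<noteq> 0" using q(3) by auto
  define g where "g = arg_min Polynomial.degree (\<lambda>g. ?I g \<and> g \<noteq> 0)"
  have g: "?I g" "g \<noteq> 0" and least: "\<And>h. ?I h \<Longrightarrow> h \<noteq> 0 \<Longrightarrow> Polynomial.degree g \<le> Polynomial.degree h"
    using arg_min_nat_lemma[of "\<lambda>g. ?I g \<and> g \<noteq> 0" q Polynomial.degree] q \<open>q \<noteq> 0\<close> unfolding g_def by auto
  have dvd: "g dvd h" if "?I h" for h
    by (rule minimal_dvd[OF A]) (use g least that in blast)+
  define l where "l = [:- w, 1:]"
  have lp: "l ^ p = Polynomial.monom 1 p - [:w ^ p:]"
  proof -
    have "l ^ p = (Polynomial.monom 1 1 + [:- w:]) ^ p" by (simp add: l_def monom_altdef)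
    also have "\<dots> = Polynomial.monom 1 1 ^ p + [:- w:] ^ p"
      by (rule freshmans_dream) (use p in \<open>auto\<close>)
    also have "Polynomial.monom 1 1 ^ p = (Polynomial.monom 1 p :: 'b poly)"
      by (simp only: monom_power power_one mult_1_left)
    also have "[:- w:] ^ p = [:(- w) ^ p:]" by (rule poly_const_pow)
    also have "(- w) ^ p = - (w ^ p)" using p minus_power_prime_CHAR[where x = w and p = p] by simp
    finally show ?thesis by (simp only: minus_pCons minus_zero flip: diff_conv_add_uminus) simp
  qed
  have "?I (l ^ p)"
  proof (intro conjI allI)
    show "Polynomial.coeff (l ^ p) i \<in> A" for i
      unfolding lp using p(3) A A0 by (auto simp: coeff_pCons subfield_set_def split: nat.split intro: A' A'')
    show "poly (l ^ p) w = 0" using p(2) by (simp add: l_def prime_gt_0_nat)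
  qed
  hence "g dvd l ^ p" by (rule dvd)
  then obtain u where u: "l ^ p = g * u" by (rule dvdE)
  have lp0: "l ^ p \<noteq> 0" by (simp add: l_def)
  have u0: "u \<noteq> 0" using u lp0 by auto
  have "order w (l ^ p) = p" unfolding l_def by (simp add: order_power_n_n)
  moreover have "order w (g * u) = order w g + order w u"
    by (rule order_mult) (use g(2) u0 in simp)
  ultimately have "order w g + order w u = p" by (simp only: u)
  moreover have "Polynomial.degree g + Polynomial.degree u = p"
    using degree_mult_eq[OF g(2) u0] u by (simp add: l_def degree_linear_power flip: u)
  ultimately have "order w g = Polynomial.degree g"
    using order_degree[OF g(2), of w] order_degree[OF u0, of w] by linarith
  moreover have "\<not> order w g \<ge> 2"
  proof
    assume "order w g \<ge> 2"
    hence "l ^ 2 dvd g" using order_divides[of w 2 g] by (simp add: l_def)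
    hence "l ^ 2 dvd q" using dvd[of q] q by (meson dvd_trans)
    then obtain r where "q = l ^ 2 * r" by (rule dvdE)
    hence "q = l * (l * r)" by (simp only: power2_eq_square mult.assoc)
    moreover have "poly l w = 0" by (simp add: l_def)
    ultimately have "poly (pderiv q) w = 0" by (simp only: pderiv_mult poly_add poly_mult mult_zero_left mult_zero_right add_0)
    thus False using q(3) by simp
  qed
  moreover have "order w g \<noteq> 0" using g order_root by blast
  ultimately have "Polynomial.degree g = 1" by simp
  then obtain a b where ab: "g = [:b, a:]" "a \<noteq> 0"
    by (rule degree1_coeffs)
  have "b + w * a = 0" using g(1) by (simp add: ab)
  hence "w = - b * inverse a" using ab(2) by (simp add: field_simps eq_neg_iff_add_eq_0)
  moreover have "Polynomial.coeff g 0 \<in> A" "Polynomial.coeff g 1 \<in> A" using g(1) by auto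
  ultimately show ?thesis by (simp add: ab A')
qed

section \<open>Hasse derivatives and Wronskians\<close>
text \<open>
  The difference of the two sides is, if the formula holds for smaller \<open>m\<close>, a derivation: the mixed terms in the
  product rule cancel. It kills the constants and \<open>\<zeta>\<close>, hence everything.
\<close>

lemma hasse_composition:
  fixes D :: "nat \<Rightarrow> 'f::field \<Rightarrow> 'f"
  assumes D0: "\<And>x. D 0 x = x" and add: "\<And>k x y. D k (x + y) = D k x + D k y"
    and mult: "\<And>k x y. D k (x * y) = (\<Sum>i\<le>k. D i x * D (k - i) y)"
    and const: "\<And>k c. c \<in> C \<Longrightarrow> k \<ge> 1 \<Longrightarrow> D k c = 0"
    and \<zeta>: "D 1 \<zeta> = 1" "\<And>k. k \<ge> 2 \<Longrightarrow> D k \<zeta> = 0"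
    and rigid: "\<And>\<delta> x. derivation \<delta> \<Longrightarrow> (\<And>c. c \<in> C \<Longrightarrow> \<delta> c = 0) \<Longrightarrow> \<delta> \<zeta> = 0 \<Longrightarrow> \<delta> x = 0"
  shows "derivation (D 1)" and "of_nat (Suc m) * D (Suc m) x = D 1 (D m x)"
proof -
  show d1: "derivation (D 1)"
    by unfold_locales (simp_all add: add mult D0)
  interpret d: derivation "D 1" by (rule d1)
  define \<delta> where "\<delta> i x = of_nat (Suc i) * D (Suc i) x - D 1 (D i x)" for i x
  have "\<delta> m x = 0" for m x
  proof (induction m arbitrary: x rule: less_induct)
    case (less m)
    have leibniz: "\<delta> m (a * b) = a * \<delta> m b + \<delta> m a * b" for a b
    proof -
      have "of_nat (Suc m) * D (Suc m) (a * b)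
          = (\<Sum>i\<le>Suc m. of_nat i * D i a * D (Suc m - i) b) + (\<Sum>i\<le>Suc m. of_nat (Suc m - i) * D i a * D (Suc m - i) b)"
        unfolding mult sum_distrib_left sum.distrib[symmetric]
        by (intro sum.cong refl) (auto simp flip: distrib_right of_nat_add)
      also have "(\<Sum>i\<le>Suc m. of_nat i * D i a * D (Suc m - i) b) = (\<Sum>i\<le>m. of_nat (Suc i) * D (Suc i) a * D (m - i) b)"
        by (simp only: sum.atMost_Suc_shift of_nat_0 mult_zero_left add_0 diff_Suc_Suc)
      also have "(\<Sum>i\<le>Suc m. of_nat (Suc m - i) * D i a * D (Suc m - i) b)
          = (\<Sum>i\<le>m. D i a * (of_nat (Suc (m - i)) * D (Suc (m - i)) b))"
        by (simp add: Suc_diff_le mult_ac add_diff_eq)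
      finally have e1: "of_nat (Suc m) * D (Suc m) (a * b) = (\<Sum>i\<le>m. of_nat (Suc i) * D (Suc i) a * D (m - i) b)
          + (\<Sum>i\<le>m. D i a * (of_nat (Suc (m - i)) * D (Suc (m - i)) b))" .
      have e2: "D 1 (D m (a * b)) = (\<Sum>i\<le>m. D 1 (D i a) * D (m - i) b) + (\<Sum>i\<le>m. D i a * D 1 (D (m - i) b))"
        unfolding mult[of m] d.sum d.mult by (simp add: sum.distrib add.commute)
      have "\<delta> m (a * b) = (\<Sum>i\<le>m. \<delta> i a * D (m - i) b) + (\<Sum>i\<le>m. D i a * \<delta> (m - i) b)"
        unfolding \<delta>_def left_diff_distrib right_diff_distrib sum_subtractf e1 e2 by (simp only: algebra_simps)
      also have "(\<Sum>i\<le>m. \<delta> i a * D (m - i) b) = (\<Sum>i\<le>m. if i = m then \<delta> m a * b else 0)"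
        by (intro sum.cong refl) (use less in \<open>auto simp: D0\<close>)
      also have "(\<Sum>i\<le>m. D i a * \<delta> (m - i) b) = (\<Sum>i\<le>m. if i = 0 then a * \<delta> m b else 0)"
        by (intro sum.cong refl) (use less in \<open>auto simp: D0\<close>)
      finally show ?thesis by simp
    qed
    show ?case
    proof (rule rigid[of "\<delta> m"])
      show "derivation (\<delta> m)"
        by unfold_locales (simp_all only: leibniz, simp add: \<delta>_def add algebra_simps)
      show "\<delta> m c = 0" if "c \<in> C" for c
        using const[OF that, of "Suc m"] const[OF that, of m] const[OF that, of 1] D0
          d.zero[unfolded One_nat_def] by (cases m) (simp_all add: \<delta>_def)
      show "\<delta> m \<zeta> = 0"
      proof (cases m)
        case 0 thus ?thesis by (simp add: \<delta>_def D0)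
      next
        case (Suc k)
        have D: "D 1 (D (Suc k) \<zeta>) = 0"
        proof (cases k)
          case 0
          hence "D (Suc k) \<zeta> = 1" using \<zeta>(1) by simp
          thus ?thesis by (simp only: d.one)
        next
          case (Suc j)
          hence "D (Suc k) \<zeta> = 0" using \<zeta>(2)[of "Suc k"] by simp
          thus ?thesis by (simp only: d.zero)
        qed
        have "D (Suc (Suc k)) \<zeta> = 0" by (rule \<zeta>(2)) simp
        thus ?thesis using D by (simp only: \<delta>_def Suc mult_zero_right diff_self)
      qed
    qed
  qed
  thus "of_nat (Suc m) * D (Suc m) x = D 1 (D m x)" by (simp add: \<delta>_def)
qed

lemma fact_times_hasse:
  fixes D :: "nat \<Rightarrow> 'f::field \<Rightarrow> 'f"
  assumes "\<And>x. D 0 x = x" and "\<And>m x. of_nat (Suc m) * D (Suc m) x = D 1 (D m x)" and "derivation (D 1)"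
  shows "of_nat (fact k) * D k x = ((D 1) ^^ k) x"
proof (induction k)
  case (Suc k)
  interpret derivation "D 1" by fact
  have "(D 1 ^^ Suc k) x = D 1 (of_nat (fact k) * D k x)" using Suc by simp
  also have "\<dots> = of_nat (fact k) * (of_nat (Suc k) * D (Suc k) x)"
    by (simp only: mult assms(2) of_nat mult_zero_left add_0_right)
  finally show ?case by (simp add: algebra_simps)
qed (simp add: assms(1))

lemma of_nat_fact_neq_0:
  assumes "CHAR('f::field) = p" "prime p" "k < p" shows "of_nat (fact k) \<noteq> (0 :: 'f)"
  using assms by (auto simp: of_nat_eq_0_iff_char_dvd prime_dvd_fact_iff)

lemma det_eq_0_iff_relation:
  fixes M :: "nat \<Rightarrow> nat \<Rightarrow> 'f::field"
  shows "(\<Sum>\<pi>\<in>{\<pi>. \<pi> permutes {..n}}. of_int (sign \<pi>) * (\<Prod>i\<in>{..n}. M i (\<pi> i))) = 0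
    \<longleftrightarrow> (\<exists>c. (\<exists>l\<le>n. c l \<noteq> 0) \<and> (\<forall>i\<le>n. (\<Sum>l\<le>n. M i l * c l) = 0))"
proof -
  define A where "A = mat (Suc n) (Suc n) (\<lambda>(i, l). M i l)"
  have A: "A \<in> carrier_mat (Suc n) (Suc n)" by (simp add: A_def)
  have n: "{0..<Suc n} = {..n}" by auto
  have "det A = (\<Sum>\<pi>\<in>{\<pi>. \<pi> permutes {..n}}. of_int (sign \<pi>) * (\<Prod>i\<in>{..n}. M i (\<pi> i)))"
    unfolding det_def'[OF A] n
  proof (intro sum.cong refl arg_cong2[of _ _ _ _ "(*)"] prod.cong)
    fix \<pi> i assume \<pi>: "\<pi> \<in> {\<pi>. \<pi> permutes {..n}}" "i \<in> {..n}"
    hence "\<pi> i \<in> {..n}" using permutes_in_image[of \<pi> "{..n}" i] by blast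
    thus "A $$ (i, \<pi> i) = M i (\<pi> i)" using \<pi> by (simp add: A_def)
  qed
  moreover have "det A = 0 \<longleftrightarrow> (\<exists>c. (\<exists>l\<le>n. c l \<noteq> 0) \<and> (\<forall>i\<le>n. (\<Sum>l\<le>n. M i l * c l) = 0))"
    unfolding det_0_iff_vec_prod_zero_field[OF A]
  proof safe
    fix v assume v: "v \<in> carrier_vec (Suc n)" "v \<noteq> 0\<^sub>v (Suc n)" "A *\<^sub>v v = 0\<^sub>v (Suc n)"
    have "\<exists>l\<le>n. vec_index v l \<noteq> 0"
    proof (rule ccontr)
      assume "\<not> ?thesis"
      hence "v = 0\<^sub>v (Suc n)" using v(1) by (intro eq_vecI) auto
      thus False using v(2) by simp
    qed
    moreover have "(\<Sum>l\<le>n. M i l * vec_index v l) = 0" if "i \<le> n" for i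
    proof -
      have "vec_index (A *\<^sub>v v) i = (\<Sum>l\<le>n. M i l * vec_index v l)"
        using that v(1) by (auto simp: A_def scalar_prod_def n)
      thus ?thesis using v(3) that by simp
    qed
    ultimately show "\<exists>c. (\<exists>l\<le>n. c l \<noteq> 0) \<and> (\<forall>i\<le>n. (\<Sum>l\<le>n. M i l * c l) = 0)"
      by (intro exI[of _ "vec_index v"]) simp
  next
    fix c l assume c: "\<forall>i\<le>n. (\<Sum>l\<le>n. M i l * c l) = 0" "l \<le> n" "c l \<noteq> 0"
    let ?v = "vec (Suc n) c"
    have "?v \<noteq> 0\<^sub>v (Suc n)"
    proof
      assume "?v = 0\<^sub>v (Suc n)"
      hence "vec_index ?v l = vec_index (0\<^sub>v (Suc n)) l" by (simp only:)
      thus False using c(2,3) by simp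
    qed
    moreover have "A *\<^sub>v ?v = 0\<^sub>v (Suc n)"
      using c(1) by (intro eq_vecI) (auto simp: A_def scalar_prod_def n)
    ultimately show "\<exists>v. v \<in> carrier_vec (Suc n) \<and> v \<noteq> 0\<^sub>v (Suc n) \<and> A *\<^sub>v v = 0\<^sub>v (Suc n)"
      by (intro exI[of _ ?v]) simp
  qed
  ultimately show ?thesis by simp
qed

lemma derivation_poly_const_coeffs:
  fixes d :: "'f::field \<Rightarrow> 'f"
  assumes "derivation d" and "\<And>i. d (Polynomial.coeff q i) = 0" shows "d (poly q x) = poly (pderiv q) x * d x"
  using assms(2)
proof (induction q)
  case 0
  interpret derivation d by fact
  show ?case by simp
next
  case (pCons a q)
  interpret derivation d by fact
  have "d a = 0" using pCons.prems[of 0] by simp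
  moreover have "d (Polynomial.coeff q i) = 0" for i using pCons.prems[of "Suc i"] by simp
  ultimately show ?case using pCons.IH by (simp add: add mult pderiv_pCons algebra_simps)
qed

lemma derivation_inverse:
  fixes d :: "'f::field \<Rightarrow> 'f"
  assumes "derivation d" "d a = 0" shows "d (inverse a) = 0"
proof (cases "a = 0")
  case False
  interpret derivation d by fact
  have "0 = d (a * inverse a)" using False by simp
  thus ?thesis using False assms(2) by (simp only: mult) simp
next
  case True thus ?thesis using assms(2) by simp
qed

lemma subfield_set_constants:
  fixes d :: "'f::field \<Rightarrow> 'f"
  assumes "derivation d" shows "subfield_set {a. d a = 0}"
proof -
  interpret derivation d by fact
  show ?thesis by (simp add: subfield_set_def add mult uminus derivation_inverse[OF assms])
qed

section \<open>Function fields as field types\<close>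
lemma forms_var_power: "i \<le> n \<Longrightarrow> (mvar i :: 'a::comm_ring_1 mpoly) ^ k \<in> forms n k"
  using forms_power[OF forms_var, of i n k] by simp

text \<open>
  A field type identified with the function field. Univariate polynomials, determinants and field arithmetic are
  used on this type, and results are carried back along \<open>h\<close>.
\<close>

locale function_field_model =
  fixes n :: nat and Z :: "(nat \<Rightarrow> 'k::field alg_closure) set set"
    and h :: "'f::field \<Rightarrow> 'k mpoly fract set"
  assumes Z: "variety n Z"
    and bij: "bij_betw h UNIV (carrier (function_field n Z))"
    and h_add: "h (a + b) = h a \<oplus>\<^bsub>function_field n Z\<^esub> h b"
    and h_mult: "h (a * b) = h a \<otimes>\<^bsub>function_field n Z\<^esub> h b"
    and h_one: "h 1 = \<one>\<^bsub>function_field n Z\<^esub>"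
begin

abbreviation (input) "R \<equiv> function_field n Z"

sublocale R: field "function_field n Z"
  by (rule function_field_field[OF Z])

definition g :: "'k mpoly fract set \<Rightarrow> 'f" where "g = inv_into UNIV h"

lemma inj_h: "h a = h b \<longleftrightarrow> a = b"
  using bij by (auto simp: bij_betw_def inj_on_def)

lemma h_closed [simp]: "h a \<in> carrier R"
  using bij by (auto simp: bij_betw_def)

lemma h_g [simp]: "x \<in> carrier R \<Longrightarrow> h (g x) = x"
  using bij unfolding g_def bij_betw_def by (metis f_inv_into_f)

lemma g_h [simp]: "g (h a) = a"
  using bij by (auto simp: g_def bij_betw_def)

lemma h_zero: "h 0 = \<zero>\<^bsub>R\<^esub>"
  using h_add[of 0 0] R.add.l_cancel_one'[of "h 0" "h 0"] by simp

lemma h_uminus: "h (- a) = \<ominus>\<^bsub>R\<^esub> h a"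
  using h_add[of "- a" a] by (intro R.minus_equality[symmetric]) (simp_all add: h_zero)

lemma h_eq_zero: "h a = \<zero>\<^bsub>R\<^esub> \<longleftrightarrow> a = 0"
  using inj_h[of a 0] by (simp add: h_zero)

lemma h_inverse: "a \<noteq> 0 \<Longrightarrow> h (inverse a) = inv\<^bsub>R\<^esub> h a"
  using h_mult[of a "inverse a"] by (intro R.comm_inv_char[symmetric]) (simp_all add: h_one)

lemma h_power: "h (a ^ k) = h a [^]\<^bsub>R\<^esub> k"
  by (induction k) (simp_all add: h_one h_mult R.m_comm)

lemma h_sum: "finite I \<Longrightarrow> h (sum f I) = (\<Oplus>\<^bsub>R\<^esub>i\<in>I. h (f i))"
  by (induction I rule: finite_induct) (simp_all add: h_zero h_add)

lemma h_prod: "finite I \<Longrightarrow> h (prod f I) = (\<Otimes>\<^bsub>R\<^esub>i\<in>I. h (f i))"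
  by (induction I rule: finite_induct) (simp_all add: h_one h_mult)

lemma h_add_pow_nat: "h (of_nat k * a) = add_pow R k (h a)"
  by (induction k) (simp_all add: h_zero h_add distrib_right R.add.nat_pow_Suc R.a_comm)

lemma h_add_pow_int: "h (of_int k * a) = add_pow R k (h a)"
proof (cases k)
  case (nonneg m)
  thus ?thesis using h_add_pow_nat[of m a] by (simp add: add_pow_int_ge)
next
  case (neg m)
  have "h (of_int k * a) = \<ominus>\<^bsub>R\<^esub> h (of_nat (Suc m) * a)"
    unfolding h_uminus[symmetric] by (simp add: neg algebra_simps)
  also have "\<dots> = \<ominus>\<^bsub>R\<^esub> add_pow R (Suc m) (h a)" by (simp only: h_add_pow_nat)
  also have "\<dots> = add_pow R k (h a)"
    using R.add.int_pow_neg_int[of "h a" "Suc m"] by (simp only: neg h_closed)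
  finally show ?thesis .
qed

definition rat :: "'k mpoly \<Rightarrow> 'k mpoly \<Rightarrow> 'f" where "rat G H = g (ratio n Z G H)"

lemma h_rat: "G \<in> forms n d \<Longrightarrow> H \<in> forms n d \<Longrightarrow> \<not> vanishes_on H Z \<Longrightarrow> h (rat G H) = ratio n Z G H"
  unfolding rat_def by (rule h_g[OF ratio_closed[OF Z]])

lemma rat_mult:
  assumes "G \<in> forms n d" "H \<in> forms n d" "\<not> vanishes_on H Z" "G' \<in> forms n e" "H' \<in> forms n e" "\<not> vanishes_on H' Z"
  shows "rat (G * G') (H * H') = rat G H * rat G' H'"
  using ratio_mult[OF Z assms] unfolding rat_def
  by (metis h_mult g_h h_g ratio_closed[OF Z assms(1-3)] ratio_closed[OF Z assms(4-6)])

lemma rat_eq_0_iff: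
  assumes "G \<in> forms n d" "H \<in> forms n d" "\<not> vanishes_on H Z"
  shows "rat G H = 0 \<longleftrightarrow> vanishes_on G Z"
  using ratio_eq_0_iff[OF Z assms] h_eq_zero[of "rat G H"] h_rat[OF assms] by simp

lemma rat_eq_iff:
  assumes "G \<in> forms n d" "H \<in> forms n d" "\<not> vanishes_on H Z" "G' \<in> forms n e" "H' \<in> forms n e" "\<not> vanishes_on H' Z"
  shows "rat G H = rat G' H' \<longleftrightarrow> vanishes_on (G * H' - G' * H) Z"
  using ratio_eq_iff[OF Z assms] h_rat[OF assms(1-3)] h_rat[OF assms(4-6)] inj_h by metis

lemma rat_self: assumes "H \<in> forms n d" "\<not> vanishes_on H Z" shows "rat H H = 1"
proof -
  have "rat H H = rat 1 1"
    using rat_eq_iff[OF assms(1) assms forms_one forms_one one_not_vanishing[OF Z]] by simp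
  thus ?thesis by (simp add: rat_def ratio_one[OF Z] flip: h_one)
qed

lemma rat_add:
  assumes "G \<in> forms n d" "H \<in> forms n d" "\<not> vanishes_on H Z" "G' \<in> forms n d"
  shows "rat (G + G') H = rat G H + rat G' H"
proof -
  have nv: "\<not> vanishes_on (H * H) Z" using vanishes_on_mult_iff[OF Z assms(2,2)] assms(3) by blast
  have f: "G * H + G' * H \<in> forms n (d + d)" by (intro forms_add forms_mult assms)
  have "h (rat G H + rat G' H) = ratio n Z (G * H + G' * H) (H * H)"
    using ratio_add[OF Z assms(1-3) assms(4,2,3)] h_rat[OF assms(1-3)] h_rat[OF assms(4,2,3)]
    by (simp add: h_add)
  also have "\<dots> = ratio n Z (G + G') H"
    using ratio_eq_iff[OF Z f forms_mult[OF assms(2,2)] nv forms_add[OF assms(1,4)] assms(2,3)]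
    by (simp add: algebra_simps)
  finally show ?thesis by (metis rat_def g_h)
qed

definition \<iota> :: "'k \<Rightarrow> 'f" where "\<iota> c = rat (mconst c) 1"

lemma \<iota>_hom: "comm_ring_hom \<iota>"
proof unfold_locales
  note nv = one_not_vanishing[OF Z]
  show "\<iota> (a + b) = \<iota> a + \<iota> b" for a b
    unfolding \<iota>_def mconst_add by (rule rat_add[OF forms_const forms_one nv forms_const])
  show "\<iota> (a * b) = \<iota> a * \<iota> b" for a b
    using rat_mult[OF forms_const forms_one nv forms_const forms_one nv, of a b]
    by (simp add: \<iota>_def mconst_mult)
  show "\<iota> 1 = 1" using rat_self[OF forms_one nv] by (simp add: \<iota>_def mconst_1)
  show "\<iota> 0 = 0" using rat_eq_0_iff[OF forms_0 forms_one nv] by (simp add: \<iota>_def)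
qed

sublocale \<iota>: comm_ring_hom \<iota> by (rule \<iota>_hom)

lemma \<iota>_eq_0: "\<iota> c = 0 \<longleftrightarrow> c = 0"
  using rat_eq_0_iff[OF forms_const forms_one one_not_vanishing[OF Z]] vanishes_on_const[OF Z]
  by (simp add: \<iota>_def)

lemma constants_eq: "constants n Z = h ` range \<iota>"
  unfolding constants_def \<iota>_def image_image
  by (simp add: h_rat[OF forms_const forms_one one_not_vanishing[OF Z]])

lemma CHAR_f: "CHAR('f) = CHAR('k)"
proof (rule CHAR_eqI)
  have "\<iota> (of_nat CHAR('k)) = 0" by simp
  thus "of_nat CHAR('k) = (0 :: 'f)" by (simp only: \<iota>.hom_of_nat)
  fix k assume "of_nat k = (0 :: 'f)"
  hence "\<iota> (of_nat k) = 0" by (simp only: \<iota>.hom_of_nat)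
  thus "CHAR('k) dvd k" by (simp add: \<iota>_eq_0 of_nat_eq_0_iff_char_dvd)
qed

text \<open>
  Evaluation at the affine coordinate functions \<open>X i / X j\<close>. On forms of degree \<open>d\<close> this is division by \<open>(X j)\<^sup>d\<close>.
\<close>

definition ev :: "nat \<Rightarrow> 'k mpoly \<Rightarrow> 'f" where
  "ev j = peval \<iota> (\<lambda>i. rat (mvar i) (mvar j))"

lemma ev_hom: "comm_ring_hom (ev j)"
  unfolding ev_def by (rule peval_hom[OF \<iota>_hom])

lemma rat_power:
  assumes "G \<in> forms n d" "H \<in> forms n d" "\<not> vanishes_on H Z"
  shows "rat (G ^ k) (H ^ k) = rat G H ^ k"
proof (induction k)
  case 0
  show ?case using rat_self[OF forms_one one_not_vanishing[OF Z]] by simp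
next
  case (Suc k)
  have "\<not> vanishes_on (H ^ k) Z" using vanishes_on_power_iff[OF Z assms(2)] assms(3) by blast
  thus ?case
    using rat_mult[OF assms forms_power[OF assms(1), of k] forms_power[OF assms(2), of k]] Suc by simp
qed

context
  fixes j assumes j: "j \<le> n" "\<not> vanishes_on (mvar j :: 'k mpoly) Z"
begin

lemma xj: "(mvar j :: 'k mpoly) ^ d \<in> forms n d" "\<not> vanishes_on ((mvar j :: 'k mpoly) ^ d) Z"
  using forms_power[OF forms_var[OF j(1)], of d] vanishes_on_power_iff[OF Z forms_var[OF j(1)], of d] j(2)
  by simp_all

lemma rat_prod:
  assumes "finite I" "I \<subseteq> {..n}"
  shows "rat (\<Prod>i\<in>I. mvar i ^ e i) (mvar j ^ sum e I) = (\<Prod>i\<in>I. rat (mvar i) (mvar j) ^ e i)"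
  using assms
proof (induction I rule: finite_induct)
  case empty
  show ?case using rat_self[OF forms_one one_not_vanishing[OF Z]] by simp
next
  case (insert i I)
  have f: "(mvar i :: 'k mpoly) ^ e i \<in> forms n (e i)"
    using insert.prems forms_power[OF forms_var, of i n "e i"] by simp
  have f': "(\<Prod>i\<in>I. (mvar i :: 'k mpoly) ^ e i) \<in> forms n (sum e I)"
    using insert.prems by (intro forms_prod forms_var_power) auto
  have "rat (mvar i ^ e i * (\<Prod>i\<in>I. mvar i ^ e i)) (mvar j ^ e i * mvar j ^ sum e I)
     = rat (mvar i ^ e i) (mvar j ^ e i) * rat (\<Prod>i\<in>I. mvar i ^ e i) (mvar j ^ sum e I)"
    by (rule rat_mult[OF f xj f' xj])
  also have "rat (mvar i ^ e i) (mvar j ^ e i) = rat (mvar i) (mvar j) ^ e i"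
    by (rule rat_power[OF forms_var forms_var[OF j(1)] j(2)]) (use insert.prems in simp)
  finally show ?case using insert by (simp add: power_add)
qed

lemma rat_form:
  assumes "G \<in> forms n d" shows "rat G (mvar j ^ d) = ev j G"
proof -
  let ?s = "\<lambda>m. single m (lookup G m)"
  have sf: "?s m \<in> forms n d" if "m \<in> keys G" for m
    using assms that by (auto simp: forms_eq polys_in_def)
  have zero: "rat 0 (mvar j ^ d) = 0" using rat_eq_0_iff[OF forms_0 xj] by simp
  have single: "rat (?s m) (mvar j ^ d) = \<iota> (lookup G m) * mono_eval (\<lambda>i. rat (mvar i) (mvar j)) m"
    if m: "m \<in> keys G" for m
  proof -
    have d: "tdeg m = d" and sub: "keys m \<subseteq> {..n}" using m assms by (auto simp: forms_eq polys_in_def)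
    have f: "(\<Prod>i\<in>keys m. mvar i ^ lookup m i) \<in> (forms n d :: 'k mpoly set)"
      unfolding d[symmetric] tdeg_def
      using sub by (intro forms_prod forms_var_power) auto
    have "rat (?s m) (mvar j ^ d) = rat (mconst (lookup G m) *
        (\<Prod>i\<in>keys m. mvar i ^ lookup m i)) (1 * mvar j ^ d)"
      by (simp add: single_eq_monomial)
    also have "\<dots> = \<iota> (lookup G m) * rat (\<Prod>i\<in>keys m. mvar i ^ lookup m i) (mvar j ^ d)"
      unfolding \<iota>_def by (rule rat_mult[OF forms_const forms_one one_not_vanishing[OF Z] f xj])
    finally show ?thesis using rat_prod[of "keys m" "lookup m"] sub
      by (simp add: mono_eval_def tdeg_def flip: d)
  qed
  have "rat (sum ?s I) (mvar j ^ d) = (\<Sum>m\<in>I. \<iota> (lookup G m) * mono_eval (\<lambda>i. rat (mvar i) (mvar j)) m)"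
    if "finite I" "I \<subseteq> keys G" for I
    using that
  proof (induction I rule: finite_induct)
    case (insert m I)
    have "rat (?s m + sum ?s I) (mvar j ^ d) = rat (?s m) (mvar j ^ d) + rat (sum ?s I) (mvar j ^ d)"
      by (rule rat_add[OF _ xj]) (use insert.prems sf in \<open>auto intro: forms_sum\<close>)
    thus ?case using insert single by simp
  qed (simp add: zero)
  from this[of "keys G"] show ?thesis
    by (simp add: poly_mapping_sum_single ev_def peval_def)
qed

lemma ev_eq_0_iff: "G \<in> forms n d \<Longrightarrow> ev j G = 0 \<longleftrightarrow> vanishes_on G Z"
  using rat_form[of G d] rat_eq_0_iff[OF _ xj, of G d] by simp

lemma rat_eq_ev:
  assumes "G \<in> forms n d" "H \<in> forms n d" "\<not> vanishes_on H Z" shows "rat G H = ev j G / ev j H"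
proof -
  have "\<not> vanishes_on (H * mvar j ^ d) Z" using vanishes_on_mult_iff[OF Z assms(2) xj(1)] assms(3) xj(2) by blast
  have "rat G H * rat H (mvar j ^ d) = rat (G * H) (H * mvar j ^ d)"
    using rat_mult[OF assms(1-3) assms(2) xj] by simp
  also have "\<dots> = rat G (mvar j ^ d)"
    using rat_eq_iff[OF forms_mult[OF assms(1,2)] forms_mult[OF assms(2) xj(1)] _ assms(1) xj]
      \<open>\<not> vanishes_on (H * mvar j ^ d) Z\<close> by (simp add: algebra_simps)
  finally have "rat G H * ev j H = ev j G" by (simp add: rat_form[OF assms(1)] rat_form[OF assms(2)])
  thus ?thesis using ev_eq_0_iff[OF assms(2)] assms(3) by (simp add: field_simps)
qed

lemma element_eq_quotient:
  obtains G H d where "x = ev j G / ev j H" "G \<in> forms n d" "H \<in> forms n d" "\<not> vanishes_on H Z"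
proof -
  obtain G H d where 1: "h x = ratio n Z G H" "G \<in> forms n d" "H \<in> forms n d" "\<not> vanishes_on H Z"
    using function_fieldE[OF Z h_closed] by blast
  hence "x = rat G H" unfolding rat_def by (metis g_h)
  thus ?thesis using that rat_eq_ev[OF 1(2-4)] 1 by blast
qed

end

lemma generate_field_subset:
  assumes A: "subfield_set A" and H: "H \<subseteq> h ` A" and x: "x \<in> generate_field R H"
  shows "x \<in> h ` A"
  using x
proof induction
  case one
  show ?case using A h_one by (metis subfield_set_def image_eqI)
next
  case (incl x)
  thus ?case using H by blast
next
  case (a_inv x)
  thus ?case using A by (auto simp: subfield_set_def simp flip: h_uminus)
next
  case (m_inv x)
  then obtain a where "a \<in> A" "x = h a" by blast
  moreover from this have "a \<noteq> 0" using m_inv.hyps(2) by (simp add: h_eq_zero)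
  ultimately show ?case using A by (auto simp: subfield_set_def simp flip: h_inverse)
next
  case (eng_add x y)
  thus ?case using A by (auto simp: subfield_set_def simp flip: h_add)
next
  case (eng_mult x y)
  thus ?case using A by (auto simp: subfield_set_def simp flip: h_mult)
qed

end

section \<open>Separable elements\<close>
text \<open>
  Transitivity of algebraicity, by multiplicativity of degrees.
\<close>

lemma (in field) algebraic_if_algebraic_over_simple_extension:
  assumes L: "subfield L R" and z: "z \<in> carrier R" "(algebraic over L) z"
    and x: "x \<in> carrier R" "(algebraic over S) x" and S: "S \<subseteq> simple_extension L z"
  shows "(algebraic over L) x"
proof -
  let ?M = "simple_extension L z"
  have M: "subfield ?M R" using simple_extension_is_subfield[OF L z(1)] z(2) by blast
  have xM: "(algebraic over ?M) x" by (rule algebraic_mono[OF S x(2)])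
  let ?N = "simple_extension ?M x"
  have "finite_dimension L ?M" using finite_dimension_simple_extension[OF L z(1)] z(2) by blast
  moreover have "finite_dimension ?M ?N" using finite_dimension_simple_extension[OF M x(1)] xM by blast
  ultimately have "finite_dimension L ?N" using telescopic_base_dim(1)[OF L M] by blast
  moreover have "subring ?N R" by (rule simple_extension_is_subring[OF subfieldE(1)[OF M] x(1)])
  moreover have "x \<in> ?N" by (rule simple_extension_mem[OF subfieldE(1)[OF M] x(1)])
  ultimately show ?thesis using finite_dimension_imp_algebraic[OF L] by blast
qed

text \<open>
  The minimal polynomial generates a maximal ideal, and \<open>f\<close> lies outside of it.
\<close>

lemma (in field) bezout_of_nonvanishing:
  assumes L: "subfield L R" and x: "x \<in> carrier R" "(algebraic over L) x"
    and f: "f \<in> carrier (univ_poly R L)" "eval f x \<noteq> \<zero>"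
  shows "\<exists>a \<in> carrier (univ_poly R L). \<exists>b \<in> carrier (univ_poly R L).
    a \<otimes>\<^bsub>univ_poly R L\<^esub> Irr L x \<oplus>\<^bsub>univ_poly R L\<^esub> b \<otimes>\<^bsub>univ_poly R L\<^esub> f = \<one>\<^bsub>univ_poly R L\<^esub>"
proof -
  let ?P = "univ_poly R L" and ?m = "Irr L x"
  interpret P: principal_domain ?P by (rule univ_poly_is_principal[OF L])
  have m: "?m \<in> carrier ?P" "pirreducible L ?m" by (rule IrrE[OF L x])+
  have max: "maximalideal (PIdl\<^bsub>?P\<^esub> ?m) ?P" by (rule P.irreducible_imp_maximalideal[OF m])
  let ?J = "PIdl\<^bsub>?P\<^esub> ?m <+>\<^bsub>?P\<^esub> PIdl\<^bsub>?P\<^esub> f"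
  have J: "ideal ?J ?P" by (intro P.add_ideals P.cgenideal_ideal m f)
  have zero: "\<zero>\<^bsub>?P\<^esub> \<in> PIdl\<^bsub>?P\<^esub> g" if "g \<in> carrier ?P" for g
    using additive_subgroup.zero_closed[OF ideal.axioms(1)[OF P.cgenideal_ideal[OF that]]] .
  have in1: "a \<in> ?J" if "a \<in> PIdl\<^bsub>?P\<^esub> ?m" for a
  proof -
    have "a \<in> carrier ?P" using that ideal.Icarr[OF P.cgenideal_ideal[OF m(1)]] by blast
    hence "a = a \<oplus>\<^bsub>?P\<^esub> \<zero>\<^bsub>?P\<^esub>" by simp
    thus ?thesis using that zero[OF f(1)] unfolding set_add_def' by blast
  qed
  have "f \<in> PIdl\<^bsub>?P\<^esub> f" by (rule P.cgenideal_self[OF f(1)])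
  moreover have "f = \<zero>\<^bsub>?P\<^esub> \<oplus>\<^bsub>?P\<^esub> f" using f(1) by simp
  ultimately have "f \<in> ?J" using zero[OF m(1)] unfolding set_add_def' by blast
  moreover have "f \<notin> PIdl\<^bsub>?P\<^esub> ?m"
    using f(2) unfolding Irr_generates_ker[OF L x, symmetric] a_kernel_def' by simp
  ultimately have "?J = carrier ?P"
    using maximalideal.I_maximal[OF max J] in1 ideal.Icarr[OF J] by blast
  hence "\<one>\<^bsub>?P\<^esub> \<in> ?J" using P.one_closed by simp
  then obtain a b where "a \<in> PIdl\<^bsub>?P\<^esub> ?m" "b \<in> PIdl\<^bsub>?P\<^esub> f" "\<one>\<^bsub>?P\<^esub> = a \<oplus>\<^bsub>?P\<^esub> b"
    unfolding set_add_def' by blast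
  thus ?thesis unfolding cgenideal_def by force
qed

context function_field_model
begin

text \<open>
  Polynomials as coefficient lists start with the leading coefficient, whence the reversal.
\<close>

definition to_poly :: "'k mpoly fract set list \<Rightarrow> 'f poly" where
  "to_poly p = Poly (rev (map g p))"

lemma eval_to_poly: "set p \<subseteq> carrier R \<Longrightarrow> R.eval p (h x) = h (poly (to_poly p) x)"
proof (induction p)
  case Nil
  show ?case by (simp add: to_poly_def h_zero)
next
  case (Cons a p)
  have "poly (to_poly (a # p)) x = g a * x ^ length p + poly (to_poly p) x"
    by (simp add: to_poly_def Poly_append poly_monom)
  thus ?case using Cons by (simp add: h_add h_mult h_power)
qed

lemma coeff_to_poly: "Polynomial.coeff (to_poly p) i = (if i < length p then g (p ! (length p - Suc i)) else 0)"
  by (simp add: to_poly_def nth_default_def rev_nth flip: rev_map)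

lemma to_poly_nonzero:
  assumes "p \<in> carrier (univ_poly R S)" "S \<subseteq> carrier R" "p \<noteq> []"
  shows "to_poly p \<noteq> 0" "Polynomial.degree (to_poly p) = length p - 1"
proof -
  have p: "set p \<subseteq> S" "hd p \<noteq> \<zero>\<^bsub>R\<^esub>" using assms by (auto simp: univ_poly_def polynomial_def)
  have "hd p \<in> carrier R" using p(1) assms(2) hd_in_set[OF assms(3)] by blast
  hence "g (hd p) \<noteq> 0" using p(2) h_g[of "hd p"] h_zero by metis
  hence c: "Polynomial.coeff (to_poly p) (length p - 1) \<noteq> 0"
    using assms(3) by (simp add: coeff_to_poly hd_conv_nth)
  thus "to_poly p \<noteq> 0" by auto
  have "Polynomial.degree (to_poly p) \<le> length p - 1"
    by (rule degree_le) (auto simp: coeff_to_poly)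
  thus "Polynomial.degree (to_poly p) = length p - 1" using le_degree[OF c] by simp
qed

lemma coeff_to_poly_in:
  assumes "p \<in> carrier (univ_poly R S)" "subfield S R"
  shows "h (Polynomial.coeff (to_poly p) i) \<in> S"
proof -
  have S: "S \<subseteq> carrier R" "\<zero>\<^bsub>R\<^esub> \<in> S" using subfieldE(3)[OF assms(2)] subringE(2)[OF subfieldE(1)[OF assms(2)]] by auto
  have p: "set p \<subseteq> S" using assms by (auto simp: univ_poly_def polynomial_def)
  show ?thesis
  proof (cases "i < length p")
    case True
    hence "p ! (length p - Suc i) \<in> S" using p by auto
    thus ?thesis using True S by (simp add: coeff_to_poly subset_iff)
  qed (simp add: coeff_to_poly S h_zero)
qed

lemma list_of_poly:
  assumes "q \<noteq> 0" "\<And>i. h (Polynomial.coeff q i) \<in> S"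
  obtains p where "p \<in> carrier (univ_poly R S)" "p \<noteq> []" "to_poly p = q" "set p \<subseteq> carrier R"
proof
  let ?p = "rev (map h (coeffs q))"
  show "to_poly ?p = q" by (simp add: to_poly_def rev_map o_def)
  show "?p \<noteq> []" using assms(1) by simp
  have "hd ?p = h (Polynomial.lead_coeff q)"
    using assms(1) by (simp add: hd_rev last_map last_coeffs_eq_coeff_degree)
  hence "hd ?p \<noteq> \<zero>\<^bsub>R\<^esub>" using assms(1) by (simp add: h_eq_zero)
  moreover have "set ?p \<subseteq> S" using assms(2) by (auto simp: coeffs_def)
  ultimately show "?p \<in> carrier (univ_poly R S)" by (simp add: univ_poly_def polynomial_def)
  show "set ?p \<subseteq> carrier R" by auto
qed

lemma algebraic_if_poly:
  assumes "q \<noteq> 0" "\<And>i. h (Polynomial.coeff q i) \<in> S" "poly q x = 0"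
  shows "R.algebraic S (h x)"
proof -
  obtain p where p: "p \<in> carrier (univ_poly R S)" "p \<noteq> []" "to_poly p = q" "set p \<subseteq> carrier R"
    by (rule list_of_poly[OF assms(1,2)])
  have "R.eval p (h x) = \<zero>\<^bsub>R\<^esub>" using eval_to_poly[OF p(4)] p(3) assms(3) by (simp add: h_zero)
  thus ?thesis using R.algebraicI[OF p(1,2)] by (simp add: over_def)
qed

lemma formal_deriv_in:
  assumes "p \<in> carrier (univ_poly R S)" "subfield S R"
  shows "formal_deriv R p \<in> carrier (univ_poly R S)"
proof -
  have sr: "subring S R" by (rule subfieldE(1)[OF assms(2)])
  have p: "set p \<subseteq> S" using assms by (auto simp: univ_poly_def polynomial_def)
  have "add_pow R (k::nat) a \<in> S" if "a \<in> S" for a k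
  proof (induction k)
    case 0 show ?case using subringE(2)[OF sr] by simp
  next
    case (Suc k)
    have "a \<in> carrier R" using that subringE(1)[OF sr] by blast
    thus ?case using Suc subringE(7)[OF sr _ that] by (simp add: R.add.nat_pow_Suc)
  qed
  hence "set (map (\<lambda>i. add_pow R (length p - 1 - i) (p ! i)) [0..<length p - 1]) \<subseteq> S"
    using p by (auto simp: subset_iff)
  thus ?thesis unfolding formal_deriv_def using R.normalize_gives_polynomial by (simp add: univ_poly_def)
qed

lemma eval_formal_deriv:
  assumes p: "set p \<subseteq> carrier R"
  shows "R.eval (formal_deriv R p) (h x) = h (poly (pderiv (to_poly p)) x)"
proof -
  let ?r = "map (\<lambda>i. add_pow R (length p - 1 - i) (p ! i)) [0..<length p - 1]"
  have r: "set ?r \<subseteq> carrier R" using p by (auto simp: subset_iff)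
  have "to_poly ?r = pderiv (to_poly p)"
  proof (rule poly_eqI)
    fix i
    show "Polynomial.coeff (to_poly ?r) i = Polynomial.coeff (pderiv (to_poly p)) i"
    proof (cases "Suc i < length p")
      case True
      then obtain k where len: "length p = Suc (Suc (i + k))" using less_imp_Suc_add[OF True] by auto
      have Sk: "Suc (i + k) - k = Suc i" by simp
      have "?r ! k = add_pow R (Suc i) (p ! k)" by (simp add: len Sk del: upt_Suc)
      hence "Polynomial.coeff (to_poly ?r) i = g (add_pow R (Suc i) (p ! k))"
        by (simp add: coeff_to_poly len del: upt_Suc)
      also have "p ! k \<in> carrier R" using p len by (simp add: subset_iff)
      hence "g (add_pow R (Suc i) (p ! k)) = of_nat (Suc i) * g (p ! k)"
        by (metis g_h h_g h_add_pow_nat)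
      also have "\<dots> = Polynomial.coeff (pderiv (to_poly p)) i"
        by (simp add: coeff_pderiv coeff_to_poly len del: of_nat_Suc)
      finally show ?thesis .
    next
      case False
      thus ?thesis by (simp add: coeff_pderiv coeff_to_poly)
    qed
  qed
  thus ?thesis unfolding formal_deriv_def
    using R.eval_normalize[OF r h_closed] eval_to_poly[OF r] by simp
qed

lemma separable_elementE:
  assumes S: "subfield S R" and sep: "separable_element R S (h x)"
  obtains q where "\<And>i. h (Polynomial.coeff q i) \<in> S" "poly q x = 0" "poly (pderiv q) x \<noteq> 0"
proof -
  let ?P = "univ_poly R S" and ?f = "R.Irr S (h x)"
  have alg: "R.algebraic S (h x)" using sep by (simp add: separable_element_def)
  have f: "?f \<in> carrier ?P" "R.eval ?f (h x) = \<zero>\<^bsub>R\<^esub>"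
    using R.IrrE[OF S h_closed] alg by (auto simp: over_def)
  obtain a b where ab: "a \<in> carrier ?P" "b \<in> carrier ?P"
    "a \<otimes>\<^bsub>?P\<^esub> ?f \<oplus>\<^bsub>?P\<^esub> b \<otimes>\<^bsub>?P\<^esub> formal_deriv R ?f = \<one>\<^bsub>?P\<^esub>"
    using sep by (auto simp: separable_element_def Let_def)
  have d: "formal_deriv R ?f \<in> carrier ?P" by (rule formal_deriv_in[OF f(1) S])
  interpret P: domain ?P by (rule R.univ_poly_is_domain[OF subfieldE(1)[OF S]])
  interpret E: ring_hom_ring ?P R "\<lambda>p. R.eval p (h x)"
    by (rule R.eval_ring_hom[OF subfieldE(1)[OF S] h_closed])
  have "R.eval (a \<otimes>\<^bsub>?P\<^esub> ?f \<oplus>\<^bsub>?P\<^esub> b \<otimes>\<^bsub>?P\<^esub> formal_deriv R ?f) (h x) = \<one>\<^bsub>R\<^esub>"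
    unfolding ab(3) by (rule E.hom_one)
  hence "R.eval b (h x) \<otimes>\<^bsub>R\<^esub> R.eval (formal_deriv R ?f) (h x) = \<one>\<^bsub>R\<^esub>"
    using ab(1,2) f d by simp
  hence "R.eval (formal_deriv R ?f) (h x) \<noteq> \<zero>\<^bsub>R\<^esub>"
    using E.hom_closed[OF ab(2)] R.one_not_zero by auto
  moreover have sub: "set ?f \<subseteq> carrier R"
    using f(1) subfieldE(3)[OF S] by (auto simp: univ_poly_def polynomial_def)
  ultimately have "poly (pderiv (to_poly ?f)) x \<noteq> 0"
    using eval_formal_deriv[OF sub] by (simp add: h_eq_zero)
  moreover have "poly (to_poly ?f) x = 0"
    using f(2) eval_to_poly[OF sub, of x] by (simp add: h_eq_zero)
  ultimately show ?thesis using that coeff_to_poly_in[OF f(1) S] by blast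
qed

lemma subfield_set_of_subfield:
  assumes S: "subfield S R" shows "subfield_set {a. h a \<in> S}"
proof -
  have sr: "subring S R" by (rule subfieldE(1)[OF S])
  have "h (inverse a) \<in> S" if "h a \<in> S" for a
  proof (cases "a = 0")
    case False
    hence "h a \<in> S - {\<zero>\<^bsub>R\<^esub>}" using that by (simp add: h_eq_zero)
    thus ?thesis using R.subfield_m_inv(1)[OF S] h_inverse[OF False] by simp
  qed (use that in simp)
  thus ?thesis using subringE(3,5-7)[OF sr]
    by (simp add: subfield_set_def h_one h_add h_mult h_uminus)
qed

text \<open>
  The minimal polynomial divides \<open>q\<close>, so \<open>x\<close> is a simple root of the minimal polynomial as well.
\<close>

lemma separable_elementI:
  assumes S: "subfield S R" and q: "\<And>i. h (Polynomial.coeff q i) \<in> S" "poly q x = 0" "poly (pderiv q) x \<noteq> 0"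
  shows "separable_element R S (h x)"
proof -
  let ?P = "univ_poly R S" and ?f = "R.Irr S (h x)"
  have "q \<noteq> 0" using q(3) by auto
  have alg: "(R.algebraic over S) (h x)" using algebraic_if_poly[OF \<open>q \<noteq> 0\<close> q(1,2)] by (simp add: over_def)
  have f: "?f \<in> carrier ?P" "R.eval ?f (h x) = \<zero>\<^bsub>R\<^esub>" "pirreducible\<^bsub>R\<^esub> S ?f"
    using R.IrrE[OF S h_closed alg] by auto
  have f0: "?f \<noteq> []" using R.pirreducibleE(1)[OF subfieldE(1)[OF S] f(1,3)] .
  have sub: "set ?f \<subseteq> carrier R"
    using f(1) subfieldE(3)[OF S] by (auto simp: univ_poly_def polynomial_def)
  have root: "poly (to_poly ?f) x = 0" using f(2) eval_to_poly[OF sub, of x] by (simp add: h_eq_zero)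
  note tf = to_poly_nonzero[OF f(1) subfieldE(3)[OF S] f0]
  have "to_poly ?f dvd q"
  proof (rule minimal_dvd[OF subfield_set_of_subfield[OF S]])
    fix q' :: "'f poly" assume q': "\<And>i. Polynomial.coeff q' i \<in> {a. h a \<in> S}" "poly q' x = 0" "q' \<noteq> 0"
    have c': "h (Polynomial.coeff q' i) \<in> S" for i using q'(1) by simp
    obtain p where p: "p \<in> carrier ?P" "p \<noteq> []" "to_poly p = q'" "set p \<subseteq> carrier R"
      by (rule list_of_poly[OF q'(3) c'])
    have "R.eval p (h x) = \<zero>\<^bsub>R\<^esub>" using eval_to_poly[OF p(4), of x] p(3) q'(2) by (simp add: h_zero)
    hence "?f pdivides\<^bsub>R\<^esub> p" by (rule R.Irr_minimal[OF S h_closed alg p(1)])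
    hence "length ?f - 1 \<le> length p - 1"
      by (rule R.pdivides_imp_degree_le[OF subfieldE(1)[OF S] f(1) p(1,2)])
    thus "Polynomial.degree (to_poly ?f) \<le> Polynomial.degree q'"
      using tf(2) to_poly_nonzero(2)[OF p(1) subfieldE(3)[OF S] p(2)] p(3) by simp
  qed (use coeff_to_poly_in[OF f(1) S] tf root q in auto)
  then obtain s where s: "q = to_poly ?f * s" by (rule dvdE)
  have "poly (pderiv (to_poly ?f)) x \<noteq> 0"
    using q(3) root by (auto simp: s pderiv_mult)
  hence "R.eval (formal_deriv R ?f) (h x) \<noteq> \<zero>\<^bsub>R\<^esub>"
    using eval_formal_deriv[OF sub] by (simp add: h_eq_zero)
  from R.bezout_of_nonvanishing[OF S h_closed alg formal_deriv_in[OF f(1) S] this] alg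
  show ?thesis by (simp add: separable_element_def Let_def over_def)
qed

end

section \<open>Separability in transcendence degree one\<close>
lemma collect_var_self: "collect v (mvar v) = [:0, 1:]"
  unfolding collect_def by (subst peval_var) (auto intro: comm_ring_hom_comp[OF mconst_hom const_poly_hom])

lemma pderiv_const_coeff [simp]: "pderiv [:c:] = 0"
  by (simp add: pderiv_pCons)

lemma collect_mderiv_self:
  fixes F :: "'a::field mpoly"
  shows "collect v (mderiv v F) = pderiv (collect v F)"
proof -
  obtain V where "F \<in> polys_in V" by (rule polys_in_finite)
  thus ?thesis
  proof (induction rule: polys_in_induct)
    case (const c)
    show ?case using collect_free[OF polys_in_const, of v "{}" c] by simp
  next
    case (var i)
    interpret comm_ring_hom "collect v :: 'a mpoly \<Rightarrow> _" by (rule collect_hom)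
    show ?case
    proof (cases "i = v")
      case True thus ?thesis by (simp add: mderiv_var collect_var_self pderiv_pCons)
    next
      case False
      hence "collect v (mvar i :: 'a mpoly) = [:mvar i:]" by (intro collect_free[of _ "{i}"]) auto
      thus ?thesis using False by (simp add: mderiv_var)
    qed
  next
    case (add F G) thus ?case by (simp add: mderiv_add collect_add pderiv_add)
  next
    case (mult F G) thus ?case by (simp add: mderiv_mult collect_add collect_mult pderiv_mult algebra_simps)
  qed
qed

lemma coeff_collect_mderiv:
  fixes F :: "'a::field mpoly"
  assumes "i \<noteq> v"
  shows "Polynomial.coeff (collect v (mderiv i F)) k = mderiv i (Polynomial.coeff (collect v F) k)"
proof -
  obtain V where "F \<in> polys_in V" by (rule polys_in_finite)
  thus ?thesis
  proof (induction arbitrary: k rule: polys_in_induct)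
    case (const c)
    show ?case using collect_free[OF polys_in_const, of v "{}" c] by (simp add: coeff_pCons split: nat.split)
  next
    case (var j)
    interpret comm_ring_hom "collect v :: 'a mpoly \<Rightarrow> _" by (rule collect_hom)
    show ?case
    proof (cases "j = v")
      case True thus ?thesis using assms
        by (simp add: mderiv_var collect_var_self coeff_pCons split: nat.split)
    next
      case False
      hence "collect v (mvar j :: 'a mpoly) = [:mvar j:]" by (intro collect_free[of _ "{j}"]) auto
      thus ?thesis by (simp add: mderiv_var coeff_pCons split: nat.split)
    qed
  next
    case (add F G) thus ?case by (simp add: mderiv_add collect_add)
  next
    case (mult F G) thus ?case
      by (simp add: mderiv_mult collect_add collect_mult coeff_mult mderiv_sum sum.distrib)
  qed
qed

lemma pderiv_map_poly_hom:
  fixes f :: "'a::idom \<Rightarrow> 'b::field"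
  assumes "comm_ring_hom f" shows "pderiv (map_poly f q) = map_poly f (pderiv q)"
proof -
  interpret comm_ring_hom f by fact
  show ?thesis by (intro poly_eqI) (simp add: coeff_pderiv coeff_map_poly hom_mult hom_add hom_of_nat)
qed

context function_field_model
begin

lemma peval_hom_\<iota>: "comm_ring_hom (peval \<iota> y)"
  by (rule peval_hom[OF \<iota>_hom])

abbreviation "rational_in y k \<equiv> {peval \<iota> y a / peval \<iota> y b | a b. a \<in> polys_in {k} \<and> b \<in> polys_in {k} \<and> peval \<iota> y b \<noteq> 0}"

lemma subfield_set_rational: "subfield_set (rational_in y k)"
  unfolding subfield_set_def
proof (intro conjI ballI)
  note hom = peval_mult[OF \<iota>_hom] peval_add[OF \<iota>_hom]
  interpret e: comm_ring_hom "peval \<iota> y" by (rule peval_hom_\<iota>)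
  have one: "peval \<iota> y 1 = 1" by simp
  show "1 \<in> rational_in y k" by (rule CollectI, rule exI[of _ 1], rule exI[of _ 1]) simp
  fix s assume "s \<in> rational_in y k"
  then obtain a b where ab: "s = peval \<iota> y a / peval \<iota> y b" "a \<in> polys_in {k}" "b \<in> polys_in {k}" "peval \<iota> y b \<noteq> 0" by blast
  show "- s \<in> rational_in y k"
    by (rule CollectI, rule exI[of _ "- a"], rule exI[of _ b]) (use ab in \<open>simp add: e.hom_uminus polys_in_uminus\<close>)
  show "inverse s \<in> rational_in y k"
  proof (cases "peval \<iota> y a = 0")
    case True
    thus ?thesis using ab by (intro CollectI exI[of _ 0] exI[of _ 1]) simp
  next
    case False
    thus ?thesis using ab by (intro CollectI exI[of _ b] exI[of _ a]) simp
  qed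
  fix t assume "t \<in> rational_in y k"
  then obtain c e where ce: "t = peval \<iota> y c / peval \<iota> y e" "c \<in> polys_in {k}" "e \<in> polys_in {k}" "peval \<iota> y e \<noteq> 0" by blast
  show "s + t \<in> rational_in y k"
    by (rule CollectI, rule exI[of _ "a * e + c * b"], rule exI[of _ "b * e"])
       (use ab ce in \<open>simp add: e.hom_add e.hom_mult polys_in_mult polys_in_add add_frac_eq\<close>)
  show "s * t \<in> rational_in y k"
    by (rule CollectI, rule exI[of _ "a * c"], rule exI[of _ "b * e"])
       (use ab ce in \<open>simp add: e.hom_mult polys_in_mult\<close>)
qed

lemma const_in_rational: "\<iota> c \<in> rational_in y k"
proof -
  interpret e: comm_ring_hom "peval \<iota> y" by (rule peval_hom_\<iota>)
  show ?thesis by (rule CollectI, rule exI[of _ "mconst c"], rule exI[of _ 1]) (simp add: peval_const[OF \<iota>_hom])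
qed

lemma var_in_rational: "y k \<in> rational_in y k"
proof -
  interpret e: comm_ring_hom "peval \<iota> y" by (rule peval_hom_\<iota>)
  show ?thesis by (rule CollectI, rule exI[of _ "mvar k"], rule exI[of _ 1]) (simp add: peval_var[OF \<iota>_hom])
qed

lemma clear_denominators:
  assumes "k \<noteq> l" and "\<And>i. Polynomial.coeff q i \<in> rational_in y k"
  shows "\<exists>b P. b \<in> polys_in {k} \<and> P \<in> polys_in {k, l} \<and> peval \<iota> y b \<noteq> 0 \<and>
           peval \<iota> y P = peval \<iota> y b * poly q (y l) \<and> (q \<noteq> 0 \<longrightarrow> P \<noteq> 0)"
  using assms(2)
proof (induction q)
  interpret e: comm_ring_hom "peval \<iota> y" by (rule peval_hom_\<iota>)
  case 0
  show ?case by (intro exI[of _ 1] exI[of _ 0]) simp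
next
  interpret e: comm_ring_hom "peval \<iota> y" by (rule peval_hom_\<iota>)
  case (pCons c q)
  have "Polynomial.coeff q i \<in> rational_in y k" for i using pCons.prems[of "Suc i"] by simp
  then obtain b P where bP: "b \<in> polys_in {k}" "P \<in> polys_in {k, l}" "peval \<iota> y b \<noteq> 0"
    "peval \<iota> y P = peval \<iota> y b * poly q (y l)" "q \<noteq> 0 \<longrightarrow> P \<noteq> 0"
    using pCons.IH by blast
  obtain \<alpha> \<beta> where \<alpha>\<beta>: "c = peval \<iota> y \<alpha> / peval \<iota> y \<beta>" "\<alpha> \<in> polys_in {k}" "\<beta> \<in> polys_in {k}" "peval \<iota> y \<beta> \<noteq> 0"
    using pCons.prems[of 0] by auto
  define P' where "P' = \<alpha> * b + \<beta> * mvar l * P"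
  have sub: "polys_in {k} \<subseteq> (polys_in {k, l} :: 'k mpoly set)" by (rule polys_in_mono) auto
  have "P' \<in> polys_in {k, l}"
    unfolding P'_def using subsetD[OF sub \<alpha>\<beta>(2)] subsetD[OF sub \<alpha>\<beta>(3)] subsetD[OF sub bP(1)] bP(2)
    by (simp add: polys_in_add polys_in_mult)
  moreover have "peval \<iota> y (\<beta> * b) \<noteq> 0" "\<beta> * b \<in> polys_in {k}"
    using bP \<alpha>\<beta> by (simp_all add: e.hom_mult polys_in_mult)
  moreover have "peval \<iota> y P' = peval \<iota> y (\<beta> * b) * poly (pCons c q) (y l)"
    unfolding P'_def e.hom_add e.hom_mult bP(4) peval_var[OF \<iota>_hom] using \<alpha>\<beta> by (simp add: field_simps)
  moreover have "P' \<noteq> 0"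
  proof
    assume "P' = 0"
    have "collect l P' = pCons (\<alpha> * b) (Polynomial.smult \<beta> (collect l P))"
      using collect_free[OF \<alpha>\<beta>(2), of l] collect_free[OF \<alpha>\<beta>(3), of l] collect_free[OF bP(1), of l] assms(1)
      by (simp add: P'_def collect_add collect_mult collect_var_self)
    hence z: "\<alpha> * b = 0" "Polynomial.smult \<beta> (collect l P) = 0" using \<open>P' = 0\<close> by simp_all
    have "\<beta> \<noteq> 0" "b \<noteq> 0" using \<alpha>\<beta>(4) bP(3) by auto
    hence "P = 0" "\<alpha> = 0" using z by auto
    hence "q = 0" "c = 0" using bP(5) \<alpha>\<beta>(1) by auto
    thus False using pCons.hyps by simp
  qed
  ultimately show ?case by blast
qed

lemma constants_closed: "constants n Z \<subseteq> carrier R"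
  by (auto simp: constants_eq)

abbreviation "K_adjoin u \<equiv> generate_field R (insert (h u) (constants n Z))"

lemma subfield_K_adjoin: "subfield (K_adjoin u) R"
  by (rule R.generate_field_is_subfield) (use constants_closed in simp)

lemma relation_of_algebraic:
  assumes "k \<noteq> l" and alg: "R.algebraic (K_adjoin (y k)) (h (y l))"
  shows "\<exists>P\<in>polys_in {k, l}. P \<noteq> 0 \<and> peval \<iota> y P = 0"
proof -
  let ?S = "K_adjoin (y k)"
  note S = subfield_K_adjoin[of "y k"]
  have "(R.algebraic over ?S) (h (y l))" using alg by (simp add: over_def)
  then obtain p where p: "p \<in> carrier (univ_poly R ?S)" "p \<noteq> []" "R.eval p (h (y l)) = \<zero>\<^bsub>R\<^esub>"
    by (rule R.algebraicE[OF subfieldE(1)[OF S] h_closed])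
  have sub: "set p \<subseteq> carrier R" using p(1) subfieldE(3)[OF S] by (auto simp: univ_poly_def polynomial_def)
  have gen: "insert (h (y k)) (constants n Z) \<subseteq> h ` rational_in y k"
    unfolding constants_eq using const_in_rational var_in_rational by blast
  have c: "Polynomial.coeff (to_poly p) i \<in> rational_in y k" for i
  proof -
    obtain a where "a \<in> rational_in y k" "h (Polynomial.coeff (to_poly p) i) = h a"
      using generate_field_subset[OF subfield_set_rational gen coeff_to_poly_in[OF p(1) S]] by blast
    thus ?thesis by (simp only: inj_h)
  qed
  obtain b P where "P \<in> polys_in {k, l}" "peval \<iota> y P = peval \<iota> y b * poly (to_poly p) (y l)" "to_poly p \<noteq> 0 \<longrightarrow> P \<noteq> 0"
    using clear_denominators[OF assms(1) c] by blast
  moreover have "poly (to_poly p) (y l) = 0" using p(3) eval_to_poly[OF sub] by (simp add: h_eq_zero)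
  moreover have "to_poly p \<noteq> 0" using to_poly_nonzero(1)[OF p(1) subfieldE(3)[OF S] p(2)] .
  ultimately show ?thesis by (intro bexI[of _ P]) auto
qed

text \<open>
  The derivation kills the coefficients of a separable polynomial \<open>q\<close> with root \<open>x\<close>, so differentiating \<open>q(x) = 0\<close>
  leaves \<open>q'(x) * \<delta> x = 0\<close>.
\<close>

lemma separating_rigid:
  assumes sep: "separating_element n Z (h \<zeta>)" and d: "derivation \<delta>" "\<And>c. \<delta> (\<iota> c) = 0" "\<delta> \<zeta> = 0"
  shows "\<delta> x = 0"
proof -
  interpret derivation \<delta> by (rule d)
  have "separable_element R (K_adjoin \<zeta>) (h x)" using sep by (simp add: separating_element_def)
  then obtain q where q: "\<And>i. h (Polynomial.coeff q i) \<in> K_adjoin \<zeta>" "poly q x = 0" "poly (pderiv q) x \<noteq> 0"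
    by (rule separable_elementE[OF subfield_K_adjoin]) blast
  have gen: "insert (h \<zeta>) (constants n Z) \<subseteq> h ` {a. \<delta> a = 0}"
    unfolding constants_eq using d by auto
  have "\<delta> (Polynomial.coeff q i) = 0" for i
  proof -
    obtain a where "\<delta> a = 0" "h (Polynomial.coeff q i) = h a"
      using generate_field_subset[OF subfield_set_constants[OF d(1)] gen q(1)] by blast
    thus ?thesis by (simp only: inj_h)
  qed
  hence "\<delta> (poly q x) = poly (pderiv q) x * \<delta> x" by (rule derivation_poly_const_coeffs[OF d(1)])
  thus ?thesis using q(2,3) by simp
qed

lemma peval_in_subfield:
  assumes S: "subfield S R" "constants n Z \<subseteq> S" and c: "c \<in> polys_in V" and V: "\<And>i. i \<in> V \<Longrightarrow> h (y i) \<in> S"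
  shows "h (peval \<iota> y c) \<in> S"
  using c
proof (induction rule: polys_in_induct)
  case (const c)
  have "h (\<iota> c) \<in> constants n Z" by (simp add: constants_eq)
  thus ?case using S(2) by (auto simp: peval_const[OF \<iota>_hom])
next
  case (var i) thus ?case using V by (simp add: peval_var[OF \<iota>_hom])
next
  case (add F G) thus ?case
    using subringE(7)[OF subfieldE(1)[OF S(1)]] by (simp add: peval_add[OF \<iota>_hom] h_add)
next
  case (mult F G) thus ?case
    using subringE(6)[OF subfieldE(1)[OF S(1)]] by (simp add: peval_mult[OF \<iota>_hom] h_mult)
qed

lemma K_adjoin_incl: "constants n Z \<subseteq> K_adjoin u" "h u \<in> K_adjoin u"
  by (auto intro: generate_field.incl)

text \<open>
  The exchange argument for transcendence degree one. A relation between \<open>\<zeta>\<close> and \<open>y 0\<close> either is a relation for \<open>y 0\<close>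
  alone, or it makes \<open>\<zeta>\<close>, and with it every element, algebraic over the field generated by \<open>y 0\<close>.
\<close>

lemma all_related:
  assumes sep: "separating_element n Z (h \<zeta>)"
  shows "\<exists>P\<in>polys_in {0, 1}. P \<noteq> 0 \<and> peval \<iota> y P = 0"
proof -
  let ?w = "y 0"
  have alg: "R.algebraic (K_adjoin \<zeta>) (h x)" for x
    using sep by (simp add: separating_element_def separable_element_def)
  define y' where "y' = (\<lambda>i. if i = (0::nat) then ?w else \<zeta>)"
  have "R.algebraic (K_adjoin (y' 1)) (h (y' 0))" using alg by (simp add: y'_def)
  then obtain P where P: "P \<in> polys_in {0, 1}" "P \<noteq> 0" "peval \<iota> y' P = 0"
    using relation_of_algebraic[of 1 0 y'] by (auto simp: insert_commute)
  have coeff: "Polynomial.coeff (collect 1 P) i \<in> polys_in {0}" for i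
    using polys_in_insertE[of P 1 "{0}" i] P(1) by (simp add: insert_commute)
  define q where "q = map_poly (peval \<iota> y') (collect 1 P)"
  have coeff_q: "Polynomial.coeff q i = peval \<iota> y' (Polynomial.coeff (collect 1 P) i)" for i
    by (simp add: q_def coeff_map_poly peval_0[OF \<iota>_hom])
  show ?thesis
  proof (cases "q = 0")
    case True
    let ?c = "Polynomial.lead_coeff (collect 1 P)"
    have "peval \<iota> y' ?c = 0" using coeff_q[of "vdeg 1 P"] True by simp
    moreover have "peval \<iota> y ?c = peval \<iota> y' ?c" by (rule peval_cong[OF coeff]) (simp add: y'_def)
    moreover have "?c \<in> polys_in {0, 1}" using coeff polys_in_mono[of "{0}" "{0, 1::nat}"] by blast
    moreover have "?c \<noteq> 0" using P(2) by simp
    ultimately show ?thesis by (intro bexI[of _ ?c]) auto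
  next
    case False
    let ?L = "K_adjoin ?w"
    note L = subfield_K_adjoin[of ?w]
    have "h (Polynomial.coeff q i) \<in> ?L" for i
      unfolding coeff_q by (rule peval_in_subfield[OF L K_adjoin_incl(1) coeff]) (use K_adjoin_incl(2) in \<open>simp add: y'_def\<close>)
    moreover have "poly q \<zeta> = 0"
      using P(3) peval_collect[OF \<iota>_hom, of y' P 1] by (simp add: q_def y'_def)
    ultimately have zalg: "(R.algebraic over ?L) (h \<zeta>)" using algebraic_if_poly[OF False] by (simp add: over_def)
    have M: "subfield (R.simple_extension ?L (h \<zeta>)) R"
      using R.simple_extension_is_subfield[OF L h_closed] zalg by blast
    have "insert (h \<zeta>) (constants n Z) \<subseteq> R.simple_extension ?L (h \<zeta>)"
      using R.simple_extension_incl[OF subfieldE(3)[OF L] h_closed] R.simple_extension_mem[OF subfieldE(1)[OF L] h_closed]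
        K_adjoin_incl(1)[of ?w] by blast
    hence sub: "K_adjoin \<zeta> \<subseteq> R.simple_extension ?L (h \<zeta>)"
      by (intro R.generate_field_min_subfield1[OF _ M]) (use constants_closed in auto)
    have xalg: "(R.algebraic over K_adjoin \<zeta>) (h (y 1))" using alg[of "y 1"] by (simp add: over_def)
    have "(R.algebraic over ?L) (h (y 1))"
      by (rule R.algebraic_if_algebraic_over_simple_extension[OF L h_closed zalg h_closed xalg sub])
    thus ?thesis using relation_of_algebraic[of 0 1 y] by (simp add: over_def)
  qed
qed

text \<open>
  There is a relation \<open>P(w, x) = 0\<close> of which not both partial derivatives vanish. As \<open>d w\<close> is nonzero, the chain
  rule excludes that the derivative in the second variable does, so \<open>x\<close> is a simple root of \<open>P(w, T)\<close>.
\<close>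

lemma separable_over_nonconstant:
  assumes p: "p = CHAR('k)" "prime p" and perf: "surj (\<lambda>x::'k. x ^ p)"
    and sep: "separating_element n Z (h \<zeta>)"
    and d: "derivation d" "\<And>c. d (\<iota> c) = 0" "d w \<noteq> 0"
    and S: "subfield S R" "constants n Z \<subseteq> S" "h w \<in> S"
  shows "separable_element R S (h x)"
proof -
  define y where "y = (\<lambda>i. if i = (0::nat) then w else x)"
  obtain P where P: "P \<in> polys_in {0, 1}" "P \<noteq> 0" "peval \<iota> y P = 0" using all_related[OF sep] by blast
  have d0: "d (y 0) \<noteq> 0" using d(3) by (simp add: y_def)
  obtain P where P: "P \<in> polys_in {0, 1}" "peval \<iota> y P = 0" "peval \<iota> y (mderiv 1 P) \<noteq> 0"
    using exists_separable_relation_second[OF \<iota>_hom p perf d(1,2) d0 P] by blast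
  define q where "q = map_poly (peval \<iota> y) (collect 1 P)"
  have coeff: "Polynomial.coeff (collect 1 P) i \<in> polys_in {0}" for i
    using polys_in_insertE[of P 1 "{0}" i] P(1) by (simp add: insert_commute)
  show ?thesis
  proof (rule separable_elementI[OF S(1)])
    show "h (Polynomial.coeff q i) \<in> S" for i
    proof -
      have "h (peval \<iota> y (Polynomial.coeff (collect 1 P) i)) \<in> S"
        by (rule peval_in_subfield[OF S(1,2) coeff]) (use S(3) in \<open>simp add: y_def\<close>)
      thus ?thesis by (simp add: q_def coeff_map_poly peval_0[OF \<iota>_hom])
    qed
    show "poly q x = 0" using P(2) peval_collect[OF \<iota>_hom, of y P 1] by (simp add: q_def y_def)
    show "poly (pderiv q) x \<noteq> 0"
      using P(3) peval_collect[OF \<iota>_hom, of y "mderiv 1 P" 1]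
      unfolding q_def pderiv_map_poly_hom[OF peval_hom_\<iota>] collect_mderiv_self by (simp add: y_def)
  qed
qed

text \<open>
  In a relation \<open>P(\<zeta>, w) = 0\<close> of least degree, the chain rule makes the derivative in the first variable vanish
  identically. So \<open>w\<close> is a simple root of \<open>P(\<zeta>, T)\<close>, all of whose coefficients are \<open>p\<close>-th powers.
\<close>

lemma pth_power_if_constant:
  assumes p: "p = CHAR('k)" "prime p" and perf: "surj (\<lambda>x::'k. x ^ p)"
    and sep: "separating_element n Z (h \<zeta>)"
    and d: "derivation d" "\<And>c. d (\<iota> c) = 0" "d \<zeta> = 1" "d w = 0"
  shows "\<exists>u. w = u ^ p"
proof -
  interpret derivation d by (rule d)
  define y where "y = (\<lambda>i. if i = (0::nat) then \<zeta> else w)"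
  obtain P where P: "P \<in> polys_in {0, 1}" "P \<noteq> 0" "peval \<iota> y P = 0" using all_related[OF sep] by blast
  obtain P where P: "P \<in> polys_in {0, 1}" "peval \<iota> y P = 0"
    "peval \<iota> y (mderiv 0 P) \<noteq> 0 \<or> peval \<iota> y (mderiv 1 P) \<noteq> 0"
    "peval \<iota> y (mderiv 0 P) = 0 \<Longrightarrow> mderiv 0 P = 0"
    using exists_separable_relation[OF \<iota>_hom p perf P] by auto
  have "0 = peval \<iota> y (mderiv 0 P) * d (y 0) + peval \<iota> y (mderiv 1 P) * d (y 1)"
    using chain_rule[OF _ P(1) \<iota>_hom d(2), of y] P(2) by simp
  hence "peval \<iota> y (mderiv 0 P) = 0" using d by (simp add: y_def)
  hence P0: "mderiv 0 P = 0" and P1: "peval \<iota> y (mderiv 1 P) \<noteq> 0" using P(3,4) by auto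
  define q where "q = map_poly (peval \<iota> y) (collect 1 P)"
  let ?A = "range (\<lambda>u::'f. u ^ p)"
  have CHAR: "CHAR('f) = p" "prime CHAR('f)" using CHAR_f p by auto
  have p0: "p > 0" using p(2) prime_gt_0_nat by blast
  have A: "subfield_set ?A"
    unfolding subfield_set_def
  proof (intro conjI ballI)
    show "1 \<in> ?A" by (rule range_eqI[of _ _ 1]) simp
    fix a assume "a \<in> ?A" then obtain u where u: "a = u ^ p" by blast
    show "- a \<in> ?A" using minus_power_prime_CHAR[where x = u and p = p] CHAR u p(2) by (intro range_eqI[of _ _ "- u"]) simp
    show "inverse a \<in> ?A" using u by (intro range_eqI[of _ _ "inverse u"]) (simp add: power_inverse)
    fix b assume "b \<in> ?A" then obtain v where v: "b = v ^ p" by blast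
    have "(u + v) ^ p = u ^ p + v ^ p" by (rule freshmans_dream) (use CHAR in simp_all)
    hence "a + b = (u + v) ^ p" using u v by (simp only:)
    thus "a + b \<in> ?A" by (rule range_eqI[of _ _ "u + v"])
    have "a * b = (u * v) ^ p" using u v by (simp only: power_mult_distrib)
    thus "a * b \<in> ?A" by (rule range_eqI[of _ _ "u * v"])
  qed
  have "w \<in> ?A"
  proof (rule in_subfield_if_separable_and_power[OF A _ _ _ CHAR(1) p(2)])
    show "Polynomial.coeff q i \<in> ?A" for i
    proof -
      let ?c = "Polynomial.coeff (collect 1 P) i"
      have cV: "?c \<in> polys_in {0}"
        using polys_in_insertE[of P 1 "{0}" i] P(1) by (simp add: insert_commute)
      have "mderiv 0 ?c = 0" using coeff_collect_mderiv[of 0 1 P i] P0 by simp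
      hence der: "mderiv k ?c = 0" if "k \<in> {0}" for k using that by simp
      have "\<exists>u. peval \<iota> y ?c = u ^ p"
      proof (cases "?c = 0")
        case True thus ?thesis using p0 by (intro exI[of _ 0]) (simp add: peval_0[OF \<iota>_hom])
      next
        case False
        obtain N where "deg_le N ?c" using deg_le_ex by blast
        thus ?thesis using exists_pth_root_poly[OF \<iota>_hom p perf cV False _ der] by blast
      qed
      thus ?thesis by (auto simp: q_def coeff_map_poly peval_0[OF \<iota>_hom])
    qed
    show "poly q w = 0" using P(2) peval_collect[OF \<iota>_hom, of y P 1] by (simp add: q_def y_def)
    show "poly (pderiv q) w \<noteq> 0"
      using P1 peval_collect[OF \<iota>_hom, of y "mderiv 1 P" 1]
      unfolding q_def pderiv_map_poly_hom[OF peval_hom_\<iota>] collect_mderiv_self by (simp add: y_def)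
    show "w ^ p \<in> ?A" by blast
  qed
  thus ?thesis by blast
qed

end

section \<open>Classical curves\<close>
lemma strictly_increasing_ge_index:
  assumes "sorted_wrt (<) (\<delta> :: nat list)" "i < length \<delta>" shows "i \<le> \<delta> ! i"
  using assms(2)
proof (induction i)
  case (Suc i)
  have "\<delta> ! i < \<delta> ! Suc i" using assms(1) Suc.prems by (simp add: sorted_wrt_iff_nth_less)
  thus ?case using Suc by simp
qed simp

lemma upt_lexord_minimal:
  assumes "sorted_wrt (<) \<delta>" "length \<delta> = Suc n"
  shows "\<delta> = [0..<Suc n] \<or> ([0..<Suc n], \<delta>) \<in> lexord {(a, b). a < b}"
proof (rule disjCI)
  assume nl: "([0..<Suc n], \<delta>) \<notin> lexord {(a, b). a < b}"
  have "\<delta> ! i = i" if "i < Suc n" for i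
    using that
  proof (induction i rule: less_induct)
    case (less i)
    have "take i \<delta> = [0..<i]"
      by (rule nth_equalityI) (use less assms in auto)
    moreover have "i \<le> \<delta> ! i" using strictly_increasing_ge_index[OF assms(1)] less.prems assms(2) by simp
    ultimately have "\<delta> ! i > i \<Longrightarrow> ([0..<Suc n], \<delta>) \<in> lexord {(a, b). a < b}"
      unfolding lexord_take_index_conv using less.prems assms(2)
      by (intro disjI2 exI[of _ i]) (simp add: take_upt del: upt_Suc)
    thus ?case using nl \<open>i \<le> \<delta> ! i\<close> by (metis le_neq_implies_less)
  qed
  thus "\<delta> = [0..<Suc n]" by (intro nth_equalityI) (use assms in \<open>auto simp del: upt_Suc\<close>)
qed

context function_field_model
begin

lemma ring_det_eq:
  assumes "\<And>i l. i \<le> n \<Longrightarrow> l \<le> n \<Longrightarrow> A i l = h (M i l)"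
  shows "ring_det R n A = h (\<Sum>\<pi>\<in>{\<pi>. \<pi> permutes {..n}}. of_int (sign \<pi>) * (\<Prod>i\<in>{..n}. M i (\<pi> i)))"
proof -
  have prod: "(\<Otimes>\<^bsub>R\<^esub>i\<in>{..n}. A i (\<pi> i)) = h (\<Prod>i\<in>{..n}. M i (\<pi> i))" if \<pi>: "\<pi> permutes {..n}" for \<pi>
  proof -
    have "(\<Otimes>\<^bsub>R\<^esub>i\<in>{..n}. A i (\<pi> i)) = (\<Otimes>\<^bsub>R\<^esub>i\<in>{..n}. h (M i (\<pi> i)))"
    proof (rule R.finprod_cong'[OF refl])
      fix i assume "i \<in> {..n}"
      thus "A i (\<pi> i) = h (M i (\<pi> i))" using permutes_in_image[OF \<pi>, of i] assms by simp
    qed auto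
    thus ?thesis by (simp add: h_prod)
  qed
  have "ring_det R n A = (\<Oplus>\<^bsub>R\<^esub>\<pi>\<in>{\<pi>. \<pi> permutes {..n}}. h (of_int (sign \<pi>) * (\<Prod>i\<in>{..n}. M i (\<pi> i))))"
    unfolding ring_det_def
  proof (rule R.finsum_cong'[OF refl])
    fix \<pi> assume "\<pi> \<in> {\<pi>. \<pi> permutes {..n}}"
    thus "add_pow R (sign \<pi> :: int) (\<Otimes>\<^bsub>R\<^esub>i\<in>{..n}. A i (\<pi> i)) = h (of_int (sign \<pi>) * (\<Prod>i\<in>{..n}. M i (\<pi> i)))"
      using prod[of \<pi>] h_add_pow_int[of "sign \<pi>" "\<Prod>i\<in>{..n}. M i (\<pi> i)"] by simp
  qed auto
  also have "\<dots> = h (\<Sum>\<pi>\<in>{\<pi>. \<pi> permutes {..n}}. of_int (sign \<pi>) * (\<Prod>i\<in>{..n}. M i (\<pi> i)))"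
    by (rule h_sum[symmetric]) (simp add: finite_permutations)
  finally show ?thesis .
qed

lemma hasse_model:
  assumes D: "hasse_derivatives n Z (h \<zeta>) D" and sep: "separating_element n Z (h \<zeta>)"
  obtains d where "derivation d" "\<And>c. d (\<iota> c) = 0" "d \<zeta> = 1"
    "\<And>k x. D k (h x) = h (g (D k (h x)))"
    "\<And>k x. of_nat (fact k) * g (D k (h x)) = (d ^^ k) x"
proof -
  define D' where "D' k x = g (D k (h x))" for k x
  have cl: "D k (h x) \<in> carrier R" for k x using D by (simp add: hasse_derivatives_def Let_def)
  have hD: "h (D' k x) = D k (h x)" for k x unfolding D'_def by (rule h_g[OF cl])
  have D0: "D' 0 x = x" for x
    using D by (simp add: D'_def hasse_derivatives_def Let_def)
  have add: "D' k (x + y) = D' k x + D' k y" for k x y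
  proof -
    have "D k (h x \<oplus>\<^bsub>R\<^esub> h y) = D k (h x) \<oplus>\<^bsub>R\<^esub> D k (h y)"
      using D by (simp add: hasse_derivatives_def Let_def)
    hence "h (D' k (x + y)) = h (D' k x + D' k y)" by (simp add: hD h_add)
    thus ?thesis by (simp only: inj_h)
  qed
  have mult: "D' k (x * y) = (\<Sum>i\<le>k. D' i x * D' (k - i) y)" for k x y
  proof -
    have "D k (h x \<otimes>\<^bsub>R\<^esub> h y) = (\<Oplus>\<^bsub>R\<^esub>i\<in>{..k}. D i (h x) \<otimes>\<^bsub>R\<^esub> D (k - i) (h y))"
      using D by (simp add: hasse_derivatives_def Let_def)
    hence "h (D' k (x * y)) = h (\<Sum>i\<le>k. D' i x * D' (k - i) y)" by (simp add: hD h_mult h_sum)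
    thus ?thesis by (simp only: inj_h)
  qed
  have const: "D' k c = 0" if "c \<in> range \<iota>" "k \<ge> 1" for k c
  proof -
    have "D k (h c) = \<zero>\<^bsub>R\<^esub>"
      using D that constants_eq by (auto simp: hasse_derivatives_def Let_def)
    thus ?thesis using hD[of k c] by (simp add: h_eq_zero)
  qed
  have \<zeta>1: "D' 1 \<zeta> = 1"
  proof -
    have "D 1 (h \<zeta>) = h 1" using D by (simp add: hasse_derivatives_def Let_def h_one)
    thus ?thesis by (simp add: D'_def)
  qed
  have \<zeta>2: "D' k \<zeta> = 0" if "k \<ge> 2" for k
  proof -
    have "D k (h \<zeta>) = h 0" using D that by (simp add: hasse_derivatives_def Let_def h_zero)
    thus ?thesis by (simp add: D'_def)
  qed
  have rigid: "\<delta> x = 0" if "derivation \<delta>" "\<And>c. c \<in> range \<iota> \<Longrightarrow> \<delta> c = 0" "\<delta> \<zeta> = 0" for \<delta> x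
    using separating_rigid[OF sep that(1) _ that(3)] that(2) by blast
  have der: "derivation (D' 1)"
    by (rule hasse_composition(1)[where D = D' and C = "range \<iota>" and \<zeta> = \<zeta>])
       (fact D0 add mult const \<zeta>1 \<zeta>2 rigid)+
  have comp: "of_nat (Suc m) * D' (Suc m) x = D' 1 (D' m x)" for m x
    by (rule hasse_composition(2)[where D = D' and C = "range \<iota>" and \<zeta> = \<zeta>])
       (fact D0 add mult const \<zeta>1 \<zeta>2 rigid)+
  have "of_nat (fact k) * D' k x = (D' 1 ^^ k) x" for k x
    by (rule fact_times_hasse[OF D0 comp der])
  moreover have "D' 1 (\<iota> c) = 0" for c by (rule const) auto
  moreover have "D k (h x) = h (g (D k (h x)))" for k x using cl by simp
  ultimately show ?thesis using that[of "D' 1"] der \<zeta>1 by (simp add: D'_def)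
qed

text \<open>
  The sequence \<open>0, \<dots>, n\<close> precedes all other candidates, so the curve is classical if and only if the determinant for this
  sequence does not vanish. By the factors \<open>i!\<close>, which are nonzero for \<open>i \<le> n < p\<close>, it is the Wronskian up to a unit.
\<close>

lemma classical_iff:
  assumes p: "p = CHAR('k)" "prime p" "n < p"
    and j: "j \<le> n" "\<not> vanishes_on (mvar j :: 'k mpoly) Z"
    and D: "\<And>k x. D k (h x) = h (g (D k (h x)))" "\<And>k x. of_nat (fact k) * g (D k (h x)) = (d ^^ k) x"
  shows "classical n Z j D \<longleftrightarrow>
    \<not> (\<exists>c. (\<exists>l\<le>n. c l \<noteq> 0) \<and> (\<forall>i\<le>n. (\<Sum>l\<le>n. c l * (d ^^ i) (rat (mvar l) (mvar j))) = 0))"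
proof -
  define M where "M = (\<lambda>i l. g (D i (h (rat (mvar l) (mvar j)))))"
  have "classical n Z j D \<longleftrightarrow> independent_orders n Z j D [0..<Suc n]"
    unfolding classical_def is_order_sequence_def independent_orders_def
    using upt_lexord_minimal[of _ n] by blast
  also have "\<dots> \<longleftrightarrow> ring_det R n (\<lambda>i l. D ([0..<Suc n] ! i) (ratio n Z (mvar l) (mvar j))) \<noteq> \<zero>\<^bsub>R\<^esub>"
    unfolding independent_orders_def using strict_sorted_iff[of "[0..<Suc n]"] sorted_upt by (simp del: upt_Suc)
  also have "ring_det R n (\<lambda>i l. D ([0..<Suc n] ! i) (ratio n Z (mvar l) (mvar j)))
      = h (\<Sum>\<pi>\<in>{\<pi>. \<pi> permutes {..n}}. of_int (sign \<pi>) * (\<Prod>i\<in>{..n}. M i (\<pi> i)))"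
  proof (rule ring_det_eq)
    fix i l assume il: "i \<le> n" "l \<le> n"
    have "[0..<Suc n] ! i = i" using il(1) by (simp del: upt_Suc)
    moreover have "ratio n Z (mvar l) (mvar j) = h (rat (mvar l) (mvar j))"
      using h_rat[OF forms_var[OF il(2)] forms_var[OF j(1)] j(2)] by simp
    ultimately show "D ([0..<Suc n] ! i) (ratio n Z (mvar l) (mvar j)) = h (M i l)"
      using D(1)[of i "rat (mvar l) (mvar j)"] by (simp add: M_def del: upt_Suc)
  qed
  also have "\<dots> = \<zero>\<^bsub>R\<^esub> \<longleftrightarrow> (\<exists>c. (\<exists>l\<le>n. c l \<noteq> 0) \<and> (\<forall>i\<le>n. (\<Sum>l\<le>n. M i l * c l) = 0))"
    unfolding h_eq_zero by (rule det_eq_0_iff_relation)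
  also have "(\<Sum>l\<le>n. M i l * c l) = 0 \<longleftrightarrow> (\<Sum>l\<le>n. c l * (d ^^ i) (rat (mvar l) (mvar j))) = 0" if "i \<le> n" for i c
  proof -
    have "(\<Sum>l\<le>n. c l * (d ^^ i) (rat (mvar l) (mvar j))) = of_nat (fact i) * (\<Sum>l\<le>n. M i l * c l)"
      unfolding D(2)[symmetric] M_def sum_distrib_left by (intro sum.cong refl) (simp add: mult_ac)
    moreover have "of_nat (fact i) \<noteq> (0 :: 'f)" using of_nat_fact_neq_0[of p i] p that CHAR_f by simp
    ultimately show ?thesis by simp
  qed
  hence "(\<exists>c. (\<exists>l\<le>n. c l \<noteq> 0) \<and> (\<forall>i\<le>n. (\<Sum>l\<le>n. M i l * c l) = 0)) \<longleftrightarrow>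
     (\<exists>c. (\<exists>l\<le>n. c l \<noteq> 0) \<and> (\<forall>i\<le>n. (\<Sum>l\<le>n. c l * (d ^^ i) (rat (mvar l) (mvar j))) = 0))" by simp
  finally show ?thesis .
qed

lemma alg_independent_empty: "S \<subseteq> carrier R \<Longrightarrow> alg_independent R S {}"
  unfolding alg_independent_def
proof (intro allI impI ballI)
  fix M :: "('k mpoly fract set \<Rightarrow>\<^sub>0 nat) set" and c m
  assume S: "S \<subseteq> carrier R" and m: "m \<in> M"
    and M: "finite M \<and> (\<forall>m\<in>M. keys m \<subseteq> {} \<and> c m \<in> S) \<and>
      (\<Oplus>\<^bsub>R\<^esub>m\<in>M. c m \<otimes>\<^bsub>R\<^esub> (\<Otimes>\<^bsub>R\<^esub>b\<in>keys m. b [^]\<^bsub>R\<^esub> lookup m b)) = \<zero>\<^bsub>R\<^esub>"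
  have z: "m' = 0" if "m' \<in> M" for m' using M that by auto
  hence "M = {0}" using m by blast
  moreover have "c 0 \<in> carrier R" using M S m z[OF m] by auto
  ultimately have "c 0 = \<zero>\<^bsub>R\<^esub>" using M by simp
  thus "c m = \<zero>\<^bsub>R\<^esub>" using z[OF m] by simp
qed

text \<open>
  Otherwise the empty set would be a separating transcendence basis over the function field of the image.
\<close>

lemma inseparable_imp_constant:
  assumes p: "p = CHAR('k)" "prime p" and perf: "surj (\<lambda>x::'k. x ^ p)"
    and sep: "separating_element n Z (h \<zeta>)" and d: "derivation d" "\<And>c. d (\<iota> c) = 0"
    and A: "\<And>i. A i \<in> forms n e" and insep: "inseparable_map n Z A"
    and ik: "i \<le> n" "k \<le> n" "\<not> vanishes_on (A k) Z"
  shows "d (rat (A i) (A k)) = 0"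
proof (rule ccontr)
  assume nz: "d (rat (A i) (A k)) \<noteq> 0"
  define T where "T = constants n Z \<union> {ratio n Z (A i) (A j) | i j. i \<le> n \<and> j \<le> n \<and> \<not> vanishes_on (A j) Z}"
  define S where "S = image_field n Z A"
  have S_eq: "S = generate_field R T" by (simp add: S_def image_field_def T_def)
  have T: "T \<subseteq> carrier R" using constants_closed ratio_closed[OF Z A A] by (auto simp: T_def)
  have S: "subfield S R" unfolding S_eq by (rule R.generate_field_is_subfield[OF T])
  have TS: "T \<subseteq> S" unfolding S_eq by (auto intro: generate_field.incl)
  have "ratio n Z (A i) (A k) \<in> T" using ik by (auto simp: T_def)
  hence "h (rat (A i) (A k)) \<in> S" using TS h_rat[OF A A ik(3)] by auto
  moreover have "constants n Z \<subseteq> S" using TS by (auto simp: T_def)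
  ultimately have sepel: "separable_element R S (h x)" for x
    using separable_over_nonconstant[OF p perf sep d nz S] by blast
  have gen: "generate_field R (S \<union> {}) = S"
    using R.generate_field_min_subfield1[OF subfieldE(3)[OF S] S] by (auto intro: generate_field.incl)
  have "separable_extension R S"
    unfolding separable_extension_def
  proof (intro exI[of _ "{}"] conjI ballI)
    show "alg_independent R S {}" by (rule alg_independent_empty[OF subfieldE(3)[OF S]])
    fix x assume "x \<in> carrier R"
    thus "separable_element R (generate_field R (S \<union> {})) x" using sepel[of "g x"] by (simp only: gen h_g)
  qed simp
  thus False using insep by (simp add: inseparable_map_def S_def)
qed

text \<open>
  Let \<open>w l\<close> be the partial derivatives of \<open>F\<close> divided by a nonvanishing one. Euler's identity is a relation
  \<open>\<Sum> w l * y l = 0\<close>. Because the \<open>w l\<close> are constants of \<open>d\<close>, it persists for all iterates of \<open>d\<close>.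
\<close>

theorem nonclassical_if_inseparable_gauss_map:
  fixes F :: "'k mpoly"
  assumes p: "p = CHAR('k)" "prime p" "n < p" and perf: "surj (\<lambda>x::'k. x ^ p)"
    and F: "F \<in> forms n e" "vanishes_on F Z" and k: "k \<le> n" "\<not> vanishes_on (mderiv k F) Z"
    and insep: "inseparable_map n Z (gauss_map F)" and od: "order_data n Z j \<zeta>' D"
  shows "nonclassical n Z j D"
proof -
  have j: "j \<le> n" "\<not> vanishes_on (mvar j :: 'k mpoly) Z" and sep': "separating_element n Z \<zeta>'"
    and D': "hasse_derivatives n Z \<zeta>' D" using od by (auto simp: order_data_def)
  define \<zeta> where "\<zeta> = g \<zeta>'"
  have h\<zeta>: "h \<zeta> = \<zeta>'" using sep' by (simp add: \<zeta>_def separating_element_def)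
  have sep: "separating_element n Z (h \<zeta>)" and hD: "hasse_derivatives n Z (h \<zeta>) D" using sep' D' h\<zeta> by simp_all
  obtain d where d: "derivation d" "\<And>c. d (\<iota> c) = 0" "d \<zeta> = 1"
    and D: "\<And>k x. D k (h x) = h (g (D k (h x)))" "\<And>k x. of_nat (fact k) * g (D k (h x)) = (d ^^ k) x"
    using hasse_model[OF hD sep] by blast
  interpret derivation d by (rule d)
  interpret E: comm_ring_hom "ev j" by (rule ev_hom)
  define y where "y l = rat (mvar l :: 'k mpoly) (mvar j)" for l
  define w where "w l = rat (mderiv l F) (mderiv k F)" for l
  have gf: "gauss_map F i \<in> forms n (e - 1)" for i unfolding gauss_map_def by (rule forms_mderiv[OF F(1)])
  have dw: "d (w l) = 0" if "l \<le> n" for l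
    using inseparable_imp_constant[OF p(1,2) perf sep d(1,2) gf insep that k(1)] k(2)
    by (simp add: w_def gauss_map_def)
  have w_eq: "w l = ev j (mderiv l F) / ev j (mderiv k F)" for l
    unfolding w_def by (rule rat_eq_ev[OF j forms_mderiv[OF F(1)] forms_mderiv[OF F(1)] k(2)])
  have y_eq: "y l = ev j (mvar l)" for l by (simp add: y_def ev_def peval_var[OF \<iota>_hom])
  have nz: "ev j (mderiv k F) \<noteq> 0" using ev_eq_0_iff[OF j forms_mderiv[OF F(1)]] k(2) by simp
  have "(\<Sum>l\<le>n. ev j (mvar l) * ev j (mderiv l F)) = ev j (\<Sum>l\<le>n. mvar l * mderiv l F)"
    by (simp add: E.hom_sum E.hom_mult)
  also have "\<dots> = ev j (of_nat e) * ev j F" unfolding euler_identity[OF F(1)] E.hom_mult ..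
  also have "ev j F = 0" using ev_eq_0_iff[OF j F(1)] F(2) by simp
  finally have "(\<Sum>l\<le>n. w l * y l) * ev j (mderiv k F) = 0"
    unfolding w_eq y_eq sum_distrib_right using nz by (simp add: mult.commute)
  hence zero: "(\<Sum>l\<le>n. w l * y l) = 0" using nz by simp
  have rel: "(\<Sum>l\<le>n. w l * (d ^^ i) (y l)) = 0" for i
  proof (induction i)
    case 0 show ?case using zero by simp
  next
    case (Suc i)
    have "0 = d (\<Sum>l\<le>n. w l * (d ^^ i) (y l))" using Suc by simp
    also have "\<dots> = (\<Sum>l\<le>n. w l * (d ^^ Suc i) (y l))"
      unfolding sum mult by (intro sum.cong refl) (simp add: dw)
    finally show ?case by simp
  qed
  have "w k = 1" using nz by (simp add: w_eq)
  hence "\<exists>c. (\<exists>l\<le>n. c l \<noteq> 0) \<and> (\<forall>i\<le>n. (\<Sum>l\<le>n. c l * (d ^^ i) (rat (mvar l) (mvar j))) = 0)"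
    using rel k(1) by (intro exI[of _ w] conjI exI[of _ k]) (simp_all add: y_def)
  thus ?thesis using classical_iff[OF p j D] by simp
qed

text \<open>
  The Wronskian vanishes, so there is a relation \<open>\<Sum> w l * y l = 0\<close> with constants \<open>w l = (u l)\<^sup>p\<close> of \<open>d\<close>. Writing the \<open>u l\<close>
  with a common denominator turns it into the equation.
\<close>

theorem pth_power_equation_if_nonclassical:
  assumes p: "p = CHAR('k)" "prime p" "n < p" and perf: "surj (\<lambda>x::'k. x ^ p)"
    and od: "order_data n Z j \<zeta>' D" and nc: "nonclassical n Z j D"
  shows "\<exists>A e. (\<forall>l\<le>n. A l \<in> forms n e) \<and> vanishes_on (\<Sum>l\<le>n. A l ^ p * mvar l) Z \<and>
    (\<exists>l\<le>n. \<not> vanishes_on (A l :: 'k mpoly) Z)"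
proof -
  have j: "j \<le> n" "\<not> vanishes_on (mvar j :: 'k mpoly) Z" and sep': "separating_element n Z \<zeta>'"
    and D': "hasse_derivatives n Z \<zeta>' D" using od by (auto simp: order_data_def)
  define \<zeta> where "\<zeta> = g \<zeta>'"
  have h\<zeta>: "h \<zeta> = \<zeta>'" using sep' by (simp add: \<zeta>_def separating_element_def)
  have sep: "separating_element n Z (h \<zeta>)" and hD: "hasse_derivatives n Z (h \<zeta>) D" using sep' D' h\<zeta> by simp_all
  obtain d where d: "derivation d" "\<And>c. d (\<iota> c) = 0" "d \<zeta> = 1"
    and D: "\<And>k x. D k (h x) = h (g (D k (h x)))" "\<And>k x. of_nat (fact k) * g (D k (h x)) = (d ^^ k) x"
    using hasse_model[OF hD sep] by blast
  interpret E: comm_ring_hom "ev j" by (rule ev_hom)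
  define y where "y l = rat (mvar l :: 'k mpoly) (mvar j)" for l
  have y_eq: "y l = ev j (mvar l)" for l by (simp add: y_def ev_def peval_var[OF \<iota>_hom])
  obtain c where c: "\<exists>l\<le>n. c l \<noteq> 0" "\<forall>i\<le>n. (\<Sum>l\<le>n. c l * (d ^^ i) (y l)) = 0"
    using classical_iff[OF p j D] nc unfolding y_def by blast
  have le: "{..<Suc n} = {..n}" by auto
  have "\<exists>w. (\<exists>l<Suc n. w l \<noteq> 0) \<and> (\<forall>l<Suc n. d (w l) = 0) \<and> (\<Sum>l<Suc n. w l * y l) = 0"
    by (rule wronskian_dependence[OF d(1), of "Suc n" c]) (use c in \<open>simp_all add: le less_Suc_eq_le\<close>)
  then obtain w where w: "\<exists>l\<le>n. w l \<noteq> 0" "\<And>l. l \<le> n \<Longrightarrow> d (w l) = 0" "(\<Sum>l\<le>n. w l * y l) = 0"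
    by (auto simp: le less_Suc_eq_le)
  have "\<forall>l. \<exists>u. l \<le> n \<longrightarrow> w l = u ^ p" using pth_power_if_constant[OF p(1,2) perf sep d w(2)] by blast
  then obtain u where u: "\<And>l. l \<le> n \<Longrightarrow> w l = u l ^ p" by metis
  have "\<forall>l. \<exists>G H d. u l = ev j G / ev j H \<and> G \<in> forms n d \<and> H \<in> forms n d \<and> \<not> vanishes_on H Z"
    using element_eq_quotient[OF j] by metis
  then obtain G H dg where GH: "\<And>l. u l = ev j (G l) / ev j (H l)" "\<And>l. G l \<in> forms n (dg l)"
    "\<And>l. H l \<in> forms n (dg l)" "\<And>l. \<not> vanishes_on (H l) Z" by metis
  have H0: "ev j (H l) \<noteq> 0" for l using ev_eq_0_iff[OF j GH(3)] GH(4) by simp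
  define B where "B = (\<Prod>l\<le>n. H l)"
  define A where "A l = G l * (\<Prod>m\<in>{..n} - {l}. H m)" for l
  define e where "e = sum dg {..n}"
  have Af: "A l \<in> forms n e" if "l \<le> n" for l
  proof -
    have "A l \<in> forms n (dg l + sum dg ({..n} - {l}))"
      unfolding A_def by (intro forms_mult forms_prod GH)
    thus ?thesis using that by (simp add: e_def sum.remove[of "{..n}" l])
  qed
  have B0: "ev j B \<noteq> 0" by (simp add: B_def E.hom_prod H0)
  have uA: "ev j (A l) = u l * ev j B" if "l \<le> n" for l
    using that H0[of l] by (simp add: A_def B_def GH(1) E.hom_mult E.hom_prod prod.remove[of "{..n}" l])
  have "ev j (\<Sum>l\<le>n. A l ^ p * mvar l) = (\<Sum>l\<le>n. (w l * y l) * ev j B ^ p)"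
    unfolding E.hom_sum
    by (intro sum.cong refl) (simp add: E.hom_mult E.hom_power uA u y_eq power_mult_distrib)
  also have "\<dots> = 0" by (simp add: w(3) flip: sum_distrib_right)
  finally have "ev j (\<Sum>l\<le>n. A l ^ p * mvar l) = 0" .
  moreover have "(\<Sum>l\<le>n. A l ^ p * mvar l) \<in> forms n (p * e + 1)"
    by (intro forms_sum forms_mult forms_power forms_var Af) auto
  ultimately have "vanishes_on (\<Sum>l\<le>n. A l ^ p * mvar l) Z" using ev_eq_0_iff[OF j] by blast
  moreover obtain l where l: "l \<le> n" "w l \<noteq> 0" using w(1) by blast
  hence "u l \<noteq> 0" using u[OF l(1)] p(2) by (auto simp: prime_gt_0_nat)
  hence "\<not> vanishes_on (A l) Z" using uA[OF l(1)] B0 ev_eq_0_iff[OF j Af[OF l(1)]] by simp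
  ultimately show ?thesis using Af l(1) by blast
qed

end

section \<open>The dimension of a hypersurface\<close>
lemma forms_coeff_collect:
  fixes F :: "'a::comm_ring_1 mpoly"
  assumes F: "F \<in> forms n e" shows "Polynomial.coeff (collect v F) D \<in> forms n (e - D)"
proof -
  let ?x = "\<lambda>i. if i = v then [:0, 1:] else [:mvar i :: 'a mpoly:]"
  interpret c: comm_ring_hom "\<lambda>c :: 'a mpoly. [:c:]" by (rule const_poly_hom)
  have mono: "mono_eval ?x m = Polynomial.monom (\<Prod>i\<in>keys m - {v}. mvar i ^ lookup m i) (lookup m v)" for m
  proof -
    have "mono_eval ?x m = (\<Prod>i\<in>insert v (keys m). ?x i ^ lookup m i)"
      by (rule mono_eval_superset) auto
    also have "\<dots> = ?x v ^ lookup m v * (\<Prod>i\<in>keys m - {v}. ?x i ^ lookup m i)"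
      by (subst prod.insert_remove) auto
    also have "(\<Prod>i\<in>keys m - {v}. ?x i ^ lookup m i)
        = [:\<Prod>i\<in>keys m - {v}. mvar i ^ lookup m i:]"
      unfolding c.hom_prod by (intro prod.cong refl) (simp add: poly_const_pow)
    finally show ?thesis by (simp add: monom_altdef mult.commute)
  qed
  have "Polynomial.coeff ([:mconst (lookup F m):] * mono_eval ?x m) D \<in> forms n (e - D)"
    if m: "m \<in> keys F" for m
  proof (cases "lookup m v = D")
    case True
    have d: "tdeg m = e" and sub: "keys m \<subseteq> {..n}" using m F by (auto simp: forms_eq polys_in_def)
    have "tdeg m = (\<Sum>i\<in>insert v (keys m). lookup m i)"
      by (rule tdeg_superset) auto
    also have "\<dots> = D + (\<Sum>i\<in>keys m - {v}. lookup m i)"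
      by (subst sum.insert_remove) (auto simp: True)
    finally have "e - D = 0 + (\<Sum>i\<in>keys m - {v}. lookup m i)" using d by simp
    moreover have "mconst (lookup F m) * (\<Prod>i\<in>keys m - {v}. mvar i ^ lookup m i)
        \<in> forms n (0 + (\<Sum>i\<in>keys m - {v}. lookup m i))"
      using sub by (intro forms_mult forms_const forms_prod forms_var_power) auto
    ultimately show ?thesis using True by (simp add: mono)
  qed (simp add: mono)
  thus ?thesis unfolding collect_def peval_def coeff_sum by (rule forms_sum)
qed

lemma ratio_power:
  assumes Z: "variety n Z" and "G \<in> forms n d" "H \<in> forms n d" "\<not> vanishes_on H Z"
  shows "ratio n Z G H [^]\<^bsub>function_field n Z\<^esub> (k::nat) = ratio n Z (G ^ k) (H ^ k)"
proof (induction k)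
  case 0
  show ?case using ratio_one[OF Z] by simp
next
  case (Suc k)
  interpret R: field "function_field n Z" by (rule function_field_field[OF Z])
  have nv: "\<not> vanishes_on (H ^ k) Z" using vanishes_on_power_iff[OF Z assms(3)] assms(4) by blast
  show ?case
    using ratio_mult[OF Z forms_power[OF assms(2), of k] forms_power[OF assms(3), of k] nv assms(2-4)] Suc
    by (simp add: mult.commute)
qed

context function_field_model
begin

text \<open>
  Let \<open>X v\<close> be a variable that occurs in \<open>F\<close>, and divide by another variable \<open>X k\<close>. A relation between the other
  coordinate functions becomes a form without \<open>X v\<close> that vanishes on \<open>Z\<close>, which \<open>F\<close> cannot divide unless it is
  zero. The equation \<open>F = 0\<close> makes the coordinate function of \<open>X v\<close> algebraic over the others.
\<close>

theorem hypersurface_dimension: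
  assumes F: "F \<in> forms n e" "irreducible F" and I: "\<And>G. G \<in> polys_in {..n} \<Longrightarrow> vanishes_on G Z \<longleftrightarrow> F dvd G"
    and nondeg: "nondegenerate n Z" and n: "n \<ge> 1"
  shows "has_dimension n Z (n - 1)"
proof -
  obtain v where v: "v \<in> {..n}" "vdeg v F > 0"
    using irreducible_involves_variable[OF formsD[OF F(1)] F(2)] by blast
  define k where "k = (if v = 0 then 1 else 0 :: nat)"
  have k: "k \<le> n" "k \<noteq> v" using n by (auto simp: k_def)
  have linear: "\<not> vanishes_on L Z" if L: "L \<in> forms n 1" "L \<noteq> 0" for L :: "'k mpoly"
  proof
    assume "vanishes_on L Z"
    hence "Z \<subseteq> zero_locus n {base_change L}" using subset_zero_locus_form[OF variety_proj_space[OF Z]] by blast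
    moreover have "base_change L \<noteq> 0"
      using L(2) by (metis keys_base_change keys_zero keys_eq_empty)
    ultimately show False using nondeg L(1) base_change_forms unfolding nondegenerate_def by blast
  qed
  have free: "\<not> vanishes_on G Z" if "G \<in> polys_in ({..n} - {v})" "G \<noteq> 0" for G
  proof
    assume "vanishes_on G Z"
    hence "F dvd G" using I[of G] that(1) polys_in_mono[of "{..n} - {v}" "{..n}"] by blast
    hence "F \<in> polys_in ({..n} - {v})" using polys_in_dvd that by blast
    hence "F \<in> polys_in (- {v})" using polys_in_mono[of "{..n} - {v}" "- {v}"] by auto
    thus False using v(2) vdeg_eq_0_iff[of v F] by simp
  qed
  have xk: "\<not> vanishes_on (mvar k :: 'k mpoly) Z" by (rule linear[OF forms_var[OF k(1)]]) simp
  define y where "y = (\<lambda>i. rat (mvar i :: 'k mpoly) (mvar k))"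
  have ev_k: "ev k = peval \<iota> y" by (simp add: ev_def y_def)
  have yk: "y k = 1" unfolding y_def by (rule rat_self[OF forms_var[OF k(1)] xk])
  define J where "J = {..n} - {v, k}"
  define B where "B = (\<lambda>i. h (y i)) ` J"
  have finJ: "finite J" by (simp add: J_def)
  have inj: "inj_on (\<lambda>i. h (y i)) J"
  proof (rule inj_onI, rule ccontr)
    fix i l assume il: "i \<in> J" "l \<in> J" "h (y i) = h (y l)" "i \<noteq> l"
    have fi: "(mvar i :: 'k mpoly) \<in> forms n 1" "(mvar l :: 'k mpoly) \<in> forms n 1"
      using il by (intro forms_var; simp add: J_def)+
    have "rat (mvar i) (mvar k) = rat (mvar l) (mvar k)" using il(3) by (simp add: inj_h y_def)
    hence "vanishes_on (mvar i * mvar k - mvar l * mvar k :: 'k mpoly) Z"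
      using rat_eq_iff[OF fi(1) forms_var[OF k(1)] xk fi(2) forms_var[OF k(1)] xk] by blast
    hence "vanishes_on ((mvar i - mvar l) * mvar k :: 'k mpoly) Z" by (simp add: left_diff_distrib)
    moreover have diff: "(mvar i - mvar l :: 'k mpoly) \<in> forms n 1"
      using forms_add[OF fi(1) forms_uminus[OF fi(2)]] by simp
    ultimately have "vanishes_on (mvar i - mvar l :: 'k mpoly) Z"
      using vanishes_on_mult_iff[OF Z diff forms_var[OF k(1)]] xk by blast
    moreover have "(mvar i :: 'k mpoly) \<noteq> mvar l"
    proof
      assume "(mvar i :: 'k mpoly) = mvar l"
      hence "keys (mvar i :: 'k mpoly) = keys (mvar l :: 'k mpoly)" by simp
      hence "single i (1::nat) = single l 1" by (simp add: mvar_def)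
      hence "keys (single i (1::nat)) = keys (single l (1::nat))" by simp
      thus False using il(4) by simp
    qed
    ultimately show False using linear[OF diff] by simp
  qed
  have BR: "B \<subseteq> carrier R" by (auto simp: B_def)
  have cardB: "card B = n - 1"
    unfolding B_def card_image[OF inj] using v(1) k by (simp add: J_def card_Diff_subset)
  have finB: "finite B" using finJ by (simp add: B_def)
  have indep: "alg_independent R (constants n Z) B"
    unfolding alg_independent_def
  proof (intro allI impI)
    fix M :: "('k mpoly fract set \<Rightarrow>\<^sub>0 nat) set" and c
    assume M: "finite M \<and> (\<forall>m\<in>M. keys m \<subseteq> B \<and> c m \<in> constants n Z) \<and>
      (\<Oplus>\<^bsub>R\<^esub>m\<in>M. c m \<otimes>\<^bsub>R\<^esub> (\<Otimes>\<^bsub>R\<^esub>b\<in>keys m. b [^]\<^bsub>R\<^esub> lookup m b)) = \<zero>\<^bsub>R\<^esub>"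
    have finM: "finite M" and keysM: "\<And>m. m \<in> M \<Longrightarrow> keys m \<subseteq> B" using M by auto
    have "\<exists>\<kappa>. \<forall>m\<in>M. c m = h (\<iota> (\<kappa> m))" 
    proof (intro bchoice ballI)
      fix m assume "m \<in> M"
      hence "c m \<in> h ` range \<iota>" using M constants_eq by auto
      thus "\<exists>\<kappa>. c m = h (\<iota> \<kappa>)" by blast
    qed
    then obtain \<kappa> where \<kappa>: "\<And>m. m \<in> M \<Longrightarrow> c m = h (\<iota> (\<kappa> m))" by blast
    define E where "E m = (\<Sum>i\<in>J. single i (lookup m (h (y i))))"
      for m :: "'k mpoly fract set \<Rightarrow>\<^sub>0 nat"
    have lookup_E: "lookup (E m) i = (if i \<in> J then lookup m (h (y i)) else 0)" for m i
      unfolding E_def lookup_sum using finJ by (simp add: lookup_single when_def)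
    have keysE: "keys (E m) \<subseteq> J" for m by (auto simp: in_keys_iff lookup_E split: if_splits)
    \<comment> \<open>Any common bound of the degrees serves for homogenising with \<open>X k\<close>.\<close>
    define N where "N = (\<Sum>m\<in>M. tdeg (E m))"
    have N: "tdeg (E m) \<le> N" if "m \<in> M" for m
      unfolding N_def by (rule member_le_sum[OF that]) (simp_all add: finM)
    define xp where "xp m = E m + single k (N - tdeg (E m))" for m
    have injX: "inj_on xp M"
    proof (rule inj_onI, rule poly_mapping_eqI)
      fix m m' b assume m: "m \<in> M" "m' \<in> M" "xp m = xp m'"
      show "lookup m b = lookup m' b"
      proof (cases "b \<in> B")
        case True
        then obtain i where i: "i \<in> J" "b = h (y i)" by (auto simp: B_def)
        hence "i \<noteq> k" by (auto simp: J_def)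
        hence "lookup (xp m'') i = lookup m'' b" for m''
          using i by (simp add: xp_def lookup_add lookup_E lookup_single when_def)
        thus ?thesis using m(3) by metis
      next
        case False
        thus ?thesis using keysM m(1,2) by (metis in_keys_iff subsetD)
      qed
    qed
    define r where "r = (\<Sum>m\<in>M. single (xp m) (\<kappa> m))"
    have keysX: "keys (xp m) \<subseteq> {..n} - {v}" for m
      unfolding xp_def keys_add_nat using keysE[of m] k by (auto simp: J_def split: if_splits)
    have r_free: "r \<in> polys_in ({..n} - {v})" unfolding r_def by (intro polys_in_sum polys_in_single keysX)
    have r_form: "r \<in> forms n N"
      unfolding r_def
    proof (rule forms_sum)
      fix m assume "m \<in> M"
      hence "tdeg (xp m) = N" using N by (simp add: xp_def tdeg_add)
      thus "single (xp m) (\<kappa> m) \<in> forms n N"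
        using keysX[of m] by (auto simp: forms_eq intro!: polys_in_single)
    qed
    have mono: "h (mono_eval y (xp m)) = (\<Otimes>\<^bsub>R\<^esub>b\<in>keys m. b [^]\<^bsub>R\<^esub> lookup m b)" if m: "m \<in> M" for m
    proof -
      have sub: "keys m \<subseteq> carrier R" using keysM[OF m] BR by blast
      have "mono_eval y (xp m) = (\<Prod>i\<in>J. y i ^ lookup m (h (y i)))"
        unfolding xp_def mono_eval_add by (simp add: yk mono_eval_superset[OF finJ keysE] lookup_E)
      also have "\<dots> = (\<Prod>b\<in>B. g b ^ lookup m b)"
        unfolding B_def prod.reindex[OF inj] by simp
      also have "\<dots> = (\<Prod>b\<in>keys m. g b ^ lookup m b)"
        by (rule prod.mono_neutral_right) (use finB keysM[OF m] in \<open>auto simp: in_keys_iff\<close>)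
      finally have "h (mono_eval y (xp m)) = (\<Otimes>\<^bsub>R\<^esub>b\<in>keys m. h (g b ^ lookup m b))"
        by (simp only: h_prod finite_keys)
      also have "\<dots> = (\<Otimes>\<^bsub>R\<^esub>b\<in>keys m. b [^]\<^bsub>R\<^esub> lookup m b)"
        using sub by (intro R.finprod_cong'[OF refl]) (auto simp: h_power subset_iff)
      finally show ?thesis .
    qed
    have "h (ev k r) = h (\<Sum>m\<in>M. \<iota> (\<kappa> m) * mono_eval y (xp m))"
      unfolding ev_k r_def by (simp add: peval_sum[OF \<iota>_hom] peval_single[OF \<iota>_hom])
    also have "\<dots> = (\<Oplus>\<^bsub>R\<^esub>m\<in>M. h (\<iota> (\<kappa> m) * mono_eval y (xp m)))" by (rule h_sum[OF finM])
    also have "\<dots> = (\<Oplus>\<^bsub>R\<^esub>m\<in>M. c m \<otimes>\<^bsub>R\<^esub> (\<Otimes>\<^bsub>R\<^esub>b\<in>keys m. b [^]\<^bsub>R\<^esub> lookup m b))"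
    proof (rule R.finsum_cong'[OF refl])
      show "(\<lambda>m. c m \<otimes>\<^bsub>R\<^esub> (\<Otimes>\<^bsub>R\<^esub>b\<in>keys m. b [^]\<^bsub>R\<^esub> lookup m b)) \<in> M \<rightarrow> carrier R"
        by (rule Pi_I) (simp add: \<kappa> flip: mono)
    qed (simp add: h_mult mono \<kappa>)
    also have "\<dots> = \<zero>\<^bsub>R\<^esub>" using M by simp
    finally have "ev k r = 0" by (simp only: h_eq_zero)
    hence "vanishes_on r Z" using ev_eq_0_iff[OF k(1) xk r_form] by blast
    hence r0: "r = 0" using free[OF r_free] by blast
    show "\<forall>m\<in>M. c m = \<zero>\<^bsub>R\<^esub>"
    proof
      fix m assume m: "m \<in> M"
      have "lookup r (xp m) = (\<Sum>m'\<in>M. if m' = m then \<kappa> m' else 0)"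
        unfolding r_def lookup_sum
        by (intro sum.cong refl) (use inj_onD[OF injX _ _ m] in \<open>auto simp: lookup_single when_def\<close>)
      hence "\<kappa> m = 0" using finM m r0 by simp
      thus "c m = \<zero>\<^bsub>R\<^esub>" using \<kappa>[OF m] h_zero by simp
    qed
  qed
  define E where "E = generate_field R (constants n Z \<union> B)"
  have E: "subfield E R" unfolding E_def by (rule R.generate_field_is_subfield) (use constants_closed BR in auto)
  have CE: "constants n Z \<subseteq> E" and BE: "B \<subseteq> E" unfolding E_def by (auto intro: generate_field.incl)
  have yE: "h (y i) \<in> E" if "i \<in> {..n} - {v}" for i
  proof (cases "i = k")
    case True thus ?thesis using subringE(3)[OF subfieldE(1)[OF E]] yk h_one by simp
  next
    case False thus ?thesis using that BE by (auto simp: B_def J_def)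
  qed
  have vE: "(R.algebraic over E) (h (y v))"
  proof -
    define q where "q = map_poly (ev k) (collect v F)"
    have c: "Polynomial.coeff (collect v F) i \<in> polys_in ({..n} - {v})" for i
      by (rule coeff_collect_in[OF formsD[OF F(1)]])
    have qc: "Polynomial.coeff q i = ev k (Polynomial.coeff (collect v F) i)" for i
      by (simp add: q_def coeff_map_poly ev_k peval_0[OF \<iota>_hom])
    have "h (Polynomial.coeff q i) \<in> E" for i
      unfolding qc ev_k by (rule peval_in_subfield[OF E CE c yE])
    moreover have "q \<noteq> 0"
    proof
      assume "q = 0"
      hence "ev k (Polynomial.lead_coeff (collect v F)) = 0" using qc[of "vdeg v F"] by simp
      hence "vanishes_on (Polynomial.lead_coeff (collect v F)) Z"
        using ev_eq_0_iff[OF k(1) xk forms_coeff_collect[OF F(1)]] by blast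
      moreover have "F \<noteq> 0" using F(2) by auto
      ultimately show False using free[OF c] by simp
    qed
    moreover have "poly q (y v) = 0"
    proof -
      have "vanishes_on F Z" using I[OF formsD[OF F(1)]] by simp
      hence "ev k F = 0" using ev_eq_0_iff[OF k(1) xk F(1)] by blast
      thus ?thesis using peval_collect[OF \<iota>_hom, of y F v] by (simp add: q_def ev_k)
    qed
    ultimately show ?thesis using algebraic_if_poly[of q E "y v"] by (simp add: over_def)
  qed
  let ?A = "{x \<in> carrier R. (R.algebraic over E) x}"
  have A: "subfield ?A R" by (rule R.subfield_of_algebraics[OF E])
  have EA: "E \<subseteq> ?A" using R.algebraic_self[OF subfieldE(1)[OF E]] subfieldE(3)[OF E] by auto
  have yA: "h (y i) \<in> ?A" if "i \<in> {..n}" for i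
    using that yE[of i] EA vE by (cases "i = v") auto
  have evA: "h (ev k G) \<in> ?A" if "G \<in> polys_in {..n}" for G
    unfolding ev_k by (rule peval_in_subfield[OF A _ that yA]) (use CE EA in auto)
  have all: "R.algebraic E x" if x: "x \<in> carrier R" for x
  proof -
    obtain G H d where GH: "g x = ev k G / ev k H" "G \<in> forms n d" "H \<in> forms n d"
      by (rule element_eq_quotient[OF k(1) xk])
    have "h (ev k G) \<in> ?A" "h (ev k H) \<in> ?A" using evA formsD GH by blast+
    hence "h (g x) \<in> ?A"
      using subfield_set_of_subfield[OF A] unfolding GH(1) divide_inverse subfield_set_def by blast
    thus ?thesis using x by (simp add: over_def)
  qed
  show ?thesis
    unfolding has_dimension_def has_transcendence_degree_def
    using BR finB cardB indep all unfolding E_def by (intro exI[of _ B]) auto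
qed

end

section \<open>Curves and hypersurfaces\<close>
text \<open>
  The three results obtained from a field type, as closed statements about a variety.
\<close>

definition inseparability_claim :: "nat \<Rightarrow> (nat \<Rightarrow> 'k::field alg_closure) set set \<Rightarrow> bool" where
  "inseparability_claim n Z \<longleftrightarrow> (\<forall>p (F :: 'k mpoly) e k j \<zeta> D.
     p = CHAR('k) \<and> prime p \<and> n < p \<and> surj (\<lambda>x::'k. x ^ p) \<and> F \<in> forms n e \<and> vanishes_on F Z \<and>
     k \<le> n \<and> \<not> vanishes_on (mderiv k F) Z \<and> inseparable_map n Z (gauss_map F) \<and> order_data n Z j \<zeta> D
     \<longrightarrow> nonclassical n Z j D)"

definition equation_claim :: "nat \<Rightarrow> (nat \<Rightarrow> 'k::field alg_closure) set set \<Rightarrow> bool" where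
  "equation_claim n Z \<longleftrightarrow> (\<forall>p j \<zeta> D.
     p = CHAR('k) \<and> prime p \<and> n < p \<and> surj (\<lambda>x::'k. x ^ p) \<and> order_data n Z j \<zeta> D \<and> nonclassical n Z j D
     \<longrightarrow> (\<exists>(A :: nat \<Rightarrow> 'k mpoly) e. (\<forall>l\<le>n. A l \<in> forms n e) \<and>
            vanishes_on (\<Sum>l\<le>n. A l ^ p * mvar l) Z \<and> (\<exists>l\<le>n. \<not> vanishes_on (A l) Z)))"

definition dimension_claim :: "nat \<Rightarrow> (nat \<Rightarrow> 'k::field alg_closure) set set \<Rightarrow> bool" where
  "dimension_claim n Z \<longleftrightarrow> (\<forall>(F :: 'k mpoly) e.
     F \<in> forms n e \<and> irreducible F \<and> (\<forall>G\<in>polys_in {..n}. vanishes_on G Z \<longleftrightarrow> F dvd G) \<and>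
     nondegenerate n Z \<and> n \<ge> 1 \<longrightarrow> has_dimension n Z (n - 1))"

definition claims :: "nat \<Rightarrow> (nat \<Rightarrow> 'k::field alg_closure) set set \<Rightarrow> bool" where
  "claims n Z \<longleftrightarrow> inseparability_claim n Z \<and> equation_claim n Z \<and> dimension_claim n Z"

lemma (in function_field_model) claims_hold: "claims n Z"
  unfolding claims_def inseparability_claim_def equation_claim_def dimension_claim_def
proof (intro conjI allI impI; (elim conjE)?)
  fix p :: nat and F :: "'k mpoly" and e k j \<zeta> D
  assume "p = CHAR('k)" "prime p" "n < p" "surj (\<lambda>x::'k. x ^ p)" "F \<in> forms n e" "vanishes_on F Z"
    "k \<le> n" "\<not> vanishes_on (mderiv k F) Z" "inseparable_map n Z (gauss_map F)" "order_data n Z j \<zeta> D"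
  thus "nonclassical n Z j D" by (rule nonclassical_if_inseparable_gauss_map)
next
  fix p :: nat and j \<zeta> D
  assume "p = CHAR('k)" "prime p" "n < p" "surj (\<lambda>x::'k. x ^ p)" "order_data n Z j \<zeta> D" "nonclassical n Z j D"
  thus "\<exists>(A :: nat \<Rightarrow> 'k mpoly) e. (\<forall>l\<le>n. A l \<in> forms n e) \<and>
            vanishes_on (\<Sum>l\<le>n. A l ^ p * mvar l) Z \<and> (\<exists>l\<le>n. \<not> vanishes_on (A l) Z)"
    by (rule pth_power_equation_if_nonclassical)
next
  fix F :: "'k mpoly" and e
  assume "F \<in> forms n e" "irreducible F" "\<forall>G\<in>polys_in {..n}. vanishes_on G Z \<longleftrightarrow> F dvd G"
    "nondegenerate n Z" "n \<ge> 1"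
  thus "has_dimension n Z (n - 1)" using hypersurface_dimension by blast
qed

lemma variety_point: "variety 0 (proj_space 0 :: (nat \<Rightarrow> 'k::field alg_closure) set set)"
proof -
  have 1: "(\<lambda>i. if i = 0 then 1 else 0 :: 'k alg_closure) \<in> proj_vecs 0" by (auto simp: proj_vecs_def)
  have ray: "ray x = ray y" if "x \<in> proj_vecs 0" "y \<in> proj_vecs 0" for x y :: "nat \<Rightarrow> 'k alg_closure"
  proof -
    have "ray x \<subseteq> ray y" if xy: "x \<in> proj_vecs 0" "y \<in> proj_vecs 0" for x y :: "nat \<Rightarrow> 'k alg_closure"
    proof
      fix z assume "z \<in> ray x"
      then obtain c where c: "c \<noteq> 0" "z = (\<lambda>i. c * x i)" by (auto simp: ray_def)
      have "z = (\<lambda>i. (c * x 0 / y 0) * y i)"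
      proof
        fix i show "z i = (c * x 0 / y 0) * y i"
          using xy c by (cases "i = 0") (auto simp: proj_vecs_def)
      qed
      moreover have "c * x 0 / y 0 \<noteq> 0" using xy c by (auto simp: proj_vecs_def)
      ultimately show "z \<in> ray y" unfolding ray_def by blast
    qed
    thus ?thesis using that by blast
  qed
  obtain P where P: "proj_space 0 = {P :: (nat \<Rightarrow> 'k alg_closure) set}"
    using ray 1 unfolding proj_space_eq by blast
  have "(proj_space 0 :: (nat \<Rightarrow> 'k alg_closure) set set) = zero_locus 0 (base_change ` ({} :: 'k mpoly set))"
    by (simp add: zero_locus_def)
  moreover have "zariski_irreducible 0 (proj_space 0 :: (nat \<Rightarrow> 'k alg_closure) set set)"
    unfolding zariski_irreducible_def P by simp
  ultimately show ?thesis unfolding variety_def by (intro conjI exI[of _ "{}"]) auto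
qed

type_synonym 'k embedded = "nat \<times> (nat \<Rightarrow> 'k alg_closure) set set"

text \<open>
  A type cannot depend on a variety, so a single variety is chosen for which a field type is built: one that
  violates the claims if there is any, and the point \<open>proj_space 0\<close> otherwise. The claims hold for the chosen one because
  of its field type, and therefore for all.
\<close>

definition critical :: "'k::field embedded" where
  "critical = (if \<exists>Y :: 'k embedded. variety (fst Y) (snd Y) \<and> \<not> claims (fst Y) (snd Y)
     then SOME Y. variety (fst Y) (snd Y) \<and> \<not> claims (fst Y) (snd Y) else (0, proj_space 0))"

lemma variety_critical:
  "variety (fst (critical :: 'k::field embedded)) (snd (critical :: 'k embedded))"
proof (cases "\<exists>Y :: 'k embedded. variety (fst Y) (snd Y) \<and> \<not> claims (fst Y) (snd Y)")
  case True
  have "variety (fst (critical :: 'k embedded)) (snd (critical :: 'k embedded)) \<and>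
      \<not> claims (fst (critical :: 'k embedded)) (snd (critical :: 'k embedded))"
    unfolding critical_def if_P[OF True] by (rule someI_ex[OF True])
  thus ?thesis ..
next
  case False
  show ?thesis unfolding critical_def if_not_P[OF False] using variety_point by simp
qed

abbreviation critical_ring :: "'k::field mpoly fract set ring" where
  "critical_ring \<equiv> function_field (fst (critical :: 'k embedded)) (snd (critical :: 'k embedded))"

lemma critical_ring_field: "field (critical_ring :: 'k::field mpoly fract set ring)"
  by (rule function_field_field[OF variety_critical])

typedef (overloaded) 'k critical_field = "carrier (critical_ring :: 'k::field mpoly fract set ring)"
proof -
  interpret field "critical_ring :: 'k mpoly fract set ring" by (rule critical_ring_field)
  show ?thesis using zero_closed by blast
qed

setup_lifting type_definition_critical_field

instantiation critical_field :: (field) field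
begin

context
  fixes R :: "'a mpoly fract set ring"
  defines "R \<equiv> critical_ring"
begin

interpretation field R unfolding R_def by (rule critical_ring_field)

lift_definition zero_critical_field :: "'a critical_field" is "ring.zero R"
  by (fold R_def) simp

lift_definition one_critical_field :: "'a critical_field" is "monoid.one R"
  by (fold R_def) simp

lift_definition plus_critical_field :: "'a critical_field \<Rightarrow> 'a critical_field \<Rightarrow> 'a critical_field" is "ring.add R"
  by (fold R_def) simp

lift_definition times_critical_field :: "'a critical_field \<Rightarrow> 'a critical_field \<Rightarrow> 'a critical_field" is "monoid.mult R"
  by (fold R_def) simp

lift_definition uminus_critical_field :: "'a critical_field \<Rightarrow> 'a critical_field" is "a_inv R"
  by (fold R_def) simp

lift_definition minus_critical_field :: "'a critical_field \<Rightarrow> 'a critical_field \<Rightarrow> 'a critical_field" is "a_minus R"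
  by (fold R_def) simp

lift_definition inverse_critical_field :: "'a critical_field \<Rightarrow> 'a critical_field"
  is "\<lambda>x. if x = ring.zero R then ring.zero R else m_inv R x"
  by (fold R_def) (auto simp: field_Units)

lift_definition divide_critical_field :: "'a critical_field \<Rightarrow> 'a critical_field \<Rightarrow> 'a critical_field"
  is "\<lambda>x y. monoid.mult R x (if y = ring.zero R then ring.zero R else m_inv R y)"
  by (fold R_def) (auto simp: field_Units)

end

instance
proof -
  define R where "R = (critical_ring :: 'a mpoly fract set ring)"
  interpret field R unfolding R_def by (rule critical_ring_field)
  show "OFCLASS('a critical_field, field_class)"
  proof (standard, goal_cases)
    case 1 show ?case by (transfer, fold R_def) (rule m_assoc)
  next
    case 2 show ?case by (transfer, fold R_def) (rule m_comm)
  next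
    case 3 show ?case by (transfer, fold R_def) (rule l_one)
  next
    case 4 show ?case by (transfer, fold R_def) (rule a_assoc)
  next
    case 5 show ?case by (transfer, fold R_def) (rule a_comm)
  next
    case 6 show ?case by (transfer, fold R_def) (rule l_zero)
  next
    case 7 show ?case by (transfer, fold R_def) (rule l_neg)
  next
    case 8 show ?case by (transfer, fold R_def) (rule a_minus_def)
  next
    case 9 show ?case by (transfer, fold R_def) (rule l_distr)
  next
    case 10 show ?case by (transfer, fold R_def) (rule zero_not_one)
  next
    case 11 thus ?case by (transfer, fold R_def) (auto simp: field_Units)
  next
    case 12 show ?case by (transfer, fold R_def) simp
  next
    case 13 show ?case by (transfer, fold R_def) simp
  qed
qed

end

lemma claims_critical:
  "claims (fst (critical :: 'k::field embedded)) (snd (critical :: 'k embedded))"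
proof -
  interpret function_field_model "fst (critical :: 'k embedded)"
    "snd (critical :: 'k embedded)" "Rep_critical_field :: 'k critical_field \<Rightarrow> _"
  proof unfold_locales
    show "variety (fst (critical :: 'k embedded)) (snd (critical :: 'k embedded))"
      by (rule variety_critical)
    show "bij_betw Rep_critical_field UNIV (carrier (critical_ring :: 'k mpoly fract set ring))"
      using type_definition.Rep_range[OF type_definition_critical_field]
      by (simp add: bij_betw_def inj_on_def Rep_critical_field_inject)
  qed (rule plus_critical_field.rep_eq times_critical_field.rep_eq one_critical_field.rep_eq)+
  show ?thesis by (rule claims_hold)
qed

theorem claims_variety:
  assumes "variety n Z" shows "claims n (Z :: (nat \<Rightarrow> 'k::field alg_closure) set set)"
proof (rule ccontr)
  assume "\<not> claims n Z"
  hence ex: "\<exists>Y :: 'k embedded. variety (fst Y) (snd Y) \<and> \<not> claims (fst Y) (snd Y)"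
    using assms by (intro exI[of _ "(n, Z)"]) simp
  have "variety (fst (critical :: 'k embedded)) (snd (critical :: 'k embedded)) \<and>
      \<not> claims (fst (critical :: 'k embedded)) (snd (critical :: 'k embedded))"
    unfolding critical_def if_P[OF ex] by (rule someI_ex[OF ex])
  thus False using claims_critical by blast
qed

lemma vanishes_on_mono: "vanishes_on F S \<Longrightarrow> C \<subseteq> S \<Longrightarrow> vanishes_on F C"
  by (auto simp: vanishes_on_def)

text \<open>
  Of the homogeneous divisors of \<open>F0\<close> that vanish on \<open>C\<close>, one of least degree is irreducible, since one of any two factors
  vanishes on \<open>C\<close> again.
\<close>

lemma exists_irreducible_divisor_vanishing:
  fixes F0 :: "'k::field mpoly"
  assumes C: "variety n C" and F0: "F0 \<in> forms n d" "F0 \<noteq> 0" "vanishes_on F0 C"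
  shows "\<exists>F e. F \<in> forms n e \<and> irreducible F \<and> F dvd F0 \<and> vanishes_on F C"
proof -
  let ?Q = "\<lambda>F. (\<exists>e. F \<in> forms n e) \<and> F dvd F0 \<and> vanishes_on F C"
  define F where "F = arg_min gdeg ?Q"
  have "?Q F0" using F0 by auto
  hence F: "?Q F" and least: "\<And>G. ?Q G \<Longrightarrow> gdeg F \<le> gdeg G"
    unfolding F_def using arg_min_nat_lemma[of ?Q F0 gdeg] by blast+
  obtain e where e: "F \<in> forms n e" using F by blast
  have Fnz: "F \<noteq> 0" using F F0(2) by auto
  have "irreducible F"
    unfolding irreducible_def
  proof (intro conjI allI impI)
    show "F \<noteq> 0" by (rule Fnz)
    show "\<not> F dvd 1"
    proof
      assume "F dvd 1"
      then obtain c where "c \<noteq> 0" "F = mconst c" by (auto simp: unit_mpoly_iff)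
      thus False using F vanishes_on_const[OF C] by blast
    qed
    fix a b assume ab: "F = a * b"
    have unit: "b dvd 1" if ab: "F = a * b" and van: "vanishes_on a C" for a b
    proof -
      have "\<exists>e. a \<in> forms n e" using forms_factor[of a b n e] e Fnz ab by simp
      moreover have "a dvd F0" using F ab by (meson dvd_trans dvd_triv_left)
      ultimately have "gdeg F \<le> gdeg a" using least van by blast
      moreover have "a \<noteq> 0" "b \<noteq> 0" using ab Fnz by auto
      ultimately have "gdeg b = 0" using gdeg_mult[of a b] ab by simp
      then obtain c where "b = mconst c" by (rule gdeg_eq_0)
      thus ?thesis using \<open>b \<noteq> 0\<close> by (auto simp: unit_mpoly_iff)
    qed
    obtain e1 where e1: "a \<in> forms n e1" using forms_factor[of a b n e] e Fnz ab by auto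
    obtain e2 where e2: "b \<in> forms n e2"
      using forms_factor[of b a n e] e Fnz ab by (auto simp: mult.commute)
    have "vanishes_on a C \<or> vanishes_on b C" using F ab vanishes_on_mult_iff[OF C e1 e2] by blast
    thus "a dvd 1 \<or> b dvd 1"
    proof
      assume "vanishes_on a C" thus ?thesis using unit[OF ab] by blast
    next
      assume "vanishes_on b C"
      moreover have "F = b * a" using ab by (simp only: mult.commute)
      ultimately show ?thesis using unit by blast
    qed
  qed
  thus ?thesis using F e by blast
qed

lemma mderiv_pth_power_equation:
  fixes A :: "nat \<Rightarrow> 'k::field mpoly"
  assumes p: "CHAR('k) = p" and i: "i \<le> n"
  shows "mderiv i (\<Sum>l\<le>n. A l ^ p * mvar l) = A i ^ p"
proof -
  have "(of_nat p :: 'k mpoly) = single 0 (of_nat p)" by simp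
  also have "\<dots> = 0" by (simp only: p[symmetric] of_nat_CHAR single_zero)
  finally have p0: "(of_nat p :: 'k mpoly) = 0" .
  have "mderiv i (\<Sum>l\<le>n. A l ^ p * mvar l) = (\<Sum>l\<le>n. if l = i then A i ^ p else 0)"
    unfolding mderiv_sum by (intro sum.cong refl) (simp add: mderiv_mult mderiv_power mderiv_var p0)
  thus ?thesis using i by simp
qed

text \<open>
  Where \<open>F = 0\<close>, the product rule for \<open>F * G\<close> says that the partial derivatives of \<open>F\<close> are proportional to the \<open>(A i)\<^sup>p\<close>, with
  factor \<open>G\<close>.
\<close>

lemma gauss_map_of_divisor:
  fixes F G :: "'k::field mpoly"
  assumes S: "variety n S" and F: "F \<in> forms n d" "vanishes_on F S"
    and A: "\<And>l. l \<le> n \<Longrightarrow> A l \<in> forms n e" and k: "k \<le> n" "\<not> vanishes_on (A k) S"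
    and Fk: "\<not> vanishes_on (mderiv k F) S"
    and eq: "\<And>i. i \<le> n \<Longrightarrow> A i ^ p = F * mderiv i G + mderiv i F * G"
  shows "gauss_map_admits_powers p n S F"
  unfolding gauss_map_admits_powers_def has_coordinate_functions_def gauss_map_def
proof (intro exI[of _ "\<lambda>i. ratio n S (A i) (A k)"] conjI allI impI)
  interpret R: field "function_field n S" by (rule function_field_field[OF S])
  note Ak = A[OF k(1)]
  have pow: "ratio n S (A i) (A k) [^]\<^bsub>function_field n S\<^esub> p = ratio n S (A i ^ p) (A k ^ p)" if "i \<le> n" for i
    by (rule ratio_power[OF S A[OF that] Ak k(2)])
  have nvp: "\<not> vanishes_on (A k ^ p) S" using vanishes_on_power_iff[OF S Ak] k(2) by blast
  show cl: "ratio n S (A i) (A k) \<in> carrier (function_field n S)" if "i \<le> n" for i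
    by (rule ratio_closed[OF S A[OF that] Ak k(2)])
  show "ratio n S (A i) (A k) [^]\<^bsub>function_field n S\<^esub> p \<in> carrier (function_field n S)" if "i \<le> n" for i
    using cl[OF that] by simp
  show "\<exists>i\<le>n. ratio n S (A i) (A k) [^]\<^bsub>function_field n S\<^esub> p \<noteq> \<zero>\<^bsub>function_field n S\<^esub>"
    using k(1) pow[OF k(1)] ratio_eq_0_iff[OF S forms_power[OF Ak] forms_power[OF Ak] nvp] nvp
    by (intro exI[of _ k]) simp
  show "\<exists>j\<le>n. \<not> vanishes_on (mderiv j F) S" using k(1) Fk by blast
  fix i j assume ij: "i \<le> n" "j \<le> n" "\<not> vanishes_on (mderiv j F) S"
  note dF = forms_mderiv[OF F(1)]
  have nv: "\<not> vanishes_on (mderiv j F * A k ^ p) S"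
    using vanishes_on_mult_iff[OF S dF forms_power[OF Ak]] ij(3) nvp by blast
  have "ratio n S (mderiv i F) (mderiv j F) \<otimes>\<^bsub>function_field n S\<^esub> ratio n S (A j ^ p) (A k ^ p)
      = ratio n S (mderiv i F * A j ^ p) (mderiv j F * A k ^ p)"
    by (rule ratio_mult[OF S dF dF ij(3) forms_power[OF A[OF ij(2)]] forms_power[OF Ak] nvp])
  also have "\<dots> = ratio n S (A i ^ p) (A k ^ p)"
  proof (subst ratio_eq_iff[OF S forms_mult[OF dF forms_power[OF A[OF ij(2)]]] forms_mult[OF dF forms_power[OF Ak]] nv
        forms_power[OF A[OF ij(1)]] forms_power[OF Ak] nvp])
    have "mderiv i F * A j ^ p * A k ^ p - A i ^ p * (mderiv j F * A k ^ p)
        = F * ((mderiv i F * mderiv j G - mderiv i G * mderiv j F) * A k ^ p)"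
      unfolding eq[OF ij(1)] eq[OF ij(2)] by (simp add: algebra_simps)
    thus "vanishes_on (mderiv i F * A j ^ p * A k ^ p - A i ^ p * (mderiv j F * A k ^ p)) S"
      using vanishes_on_multI(1)[OF F(2)] by simp
  qed
  finally show "ratio n S (A i) (A k) [^]\<^bsub>function_field n S\<^esub> p
      = ratio n S (mderiv i F) (mderiv j F) \<otimes>\<^bsub>function_field n S\<^esub> (ratio n S (A j) (A k) [^]\<^bsub>function_field n S\<^esub> p)"
    using pow ij by simp
qed

theorem proposition3p1:
  fixes n p :: nat
  assumes "n \<ge> 2" and "perfect_field TYPE('k::field)" and "CHAR('k) = p" and "p > n"
  shows
    "(\<forall>(S :: (nat \<Rightarrow> 'k alg_closure) set set) F C j \<zeta> D.
        hypersurface n S \<and> nondegenerate n S \<and> defined_by n S F \<and>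
        curve n C \<and> C \<subseteq> S \<and>
        \<not> C \<subseteq> sing_locus n S F \<and>
        inseparable_map n C (gauss_map F) \<and>
        order_data n C j \<zeta> D
        \<longrightarrow> nonclassical n C j D) \<and>
     (alg_closed_type TYPE('k) \<longrightarrow>
       (\<forall>(C :: (nat \<Rightarrow> 'k alg_closure) set set) j \<zeta> D.
          curve n C \<and> order_data n C j \<zeta> D \<and> nonclassical n C j D \<longrightarrow>
          (\<exists>S F. hypersurface n S \<and> nondegenerate n S \<and> defined_by n S F \<and>
             C \<subseteq> S \<and>
             gauss_map_admits_powers p n S F \<and>
             \<not> C \<subseteq> sing_locus n S F)))"
proof -
  have p0: "p > 0" using assms(4) by simp
  have p: "p = CHAR('k)" "prime p" "n < p"
    using assms(3,4) prime_CHAR_semidom[where 'a = 'k] by auto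
  have perf: "surj (\<lambda>x::'k. x ^ p)" using assms(2,3) p0 by (auto simp: perfect_field_def)
  show ?thesis
  proof (intro conjI allI impI; elim conjE)
    fix S C :: "(nat \<Rightarrow> 'k alg_closure) set set" and F j \<zeta> D
    assume S: "defined_by n S F" and C: "curve n C" "C \<subseteq> S" "\<not> C \<subseteq> sing_locus n S F"
      and insep: "inseparable_map n C (gauss_map F)" and od: "order_data n C j \<zeta> D"
    have var: "variety n C" using C(1) by (simp add: curve_def)
    obtain d where F: "F \<in> forms n d" using S by (auto simp: defined_by_def)
    have "F * 1 \<in> {F * G | G. G \<in> polys n}" by (intro CollectI exI[of _ 1]) (simp add: polys_eq)
    also have "{F * G | G. G \<in> polys n} = {G \<in> polys n. vanishes_on G S}"
      using S unfolding defined_by_def by blast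
    finally have "vanishes_on F S" by simp
    hence van: "vanishes_on F C" using C(2) by (rule vanishes_on_mono)
    obtain P where P: "P \<in> C" "P \<notin> sing_locus n S F" using C(3) by blast
    then obtain k where k: "k \<le> n" "\<not> vanishes_at (base_change (mderiv k F)) P"
      using C(2) by (auto simp: sing_locus_def)
    hence "\<not> vanishes_on (mderiv k F) C" using P(1) by (auto simp: vanishes_on_def)
    moreover have "inseparability_claim n C" using claims_variety[OF var] by (simp add: claims_def)
    ultimately show "nonclassical n C j D"
      unfolding inseparability_claim_def using p perf F van k(1) insep od by blast
  next
    fix C :: "(nat \<Rightarrow> 'k alg_closure) set set" and j \<zeta> D
    assume ac: "alg_closed_type TYPE('k)" and C: "curve n C"
      and od: "order_data n C j \<zeta> D" "nonclassical n C j D"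
    have var: "variety n C" and nondegC: "nondegenerate n C" using C by (simp_all add: curve_def)
    have n1: "n \<ge> 1" using assms(1) by simp
    have "equation_claim n C" using claims_variety[OF var] by (simp add: claims_def)
    then obtain A :: "nat \<Rightarrow> 'k mpoly" and e k where A: "\<And>l. l \<le> n \<Longrightarrow> A l \<in> forms n e"
      "vanishes_on (\<Sum>l\<le>n. A l ^ p * mvar l) C" "k \<le> n" "\<not> vanishes_on (A k) C"
      unfolding equation_claim_def using p perf od by blast
    define F0 where "F0 = (\<Sum>l\<le>n. A l ^ p * mvar l)"
    have der: "mderiv i F0 = A i ^ p" if "i \<le> n" for i
      unfolding F0_def by (rule mderiv_pth_power_equation[OF assms(3) that])
    have nvp: "\<not> vanishes_on (A k ^ p) C" using vanishes_on_power_iff[OF var A(1)[OF A(3)]] A(4) by blast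
    have F0_form: "F0 \<in> forms n (p * e + 1)"
      unfolding F0_def by (intro forms_sum forms_mult forms_power forms_var A) auto
    have F0_nz: "F0 \<noteq> 0" using der[OF A(3)] nvp by (metis mderiv_0 vanishes_on_0)
    obtain F d where F: "F \<in> forms n d" "irreducible F" "F dvd F0" "vanishes_on F C"
      using exists_irreducible_divisor_vanishing[OF var F0_form F0_nz] A(2) unfolding F0_def by blast
    obtain G where G: "F0 = F * G" using F(3) by (rule dvdE)
    have eq: "A i ^ p = F * mderiv i G + mderiv i F * G" if "i \<le> n" for i
      using der[OF that] by (simp add: G mderiv_mult)
    define S where "S = zero_locus n {base_change F}"
    have CS: "C \<subseteq> S"
      unfolding S_def using subset_zero_locus_form[OF variety_proj_space[OF var]] F(4) by blast
    have varS: "variety n S" unfolding S_def by (rule variety_hypersurface[OF ac n1 F(1,2)])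
    have nondegS: "nondegenerate n S" using nondegC CS unfolding nondegenerate_def by blast
    have van: "vanishes_on H S \<longleftrightarrow> F dvd H" if "H \<in> polys_in {..n}" for H
      unfolding S_def by (rule vanishes_on_hypersurface[OF n1 F(1,2) that])
    have "dimension_claim n S" using claims_variety[OF varS] by (simp add: claims_def)
    hence "has_dimension n S (n - 1)"
      unfolding dimension_claim_def using F(1,2) van nondegS n1 by blast
    hence hyp: "hypersurface n S" using varS by (simp add: hypersurface_def)
    have def: "defined_by n S F" unfolding S_def by (rule defined_by_hypersurface[OF n1 F(1,2)])
    have FkC: "\<not> vanishes_on (mderiv k F) C"
    proof
      assume "vanishes_on (mderiv k F) C"
      hence "vanishes_on (A k ^ p) C"
        unfolding eq[OF A(3)] using F(4) by (intro vanishes_on_add vanishes_on_multI)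
      thus False using nvp by blast
    qed
    have "gauss_map_admits_powers p n S F"
    proof (rule gauss_map_of_divisor[OF varS F(1) _ A(1) A(3) _ _ eq])
      show "vanishes_on F S" using van[OF formsD[OF F(1)]] by simp
      show "\<not> vanishes_on (A k) S" using A(4) vanishes_on_mono[OF _ CS] by blast
      show "\<not> vanishes_on (mderiv k F) S" using FkC vanishes_on_mono[OF _ CS] by blast
    qed
    moreover have "\<not> C \<subseteq> sing_locus n S F"
      using FkC A(3) by (auto simp: vanishes_on_def sing_locus_def)
    ultimately show "\<exists>S F. hypersurface n S \<and> nondegenerate n S \<and> defined_by n S F \<and> C \<subseteq> S \<and>
        gauss_map_admits_powers p n S F \<and> \<not> C \<subseteq> sing_locus n S F"
      using hyp nondegS def CS by blast
  qed
qed

end
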